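(* Let $m,n\ge 0$ be integers, let $\mathcal X$ be a sequence of $n$ pairwise distinct complex variables and $\mathcal Y$ a sequence of $m$ complex variables. Let $\lambda$ be a partition with $(m,n)$-index $k$. Suppose that there are an integer $l$ with $0\le l\le \min\{n-k,n\}$ and partitions $\mu,\nu$ of lengths at most $l$ and $n-k-l$ respectively such that $\lambda_{[n-k]}=\mu\star_{l,n-k-l}\nu$. Then $$LS_{\lambda}(-\mathcal X;\mathcal Y)=\sum_{\mathcal S,\mathcal T}\frac{\varepsilon_{l,n-k-l}(\mu,\nu)\,LS_{\mu+\langle k^l\rangle}(-\mathcal S;\mathcal Y)\,LS_{\nu\cup\lambda_{(n+1-k,\,n+2-k,\dots)}}(-\mathcal T;\mathcal Y)}{\Delta(\mathcal T;\mathcal S)},$$ where the sum runs over all ways of splitting $\mathcal X$ into a subsequence $\mathcal S$ of length $l$ and the complementary subsequence $\mathcal T$ of length $n-l$.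
   Context: Partitions are non-increasing finite sequences of non-negative integers, identified when they differ by trailing zeros; $\lambda'$ is the conjugate partition; the Ferrers diagram of $\lambda$ is $\{(i,j)\in\mathbb Z^2: 1\le i\le\lambda_j\}$, with the convention that all points $(i,0)$ and $(0,i)$, $i\ge0$, also count as belonging to $\lambda$. For a sequence $\lambda$, $\lambda_{[j]}=(\lambda_1,\dots,\lambda_j)$ and $\lambda_{(j+1,j+2,\dots)}=(\lambda_{j+1},\lambda_{j+2},\dots)$; $\langle k^l\rangle$ is the partition with $l$ parts equal to $k$; sums of partitions are entrywise, and $\nu\cup\kappa$ denotes concatenation. For sequences of variables, $-\mathcal X$ is entrywise negation, $\Delta(\mathcal X;\mathcal Y)=\prod_{x\in\mathcal X,y\in\mathcal Y}(x-y)$. Littlewood–Schur functions: $LS_\lambda(\mathcal X;\mathcal Y)=\sum_{\mu,\nu}c^\lambda_{\mu\nu}\mathfrak s_\mu(\mathcal X)\mathfrak s_{\nu'}(\mathcal Y)$, where $\mathfrak s$ are Schur polynomials and $c^\lambda_{\mu\nu}$ Littlewood–Richardson coefficients. The $(m,n)$-index of $\lambda$ is the largest (possibly negative) integer $k\le\min\{m,n\}$ with $(m+1-k,n+1-k)\notin\lambda$. With $\rho_j=(j-1,\dots,1,0)$, the $(a,b)$-overlap $\mu\star_{a,b}\nu$ of partitions $\mu,\nu$ of lengths at most $a,b$ (viewed as sequences of lengths exactly $a,b$) is the partition $\kappa$ (of length at most $a+b$) such that $\kappa+\rho_{a+b}$ is a rearrangement of the concatenation $(\mu+\rho_a)\cup(\nu+\rho_b)$,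 if it exists; then $\varepsilon_{a,b}(\mu,\nu)$ is the sign of the permutation sorting $(\mu+\rho_a)\cup(\nu+\rho_b)$ into the strictly decreasing sequence $\kappa+\rho_{a+b}$. If no such partition exists, $\mu\star_{a,b}\nu=\infty$, $\varepsilon_{a,b}(\mu,\nu)=1$, and $LS_\infty:=0$. *)

theory Defs
  imports Complex_Main "HOL-Library.FuncSet" "HOL-Library.Multiset" "HOL-Combinatorics.Permutations"
begin

text \<open>A partition is a finitely supported non-increasing sequence of naturals, so that
  identification up to trailing zeros is equality. Indexing starts at 0: the part usually written
  with index \<open>i \<ge> 1\<close> is \<open>lam (i - 1)\<close>.\<close>

definition is_partition :: "(nat \<Rightarrow> nat) \<Rightarrow> bool" where
  "is_partition lam \<longleftrightarrow> antimono lam \<and> finite {i. lam i \<noteq> 0}"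

definition part_length :: "(nat \<Rightarrow> nat) \<Rightarrow> nat" where
  "part_length lam = card {i. lam i \<noteq> 0}"

definition part_size :: "(nat \<Rightarrow> nat) \<Rightarrow> nat" where
  "part_size lam = (\<Sum>i | lam i \<noteq> 0. lam i)"

definition conjugate :: "(nat \<Rightarrow> nat) \<Rightarrow> (nat \<Rightarrow> nat)" where
  "conjugate lam = (\<lambda>j. card {i. j < lam i})"

text \<open>The first coordinate of a point of the diagram is the column, the second the row; both are
  1-based, and the two half-axes are included by convention.\<close>

definition diagram :: "(nat \<Rightarrow> nat) \<Rightarrow> (int \<times> int) set" where
  "diagram lam = {(i, j). 1 \<le> j \<and> 1 \<le> i \<and> i \<le> int (lam (nat (j - 1)))}
     \<union> {(i, 0) | i. 0 \<le> i} \<union> {(0, i) | i. 0 \<le> i}"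

definition mn_index :: "nat \<Rightarrow> nat \<Rightarrow> (nat \<Rightarrow> nat) \<Rightarrow> int" where
  "mn_index m n lam = (GREATEST k. k \<le> min (int m) (int n) \<and>
     (int m + 1 - k, int n + 1 - k) \<notin> diagram lam)"

definition seq_take :: "nat \<Rightarrow> (nat \<Rightarrow> nat) \<Rightarrow> (nat \<Rightarrow> nat)" where
  "seq_take j lam = (\<lambda>i. if i < j then lam i else 0)"

definition seq_drop :: "nat \<Rightarrow> (nat \<Rightarrow> nat) \<Rightarrow> (nat \<Rightarrow> nat)" where
  "seq_drop j lam = (\<lambda>i. lam (i + j))"

text \<open>Concatenation, with the first sequence read as having length exactly \<open>b\<close>.\<close>

definition seq_append :: "nat \<Rightarrow> (nat \<Rightarrow> nat) \<Rightarrow> (nat \<Rightarrow> nat) \<Rightarrow> (nat \<Rightarrow> nat)" where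
  "seq_append b \<nu> \<kappa> = (\<lambda>i. if i < b then \<nu> i else \<kappa> (i - b))"

text \<open>The sum \<open>\<mu> + \<langle>k\<^sup>l\<rangle>\<close>, where \<open>k\<close> may be negative. The truncation by \<open>nat\<close> only matters if some
  \<open>\<mu> i + k\<close> with \<open>i < l\<close> is negative. This does not occur when \<open>k\<close> is the \<open>(m,n)\<close>-index of
  \<open>\<lambda>\<close> and the first \<open>n - k\<close> parts of \<open>\<lambda>\<close> are an overlap of \<open>\<mu>\<close> and some \<open>\<nu>\<close>: if \<open>k < 0\<close>, these
  parts are all at least \<open>m - k\<close>, hence so are the first \<open>l\<close> parts of \<open>\<mu>\<close>.\<close>

definition add_rect :: "(nat \<Rightarrow> nat) \<Rightarrow> int \<Rightarrow> nat \<Rightarrow> (nat \<Rightarrow> nat)" where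
  "add_rect \<mu> k l = (\<lambda>i. nat (int (\<mu> i) + (if i < l then k else 0)))"

text \<open>Schur polynomials as generating functions of semistandard tableaux. Cells are
  (row, column), 0-based; the entry \<open>t\<close> stands for the variable \<open>xs ! t\<close>.\<close>

definition cells :: "(nat \<Rightarrow> nat) \<Rightarrow> (nat \<times> nat) set" where
  "cells lam = {(i, j). j < lam i}"

definition ssyt :: "(nat \<Rightarrow> nat) \<Rightarrow> nat \<Rightarrow> (nat \<times> nat \<Rightarrow> nat) set" where
  "ssyt lam N = {T \<in> cells lam \<rightarrow>\<^sub>E {..<N}.
     (\<forall>i j. (i, Suc j) \<in> cells lam \<longrightarrow> T (i, j) \<le> T (i, Suc j)) \<and>
     (\<forall>i j. (Suc i, j) \<in> cells lam \<longrightarrow> T (i, j) < T (Suc i, j))}"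

definition schur :: "(nat \<Rightarrow> nat) \<Rightarrow> complex list \<Rightarrow> complex" where
  "schur lam xs = (\<Sum>T\<in>ssyt lam (length xs). \<Prod>c\<in>cells lam. xs ! T c)"

text \<open>Littlewood--Richardson coefficients as the structure constants
  \<open>s\<^sub>\<mu> s\<^sub>\<nu> = \<Sum>\<^sub>\<lambda> c\<^sup>\<lambda>\<^sub>\<mu>\<^sub>\<nu> s\<^sub>\<lambda>\<close> of the ring of symmetric functions. The expansion is required in every
  number of variables simultaneously, which makes the coefficients unique.\<close>

definition lr_coeffs :: "(nat \<Rightarrow> nat) \<Rightarrow> (nat \<Rightarrow> nat) \<Rightarrow> ((nat \<Rightarrow> nat) \<Rightarrow> int)" where
  "lr_coeffs \<mu> \<nu> = (THE c.
     finite {lam. c lam \<noteq> 0} \<and> (\<forall>lam. c lam \<noteq> 0 \<longrightarrow> is_partition lam) \<and>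
     (\<forall>xs. schur \<mu> xs * schur \<nu> xs = (\<Sum>lam | c lam \<noteq> 0. of_int (c lam) * schur lam xs)))"

text \<open>Since \<open>c\<^sup>\<lambda>\<^sub>\<mu>\<^sub>\<nu> = 0\<close> unless \<open>\<bar>\<mu>\<bar> + \<bar>\<nu>\<bar> = \<bar>\<lambda>\<bar>\<close>, the sum over all pairs of partitions is written
  over this finite set of pairs.\<close>

definition LS :: "(nat \<Rightarrow> nat) \<Rightarrow> complex list \<Rightarrow> complex list \<Rightarrow> complex" where
  "LS lam X Y = (\<Sum>(\<mu>, \<nu>) \<in> {(\<mu>, \<nu>). is_partition \<mu> \<and> is_partition \<nu> \<and>
       part_size \<mu> + part_size \<nu> = part_size lam}.
     of_int (lr_coeffs \<mu> \<nu> lam) * schur \<mu> X * schur (conjugate \<nu>) Y)"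

text \<open>The list \<open>\<mu> + \<rho>\<^sub>a\<close>, with \<open>\<mu>\<close> read as a sequence of length exactly \<open>a\<close>.\<close>

definition add_rho :: "nat \<Rightarrow> (nat \<Rightarrow> nat) \<Rightarrow> nat list" where
  "add_rho a \<mu> = map (\<lambda>i. \<mu> i + (a - 1 - i)) [0..<a]"

definition is_overlap :: "nat \<Rightarrow> nat \<Rightarrow> (nat \<Rightarrow> nat) \<Rightarrow> (nat \<Rightarrow> nat) \<Rightarrow> (nat \<Rightarrow> nat) \<Rightarrow> bool" where
  "is_overlap a b \<mu> \<nu> \<kappa> \<longleftrightarrow> is_partition \<kappa> \<and> part_length \<kappa> \<le> a + b \<and>
     mset (add_rho (a + b) \<kappa>) = mset (add_rho a \<mu> @ add_rho b \<nu>)"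

text \<open>The value \<open>None\<close> plays the role of \<open>\<infinity>\<close>.\<close>

definition overlap :: "nat \<Rightarrow> nat \<Rightarrow> (nat \<Rightarrow> nat) \<Rightarrow> (nat \<Rightarrow> nat) \<Rightarrow> (nat \<Rightarrow> nat) option" where
  "overlap a b \<mu> \<nu> = (if \<exists>\<kappa>. is_overlap a b \<mu> \<nu> \<kappa> then Some (THE \<kappa>. is_overlap a b \<mu> \<nu> \<kappa>) else None)"

definition overlap_sign :: "nat \<Rightarrow> nat \<Rightarrow> (nat \<Rightarrow> nat) \<Rightarrow> (nat \<Rightarrow> nat) \<Rightarrow> int" where
  "overlap_sign a b \<mu> \<nu> = (case overlap a b \<mu> \<nu> of
     None \<Rightarrow> 1
   | Some \<kappa> \<Rightarrow> sign (THE \<pi>. \<pi> permutes {..<a + b} \<and>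
       permute_list \<pi> (add_rho a \<mu> @ add_rho b \<nu>) = add_rho (a + b) \<kappa>))"

definition Delta :: "complex list \<Rightarrow> complex list \<Rightarrow> complex" where
  "Delta X Y = (\<Prod>x\<leftarrow>X. \<Prod>y\<leftarrow>Y. x - y)"

end

theory Submission
  imports "Jordan_Normal_Form.Determinant" "HOL-Computational_Algebra.Polynomial_FPS" Defs
begin

text \<open>Littlewood--Schur functions have a Jacobi--Trudi determinant: \<open>LS\<^sub>\<lambda>(-X; Y) = det (h\<^bsub>\<lambda>\<^sub>i - i + j\<^esub>)\<close>,
  where \<open>\<Sum> h\<^sub>r t\<^sup>r = \<Prod> (1 + y t) / \<Prod> (1 + x t)\<close>. For \<open>r > m - n\<close>, partial fractions write \<open>h\<^sub>r\<close> as a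
  combination of the powers \<open>(-x)\<^sup>r\<close>. By the definition of the index, all entries in the first
  \<open>n - k\<close> rows lie in this range. So a row \<open>i \<le> n - k\<close> expands into rows \<open>((-x)\<^sup>j)\<^sub>j\<close>, and column
  operations split off that row, leaving a Jacobi--Trudi determinant in \<open>X\<close> without \<open>x\<close>.
  Reordering the first \<open>n - k\<close> rows according to the overlap gives the sign, and doing this for
  the \<open>l\<close> rows that belong to \<open>\<mu>\<close> gives the sum over \<open>S\<close> and \<open>T\<close>.

  The determinant formula itself follows by comparing the coefficients of the alternants
  \<open>a\<^bsub>\<lambda> + \<rho>\<^esub>(z)\<close> in \<open>\<Prod> P(z\<^sub>i) Q(z\<^sub>i) a\<^sub>\<rho>(z)\<close>, expanded by the Cauchy identity once for the product
  \<open>P Q\<close> and once for \<open>P\<close> and \<open>Q\<close> separately.\<close>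

subsection \<open>Determinants\<close>

text \<open>Splitting off a row removes one variable and raises the offsets of the other rows by
  one, so the bound m - n + 1 required by partial fractions is inherited by the next row. After l
  rows the remaining offsets have risen by l and belong to \<nu> followed by the lower rows of
  \<lambda>. The contributions of the removed rows reassemble, by the same expansion read backwards
  for a set of l variables, into a determinant with offsets raised by n - l, and this produces \<mu>
  + k. The index acts from two sides: its lower bound on the first n - k parts gives the range of
  partial fractions, its upper bound on the next part makes \<nu> followed by the rest a partition.

  The obstacle is the definition of LS. Schur polynomials are tableau sums, so determinants are
  matched with them through branching; Littlewood-Richardson coefficients are a definite
  description, so existence and uniqueness come before any product formula. A single determinant
  \<open>jtp\<close> serves complete and elementary series alike, and thereby the conjugate in LS
  disappears.\<close>

definition detf :: "nat \<Rightarrow> (nat \<Rightarrow> nat \<Rightarrow> complex) \<Rightarrow> complex" where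
  "detf N f = det (mat N N (\<lambda>(i, j). f i j))"

lemma detf_expand:
  "detf N f = (\<Sum>p | p permutes {..<N}. of_int (sign p) * (\<Prod>i<N. f i (p i)))"
proof -
  have "detf N f = (\<Sum>p | p permutes {0..<N}. of_int (sign p) * (\<Prod>i = 0..<N. mat N N (\<lambda>(i, j). f i j) $$ (i, p i)))"
    unfolding detf_def by (rule det_def') simp
  also have "\<dots> = (\<Sum>p | p permutes {0..<N}. of_int (sign p) * (\<Prod>i = 0..<N. f i (p i)))"
    by (intro sum.cong refl arg_cong2[where f = "(*)"] prod.cong)
       (auto simp: permutes_in_image)
  finally show ?thesis by (simp add: atLeast0LessThan)
qed

lemma permutes_lessThan: "p permutes {..<N} \<Longrightarrow> i < N \<Longrightarrow> p i < N"
  using permutes_in_image[of p "{..<N}" i] by simp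

lemma detf_cong:
  "(\<And>i j. i < N \<Longrightarrow> j < N \<Longrightarrow> f i j = g i j) \<Longrightarrow> detf N f = detf N g"
  unfolding detf_def by (rule arg_cong[where f = det]) (auto intro!: eq_matI)

lemma detf_mult:
  "detf N A * detf N B = detf N (\<lambda>i j. \<Sum>k<N. A i k * B k j)"
proof -
  let ?A = "mat N N (\<lambda>(i, j). A i j)" and ?B = "mat N N (\<lambda>(i, j). B i j)"
  have "detf N A * detf N B = det (?A * ?B)"
    unfolding detf_def by (rule det_mult[symmetric]) auto
  also have "?A * ?B = mat N N (\<lambda>(i, j). \<Sum>k<N. A i k * B k j)"
    by (rule eq_matI) (auto simp: scalar_prod_def atLeast0LessThan)
  finally show ?thesis unfolding detf_def .
qed

lemma detf_transpose: "detf N (\<lambda>i j. f j i) = detf N f"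
proof -
  have "mat N N (\<lambda>(i, j). f j i) = transpose_mat (mat N N (\<lambda>(i, j). f i j))"
    by (rule eq_matI) auto
  thus ?thesis unfolding detf_def by (simp add: det_transpose[of _ N])
qed

text \<open>Multilinearity in all rows at once. The index set may vary with the row; a simultaneous
  choice \<open>g\<close> later becomes a partition or an exponent vector.\<close>

lemma detf_sum_rows:
  assumes "\<And>i. i < N \<Longrightarrow> finite (S i)"
  shows "detf N (\<lambda>i j. \<Sum>g\<in>S i. c i g * R i g j) =
    (\<Sum>g\<in>Pi\<^sub>E {..<N} S. (\<Prod>i<N. c i (g i)) * detf N (\<lambda>i j. R i (g i) j))"
proof -
  have "detf N (\<lambda>i j. \<Sum>g\<in>S i. c i g * R i g j) =
    (\<Sum>p | p permutes {..<N}. of_int (sign p) *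
       (\<Sum>g\<in>Pi\<^sub>E {..<N} S. \<Prod>i<N. c i (g i) * R i (g i) (p i)))"
    unfolding detf_expand
    by (intro sum.cong refl arg_cong2[where f = "(*)"] prod_sum_PiE) (use assms in auto)
  also have "\<dots> = (\<Sum>g\<in>Pi\<^sub>E {..<N} S. (\<Prod>i<N. c i (g i)) * detf N (\<lambda>i j. R i (g i) j))"
    unfolding detf_expand sum_distrib_left
    by (subst sum.swap) (simp add: prod.distrib mult_ac)
  finally show ?thesis .
qed

lemma detf_identical_rows:
  assumes "i < N" "i' < N" "i \<noteq> i'" "\<And>j. j < N \<Longrightarrow> f i j = f i' j"
  shows "detf N f = 0"
  unfolding detf_def
  by (rule det_identical_rows[of _ N i i']) (use assms in \<open>auto intro!: eq_vecI\<close>)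

lemma detf_zero_row:
  assumes "i < N" "\<And>j. j < N \<Longrightarrow> f i j = 0"
  shows "detf N f = 0"
  unfolding detf_expand
proof (intro sum.neutral ballI)
  fix p assume "p \<in> {p. p permutes {..<N}}"
  hence "p i < N" using assms(1) by (auto intro: permutes_lessThan)
  hence "(\<Prod>i<N. f i (p i)) = 0" using assms by (intro prod_zero) auto
  thus "of_int (sign p) * (\<Prod>i<N. f i (p i)) = 0" by simp
qed

lemma detf_upper_unitriangular:
  assumes "\<And>i. i < N \<Longrightarrow> f i i = 1" "\<And>i j. j < i \<Longrightarrow> i < N \<Longrightarrow> f i j = 0"
  shows "detf N f = 1"
proof -
  have "detf N f = prod_list (diag_mat (mat N N (\<lambda>(i, j). f i j)))"
    unfolding detf_def by (rule det_upper_triangular) (use assms in \<open>auto simp: upper_triangular_def\<close>)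
  also have "\<dots> = 1"
    using assms by (auto simp: diag_mat_def prod.list_conv_set_nth intro!: prod.neutral)
  finally show ?thesis .
qed

lemma detf_permute_rows:
  assumes "p permutes {..<N}"
  shows "detf N (\<lambda>i j. f (p i) j) = of_int (sign p) * detf N f"
proof -
  have "detf N (\<lambda>i j. f (p i) j) = det (mat N N (\<lambda>(i, j). mat N N (\<lambda>(i, j). f i j) $$ (p i, j)))"
    unfolding detf_def
    by (rule arg_cong[where f = det]) (use assms in \<open>auto intro!: eq_matI simp: permutes_lessThan\<close>)
  also have "\<dots> = of_int (sign p) * detf N f"
    unfolding detf_def by (rule det_permute_rows) (use assms in \<open>auto simp: atLeast0LessThan\<close>)
  finally show ?thesis .
qed

lemma detf_first_row_unit:
  assumes "\<And>j. j < Suc N \<Longrightarrow> f 0 j = (if j = 0 then 1 else 0)"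
  shows "detf (Suc N) f = detf N (\<lambda>i j. f (Suc i) (Suc j))"
proof -
  let ?M = "mat (Suc N) (Suc N) (\<lambda>(i, j). f i j)"
  have "detf (Suc N) f = (\<Sum>j<Suc N. ?M $$ (0, j) * cofactor ?M 0 j)"
    unfolding detf_def by (rule laplace_expansion_row) auto
  also have "\<dots> = (\<Sum>j<Suc N. if j = 0 then cofactor ?M 0 0 else 0)"
    using assms by (intro sum.cong) auto
  also have "\<dots> = det (mat_delete ?M 0 0)" by (simp add: cofactor_def)
  also have "mat_delete ?M 0 0 = mat N N (\<lambda>(i, j). f (Suc i) (Suc j))"
    by (rule eq_matI) (auto simp: mat_delete_def)
  finally show ?thesis unfolding detf_def .
qed

lemma detf_last_row_unit:
  assumes "\<And>j. j < Suc N \<Longrightarrow> f N j = (if j = N then 1 else 0)"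
  shows "detf (Suc N) f = detf N f"
proof -
  let ?M = "mat (Suc N) (Suc N) (\<lambda>(i, j). f i j)"
  have "detf (Suc N) f = (\<Sum>j<Suc N. ?M $$ (N, j) * cofactor ?M N j)"
    unfolding detf_def by (rule laplace_expansion_row) auto
  also have "\<dots> = (\<Sum>j<Suc N. if j = N then cofactor ?M N N else 0)"
    using assms by (intro sum.cong) auto
  also have "\<dots> = det (mat_delete ?M N N)" by (simp add: cofactor_def)
  also have "mat_delete ?M N N = mat N N (\<lambda>(i, j). f i j)"
    by (rule eq_matI) (auto simp: mat_delete_def)
  finally show ?thesis unfolding detf_def .
qed

lemma detf_sum_first_row:
  assumes "finite A"
  shows "detf (Suc N) (\<lambda>i j. if i = 0 then \<Sum>a\<in>A. c a * v a j else f i j) =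
    (\<Sum>a\<in>A. c a * detf (Suc N) (\<lambda>i j. if i = 0 then v a j else f i j))"
proof -
  have prod: "(\<Prod>i<Suc N. if i = 0 then h i else g i) = h 0 * (\<Prod>i<N. g (Suc i))" for h g :: "nat \<Rightarrow> complex"
    by (subst prod.lessThan_Suc_shift) simp
  show ?thesis
    unfolding detf_expand prod sum_distrib_left sum_distrib_right
    by (subst sum.swap) (simp add: mult_ac)
qed

subsection \<open>Jacobi--Trudi determinants\<close>

text \<open>Integer positions, with zero below 0, let the two-term recurrences hold without side
  conditions and make the negative Jacobi-Trudi entries vanish.\<close>

definition fc :: "complex fps \<Rightarrow> int \<Rightarrow> complex" where
  "fc H r = (if r < 0 then 0 else fps_nth H (nat r))"

lemma fc_neg [simp]: "r < 0 \<Longrightarrow> fc H r = 0" by (simp add: fc_def)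

lemma fc_0 [simp]: "fc H 0 = fps_nth H 0" by (simp add: fc_def)

lemma fc_int [simp]: "fc H (int n) = fps_nth H n" by (simp add: fc_def)

lemma fc_linear_mult: "fc ((1 + fps_const y * fps_X) * H) r = fc H r + y * fc H (r - 1)"
proof -
  have *: "(1 + fps_const y * fps_X) * H = H + fps_const y * (fps_X * H)"
    by (simp add: algebra_simps)
  show ?thesis
  proof (cases "r \<le> 0")
    case True thus ?thesis by (cases "r = 0") (auto simp: fc_def *)
  next
    case False
    then obtain k where "r = int (Suc k)" by (metis not_le zero_less_imp_eq_int gr0_implies_Suc)
    thus ?thesis by (simp add: fc_def * nat_add_distrib)
  qed
qed

lemma fc_geometric_mult:
  assumes "H' = inverse (1 - fps_const x * fps_X) * H"
  shows "fc H' r = fc H r + x * fc H' (r - 1)"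
proof -
  have "(1 - fps_const x * fps_X) * inverse (1 - fps_const x * fps_X) = 1"
    by (rule inverse_mult_eq_1') simp
  hence "H = (1 + fps_const (- x) * fps_X) * H'"
    by (simp add: assms mult.assoc[symmetric] fps_const_neg[symmetric] del: fps_const_neg)
  from arg_cong[OF this, of "\<lambda>H. fc H r"] show ?thesis by (simp only: fc_linear_mult) simp
qed

text \<open>The offsets are arbitrary integers, so that rows can be permuted, shifted and split off
  without leaving this form.\<close>

definition jt :: "nat \<Rightarrow> (nat \<Rightarrow> int) \<Rightarrow> complex fps \<Rightarrow> complex" where
  "jt N \<alpha> H = detf N (\<lambda>i j. fc H (\<alpha> i + int j))"

definition jtp :: "nat \<Rightarrow> (nat \<Rightarrow> nat) \<Rightarrow> complex fps \<Rightarrow> complex" where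
  "jtp N lam H = jt N (\<lambda>i. int (lam i) - int i) H"

text \<open>The added row has offset \<open>- N\<close>, so its only nonzero entry is the constant
  term 1 in the last column.\<close>

lemma jtp_Suc:
  assumes "lam N = 0" "fps_nth H 0 = 1"
  shows "jtp (Suc N) lam H = jtp N lam H"
  unfolding jtp_def jt_def by (rule detf_last_row_unit) (use assms in auto)

lemma jtp_stable:
  assumes "\<And>i. N \<le> i \<Longrightarrow> lam i = 0" "fps_nth H 0 = 1" "N \<le> M"
  shows "jtp M lam H = jtp N lam H"
  using assms(3) by (induction M rule: dec_induct) (auto simp: assms jtp_Suc)

subsection \<open>Partitions\<close>

lemma part_antimono: "is_partition lam \<Longrightarrow> i \<le> j \<Longrightarrow> lam j \<le> lam i"
  by (auto simp: is_partition_def antimono_def)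

text \<open>Turns cardinalities into comparisons: lengths, parts of a conjugate and shapes of
  subtableaux all count initial segments.\<close>

lemma downward_closed_lessThan:
  fixes S :: "nat set"
  assumes "finite S" "\<And>i j. j \<in> S \<Longrightarrow> i \<le> j \<Longrightarrow> i \<in> S"
  shows "S = {..<card S}"
proof -
  define n where "n = (LEAST n. n \<notin> S)"
  have "\<exists>n. n \<notin> S" using assms(1) ex_new_if_finite infinite_UNIV_nat by blast
  hence n: "n \<notin> S" unfolding n_def by (rule LeastI_ex)
  have "S = {..<n}"
  proof (rule Set.set_eqI)
    fix i show "i \<in> S \<longleftrightarrow> i \<in> {..<n}"
      using assms(2)[of i n] n not_less_Least[of i "\<lambda>n. n \<notin> S"]
      unfolding n_def[symmetric] by (auto intro: leI)
  qed
  thus ?thesis by (metis card_lessThan)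
qed

lemma part_support:
  assumes "is_partition lam"
  shows "{i. lam i \<noteq> 0} = {..<part_length lam}"
  unfolding part_length_def
proof (rule downward_closed_lessThan)
  show "finite {i. lam i \<noteq> 0}" using assms by (simp add: is_partition_def)
  fix i j assume "j \<in> {i. lam i \<noteq> 0}" "i \<le> j"
  thus "i \<in> {i. lam i \<noteq> 0}" using part_antimono[OF assms, of i j] by auto
qed

lemma part_zero: "is_partition lam \<Longrightarrow> part_length lam \<le> i \<Longrightarrow> lam i = 0"
  using arg_cong[OF part_support[of lam], of "\<lambda>A. i \<in> A"] by auto

lemma part_length_le_iff: "is_partition lam \<Longrightarrow> part_length lam \<le> N \<longleftrightarrow> lam N = 0"
  using arg_cong[OF part_support[of lam], of "\<lambda>A. N \<in> A"] by auto

lemma part_size_eq: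
  assumes "is_partition lam" "part_length lam \<le> N"
  shows "part_size lam = (\<Sum>i<N. lam i)"
  unfolding part_size_def part_support[OF assms(1)]
  by (rule sum.mono_neutral_left) (use assms in \<open>auto simp: part_zero[OF assms(1)]\<close>)

lemma part_length_le_size:
  assumes "is_partition lam"
  shows "part_length lam \<le> part_size lam"
proof -
  have "part_length lam = (\<Sum>i | lam i \<noteq> 0. 1)" by (simp add: part_length_def)
  also have "\<dots> \<le> part_size lam" unfolding part_size_def by (rule sum_mono) auto
  finally show ?thesis .
qed

lemma part_le_size:
  assumes "is_partition lam"
  shows "lam i \<le> part_size lam"
proof (cases "lam i = 0")
  case False
  thus ?thesis unfolding part_size_def
    using assms by (intro member_le_sum) (auto simp: is_partition_def)
qed auto

lemma part_ext:
  assumes "is_partition lam" "is_partition mu" "lam N = 0" "mu N = 0" "\<And>i. i < N \<Longrightarrow> lam i = mu i"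
  shows "lam = mu"
proof
  fix i show "lam i = mu i"
    using assms(5)[of i] part_antimono[OF assms(1), of N i] part_antimono[OF assms(2), of N i] assms(3,4)
    by (cases "i < N") auto
qed

text \<open>The partitions in a box of N rows and M columns; \<open>lam N = 0\<close> stands for at
  most N parts.\<close>

definition parts_in :: "nat \<Rightarrow> nat \<Rightarrow> (nat \<Rightarrow> nat) set" where
  "parts_in N M = {lam. is_partition lam \<and> lam N = 0 \<and> lam 0 \<le> M}"

lemma finite_parts_in: "finite (parts_in N M)"
proof -
  have "inj_on (\<lambda>lam. restrict lam {..<N}) (parts_in N M)"
  proof (rule inj_onI)
    fix a b assume ab: "a \<in> parts_in N M" "b \<in> parts_in N M" "restrict a {..<N} = restrict b {..<N}"
    show "a = b"
    proof (rule part_ext[of _ _ N])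
      fix i assume "i < N"
      thus "a i = b i" using fun_cong[OF ab(3), of i] by simp
    qed (use ab in \<open>auto simp: parts_in_def\<close>)
  qed
  moreover have "(\<lambda>lam. restrict lam {..<N}) ` parts_in N M \<subseteq> Pi\<^sub>E {..<N} (\<lambda>_. {..M})"
    by (auto simp: parts_in_def PiE_iff extensional_def split: if_splits intro: order_trans[OF part_antimono[of _ 0]])
  ultimately show ?thesis
    by (meson finite_PiE finite_atMost finite_imageD finite_lessThan finite_subset)
qed

lemma parts_of_size_in: "is_partition lam \<Longrightarrow> part_size lam \<le> N \<Longrightarrow> part_size lam \<le> M \<Longrightarrow> lam \<in> parts_in N M"
  using part_length_le_size[of lam] part_le_size[of lam 0] part_length_le_iff[of lam N]
  by (auto simp: parts_in_def)

subsection \<open>Conjugation\<close>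

lemma finite_row_gt: "is_partition lam \<Longrightarrow> finite {i. j < lam i}"
  by (rule finite_subset[of _ "{i. lam i \<noteq> 0}"]) (auto simp: is_partition_def)

text \<open>Rows and columns describe the same set of cells; the facts on conjugation below rest on
  this symmetry.\<close>

lemma less_conjugate_iff:
  fixes i j :: nat
  assumes "is_partition lam"
  shows "i < conjugate lam j \<longleftrightarrow> j < lam i"
proof -
  have "{i. j < lam i} = {..<conjugate lam j}"
    unfolding conjugate_def
  proof (rule downward_closed_lessThan)
    show "finite {i. j < lam i}" by (rule finite_row_gt[OF assms])
    fix i i' assume "i' \<in> {i. j < lam i}" "i \<le> i'"
    thus "i \<in> {i. j < lam i}" using part_antimono[OF assms, of i i'] by auto
  qed
  from arg_cong[OF this, of "\<lambda>A. i \<in> A"] show ?thesis by auto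
qed

lemma conjugate_partition:
  assumes "is_partition lam"
  shows "is_partition (conjugate lam)"
  unfolding is_partition_def
proof
  show "antimono (conjugate lam)"
  proof (rule antimonoI)
    fix x y :: nat assume "x \<le> y"
    thus "conjugate lam y \<le> conjugate lam x"
      unfolding conjugate_def by (intro card_mono finite_row_gt assms) auto
  qed
  have "{i. conjugate lam i \<noteq> 0} \<subseteq> {..<lam 0}"
    using less_conjugate_iff[OF assms, of 0] by auto
  thus "finite {i. conjugate lam i \<noteq> 0}" using finite_subset by blast
qed

lemma conjugate_conjugate: "is_partition lam \<Longrightarrow> conjugate (conjugate lam) = lam"
proof
  fix i assume p: "is_partition lam"
  have "j < conjugate (conjugate lam) i \<longleftrightarrow> j < lam i" for j
    using p by (simp add: less_conjugate_iff conjugate_partition)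
  from this[of "lam i"] this[of "conjugate (conjugate lam) i"]
  show "conjugate (conjugate lam) i = lam i" by simp
qed

lemma cells_conjugate: "is_partition lam \<Longrightarrow> cells (conjugate lam) = prod.swap ` cells lam"
  by (auto simp: cells_def less_conjugate_iff image_iff)

lemma cells_Sigma: "cells lam = Sigma {i. lam i \<noteq> 0} (\<lambda>i. {..<lam i})"
  by (auto simp: cells_def)

lemma finite_cells: "is_partition lam \<Longrightarrow> finite (cells lam)"
  unfolding cells_Sigma by (intro finite_SigmaI) (auto simp: is_partition_def)

lemma card_cells: "is_partition lam \<Longrightarrow> card (cells lam) = part_size lam"
  unfolding cells_Sigma by (subst card_SigmaI) (auto simp: is_partition_def part_size_def)

lemma part_size_conjugate: "is_partition lam \<Longrightarrow> part_size (conjugate lam) = part_size lam"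
  by (simp add: card_cells[symmetric] conjugate_partition cells_conjugate card_image)

text \<open>Inequalities between parts are implications between memberships of cells, and
  conjugation only transposes cells. This exchanges horizontal and vertical strips for the dual
  branching rule.\<close>

lemma horizontal_strip_conjugate_iff:
  assumes "is_partition ka" "is_partition nu"
  shows "(\<forall>i. conjugate nu (Suc i) \<le> conjugate ka i \<and> conjugate ka i \<le> conjugate nu i) \<longleftrightarrow>
    (\<forall>i. ka i \<le> nu i \<and> nu i \<le> Suc (ka i))" (is "?L \<longleftrightarrow> ?R")
proof -
  have le: "x \<le> y \<longleftrightarrow> (\<forall>j. j < x \<longrightarrow> j < y)" for x y :: nat
    by (meson leI less_le_trans order_less_irrefl)
  have "?L \<longleftrightarrow> (\<forall>i j. Suc i < nu j \<longrightarrow> i < ka j) \<and> (\<forall>i j. i < ka j \<longrightarrow> i < nu j)"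
    unfolding le by (auto simp: less_conjugate_iff assms)
  also have "(\<forall>i j. i < ka j \<longrightarrow> i < nu j) \<longleftrightarrow> (\<forall>j. ka j \<le> nu j)"
    unfolding le by blast
  also have "(\<forall>i j. Suc i < nu j \<longrightarrow> i < ka j) \<longleftrightarrow> (\<forall>j. nu j \<le> Suc (ka j))"
    by (meson Suc_less_eq leI less_le_trans order_less_irrefl)
  finally show ?thesis by blast
qed

subsection \<open>Branching of Schur polynomials\<close>

text \<open>The condition says that the skew shape \<open>lam\<close> / \<open>mu\<close> is a
  horizontal strip.\<close>

definition interlacing :: "(nat \<Rightarrow> nat) \<Rightarrow> (nat \<Rightarrow> nat) set" where
  "interlacing lam = {mu. is_partition mu \<and> (\<forall>i. lam (Suc i) \<le> mu i \<and> mu i \<le> lam i)}"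

lemma finite_interlacing: "is_partition lam \<Longrightarrow> finite (interlacing lam)"
proof (rule finite_subset[of _ "parts_in (part_length lam) (lam 0)"])
  assume *: "is_partition lam"
  show "interlacing lam \<subseteq> parts_in (part_length lam) (lam 0)"
    unfolding interlacing_def parts_in_def using part_zero[OF * order_refl]
    by (auto, metis le_zero_eq)
qed (rule finite_parts_in)

section \<open>Cutting a tableau at its largest admissible entry\<close>

definition tab_shape :: "(nat \<Rightarrow> nat) \<Rightarrow> nat \<Rightarrow> (nat \<times> nat \<Rightarrow> nat) \<Rightarrow> nat \<Rightarrow> nat" where
  "tab_shape lam N T = (\<lambda>i. card {j. j < lam i \<and> T (i, j) < N})"

definition tab_extend :: "(nat \<Rightarrow> nat) \<Rightarrow> nat \<Rightarrow> (nat \<Rightarrow> nat) \<Rightarrow> (nat \<times> nat \<Rightarrow> nat) \<Rightarrow> (nat \<times> nat \<Rightarrow> nat)" where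
  "tab_extend lam N mu T = (\<lambda>c. if c \<in> cells mu then T c else if c \<in> cells lam then N else undefined)"

lemma ssyt_row_mono:
  assumes "T \<in> ssyt lam N" "j \<le> j'" "j' < lam i"
  shows "T (i, j) \<le> T (i, j')"
  using assms(2,3)
proof (induction j' rule: dec_induct)
  case (step n)
  hence "T (i, n) \<le> T (i, Suc n)" using assms(1) by (auto simp: ssyt_def cells_def)
  with step show ?case by auto
qed auto

lemma ssyt_less: "T \<in> ssyt lam N \<Longrightarrow> c \<in> cells lam \<Longrightarrow> T c < N"
  by (auto simp: ssyt_def)

lemma ssyt_col: "T \<in> ssyt lam N \<Longrightarrow> (Suc i, j) \<in> cells lam \<Longrightarrow> T (i, j) < T (Suc i, j)"
  by (auto simp: ssyt_def)

lemma ssyt_row: "T \<in> ssyt lam N \<Longrightarrow> (i, Suc j) \<in> cells lam \<Longrightarrow> T (i, j) \<le> T (i, Suc j)"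
  by (auto simp: ssyt_def)

lemma ssyt_undefined: "T \<in> ssyt lam N \<Longrightarrow> c \<notin> cells lam \<Longrightarrow> T c = undefined"
  by (cases c) (auto simp: ssyt_def PiE_iff extensional_def)

text \<open>Rows increase weakly, so the entries below N fill an initial segment of each
  row.\<close>

lemma less_tab_shape_iff:
  assumes "T \<in> ssyt lam (Suc N)"
  shows "j < tab_shape lam N T i \<longleftrightarrow> j < lam i \<and> T (i, j) < N"
proof -
  have "{j. j < lam i \<and> T (i, j) < N} = {..<tab_shape lam N T i}"
    unfolding tab_shape_def
    by (rule downward_closed_lessThan)
       (use ssyt_row_mono[OF assms] in \<open>auto intro: le_less_trans\<close>)
  from arg_cong[OF this, of "\<lambda>A. j \<in> A"] show ?thesis by auto
qed

lemma cells_tab_shape: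
  "T \<in> ssyt lam (Suc N) \<Longrightarrow> c \<in> cells (tab_shape lam N T) \<longleftrightarrow> c \<in> cells lam \<and> T c < N"
  by (cases c) (auto simp: cells_def less_tab_shape_iff)

lemma cells_subset: "(\<And>i. mu i \<le> lam i) \<Longrightarrow> cells mu \<subseteq> cells lam"
  by (auto simp: cells_def intro: less_le_trans)

text \<open>Columns increase strictly and no entry exceeds N, so a cell lying above another one has
  an entry below N. This is the lower interlacing bound.\<close>

lemma tab_shape_interlacing:
  assumes "is_partition lam" "T \<in> ssyt lam (Suc N)"
  shows "tab_shape lam N T \<in> interlacing lam"
proof -
  let ?mu = "tab_shape lam N T"
  have le: "?mu i \<le> lam i" for i
    by (metis assms(2) leI less_irrefl less_tab_shape_iff)
  have ge: "lam (Suc i) \<le> ?mu i" for i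
  proof (rule ccontr)
    assume "\<not> lam (Suc i) \<le> ?mu i"
    hence c: "(Suc i, ?mu i) \<in> cells lam" by (simp add: cells_def)
    have "T (i, ?mu i) < N" using ssyt_col[OF assms(2) c] ssyt_less[OF assms(2) c] by simp
    moreover have "?mu i < lam i"
      using c part_antimono[OF assms(1), of i "Suc i"] by (auto simp: cells_def)
    ultimately have "?mu i < ?mu i" using less_tab_shape_iff[OF assms(2)] by blast
    thus False by simp
  qed
  have "antimono ?mu"
    by (rule decseq_SucI) (use le ge order_trans in blast)
  moreover have "{i. ?mu i \<noteq> 0} \<subseteq> {i. lam i \<noteq> 0}" using le by (auto, metis gr_zeroI le_zero_eq)
  hence "finite {i. ?mu i \<noteq> 0}" using assms(1) by (auto simp: is_partition_def intro: finite_subset)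
  ultimately show ?thesis using le ge by (auto simp: interlacing_def is_partition_def)
qed

lemma tab_restrict_ssyt:
  assumes "is_partition lam" "T \<in> ssyt lam (Suc N)"
  shows "restrict T (cells (tab_shape lam N T)) \<in> ssyt (tab_shape lam N T) N"
proof -
  let ?mu = "tab_shape lam N T"
  have c: "c \<in> cells ?mu \<longleftrightarrow> c \<in> cells lam \<and> T c < N" for c
    by (rule cells_tab_shape[OF assms(2)])
  have mu: "is_partition ?mu" using tab_shape_interlacing[OF assms] by (simp add: interlacing_def)
  have left: "(i, j) \<in> cells ?mu" if "(i, Suc j) \<in> cells ?mu" for i j
    using that by (auto simp: cells_def)
  have up: "(i, j) \<in> cells ?mu" if "(Suc i, j) \<in> cells ?mu" for i j
    using that part_antimono[OF mu, of i "Suc i"] by (auto simp: cells_def)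
  show ?thesis unfolding ssyt_def
  proof (safe, goal_cases)
    case (1 a b)
    thus ?case using c[of "(a, b)"] by simp
  next
    case (3 i j)
    thus ?case using left[OF 3] c[of "(i, Suc j)"] ssyt_row[OF assms(2), of i j] by simp
  next
    case (4 i j)
    thus ?case using up[OF 4] c[of "(Suc i, j)"] ssyt_col[OF assms(2), of i j] by simp
  qed auto
qed

lemma tab_extend_ssyt:
  assumes "is_partition lam" "mu \<in> interlacing lam" "T \<in> ssyt mu N"
  shows "tab_extend lam N mu T \<in> ssyt lam (Suc N)"
proof -
  have mu: "is_partition mu" and le: "\<And>i. mu i \<le> lam i" and ge: "\<And>i. lam (Suc i) \<le> mu i"
    using assms(2) by (auto simp: interlacing_def)
  have sub: "cells mu \<subseteq> cells lam" by (rule cells_subset) (rule le)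
  have up: "(i, j) \<in> cells mu" if "(Suc i, j) \<in> cells lam" for i j
    using that ge[of i] by (auto simp: cells_def)
  show ?thesis unfolding ssyt_def tab_extend_def
  proof (safe, goal_cases)
    case (1 a b)
    thus ?case using ssyt_less[OF assms(3)] sub by (force intro: less_SucI)
  next
    case (3 i j)
    have "(i, j) \<in> cells lam" using 3 by (auto simp: cells_def)
    moreover have "(i, j) \<in> cells mu" if "(i, Suc j) \<in> cells mu" using that by (auto simp: cells_def)
    ultimately show ?case using 3 ssyt_row[OF assms(3), of i j] ssyt_less[OF assms(3), of "(i, j)"]
      by auto
  next
    case (4 i j)
    thus ?case using up[OF 4] ssyt_col[OF assms(3), of i j] ssyt_less[OF assms(3), of "(i, j)"]
      by auto
  qed (use sub in auto)
qed

lemma tab_shape_extend: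
  assumes "mu \<in> interlacing lam" "T \<in> ssyt mu N"
  shows "tab_shape lam N (tab_extend lam N mu T) = mu"
proof
  fix i
  have le: "mu i \<le> lam i" using assms(1) by (auto simp: interlacing_def)
  have "{j. j < lam i \<and> tab_extend lam N mu T (i, j) < N} = {..<mu i}"
    using le ssyt_less[OF assms(2)] by (auto simp: tab_extend_def cells_def split: if_splits)
  thus "tab_shape lam N (tab_extend lam N mu T) i = mu i" by (simp add: tab_shape_def)
qed

lemma finite_ssyt: "is_partition mu \<Longrightarrow> finite (ssyt mu N)"
  by (rule finite_subset[of _ "cells mu \<rightarrow>\<^sub>E {..<N}"]) (auto simp: ssyt_def intro!: finite_PiE finite_cells)

text \<open>Branching rule. The cells carrying the last variable form a horizontal strip, and
  deleting them is a bijection with inverse \<open>tab_extend\<close>.\<close>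

lemma schur_snoc:
  assumes "is_partition lam"
  shows "schur lam (xs @ [x]) =
    (\<Sum>mu\<in>interlacing lam. x ^ (part_size lam - part_size mu) * schur mu xs)"
proof -
  let ?N = "length xs"
  let ?w = "\<lambda>T. \<Prod>c\<in>cells lam. (xs @ [x]) ! T c"
  have wt: "?w (tab_extend lam ?N mu T) = x ^ (part_size lam - part_size mu) * (\<Prod>c\<in>cells mu. xs ! T c)"
    if mu: "mu \<in> interlacing lam" and T: "T \<in> ssyt mu ?N" for mu T
  proof -
    have pmu: "is_partition mu" and le: "\<And>i. mu i \<le> lam i"
      using mu by (auto simp: interlacing_def)
    have sub: "cells mu \<subseteq> cells lam" by (rule cells_subset) (rule le)
    have "?w (tab_extend lam ?N mu T) =
      (\<Prod>c\<in>cells lam - cells mu. (xs @ [x]) ! tab_extend lam ?N mu T c) *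
      (\<Prod>c\<in>cells mu. (xs @ [x]) ! tab_extend lam ?N mu T c)"
      by (rule prod.subset_diff[OF sub finite_cells[OF assms]])
    also have "(\<Prod>c\<in>cells lam - cells mu. (xs @ [x]) ! tab_extend lam ?N mu T c) =
      (\<Prod>c\<in>cells lam - cells mu. x)"
      by (rule prod.cong) (auto simp: tab_extend_def)
    also have "\<dots> = x ^ (part_size lam - part_size mu)"
      using sub finite_cells[OF pmu] by (simp add: card_Diff_subset card_cells assms pmu)
    also have "(\<Prod>c\<in>cells mu. (xs @ [x]) ! tab_extend lam ?N mu T c) = (\<Prod>c\<in>cells mu. xs ! T c)"
      by (rule prod.cong) (auto simp: tab_extend_def nth_append dest: ssyt_less[OF T])
    finally show ?thesis .
  qed
  have "schur lam (xs @ [x]) = (\<Sum>T\<in>ssyt lam (Suc ?N). ?w T)" by (simp add: schur_def)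
  also have "\<dots> = (\<Sum>(mu, T)\<in>Sigma (interlacing lam) (\<lambda>mu. ssyt mu ?N).
      x ^ (part_size lam - part_size mu) * (\<Prod>c\<in>cells mu. xs ! T c))"
  proof (rule sum.reindex_bij_witness[where
      i = "\<lambda>(mu, T). tab_extend lam ?N mu T" and
      j = "\<lambda>T. (tab_shape lam ?N T, restrict T (cells (tab_shape lam ?N T)))"], goal_cases)
    case (1 T)
    show ?case
    proof
      fix c
      show "(case (tab_shape lam ?N T, restrict T (cells (tab_shape lam ?N T))) of
        (mu, T) \<Rightarrow> tab_extend lam ?N mu T) c = T c"
        using cells_tab_shape[OF 1, of c] ssyt_less[OF 1, of c] ssyt_undefined[OF 1, of c]
        by (auto simp: tab_extend_def)
    qed
  next
    case (2 T)
    thus ?case using tab_shape_interlacing[OF assms] tab_restrict_ssyt[OF assms] by auto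
  next
    case (3 z)
    then obtain mu T where z: "z = (mu, T)" "mu \<in> interlacing lam" "T \<in> ssyt mu ?N" by auto
    have "restrict (tab_extend lam ?N mu T) (cells mu) = T"
      using ssyt_undefined[OF z(3)] by (auto simp: tab_extend_def restrict_def)
    thus ?case using z by (simp add: tab_shape_extend)
  next
    case (4 z)
    thus ?case using tab_extend_ssyt[OF assms] by auto
  next
    case (5 T)
    let ?mu = "tab_shape lam ?N T" and ?T = "restrict T (cells (tab_shape lam ?N T))"
    have e: "tab_extend lam ?N ?mu ?T = T"
    proof
      fix c
      show "tab_extend lam ?N ?mu ?T c = T c"
        using cells_tab_shape[OF 5, of c] ssyt_less[OF 5, of c] ssyt_undefined[OF 5, of c]
        by (auto simp: tab_extend_def)
    qed
    show ?case
      using wt[OF tab_shape_interlacing[OF assms 5] tab_restrict_ssyt[OF assms 5]]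
      unfolding e by simp
  qed
  also have "\<dots> = (\<Sum>mu\<in>interlacing lam. x ^ (part_size lam - part_size mu) * schur mu xs)"
    unfolding schur_def sum_distrib_left
    by (rule sum.Sigma[symmetric], rule finite_interlacing[OF assms]) (auto simp: interlacing_def intro: finite_ssyt)
  finally show ?thesis .
qed

lemma schur_Nil: "is_partition lam \<Longrightarrow> schur lam [] = (if lam = (\<lambda>_. 0) then 1 else 0)"
proof -
  assume p: "is_partition lam"
  show ?thesis
  proof (cases "lam = (\<lambda>_. 0)")
    case True
    hence "cells lam = {}" by (auto simp: cells_def)
    moreover have "ssyt lam 0 = {\<lambda>_. undefined}"
      unfolding ssyt_def \<open>cells lam = {}\<close> by auto
    ultimately show ?thesis using True by (simp add: schur_def)
  next
    case False
    then obtain i where "lam i \<noteq> 0" by auto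
    hence c: "(i, 0) \<in> cells lam" by (auto simp: cells_def)
    have "ssyt lam 0 = {}" using c ssyt_less[of _ lam 0 "(i, 0)"] by blast
    thus ?thesis using False by (simp add: schur_def)
  qed
qed

subsection \<open>Jacobi--Trudi identities for Schur polynomials\<close>

text \<open>Generating function of the complete homogeneous symmetric polynomials;
  \<open>eser\<close> is that of the elementary ones.\<close>

definition hser :: "complex list \<Rightarrow> complex fps" where
  "hser xs = (\<Prod>x\<leftarrow>xs. inverse (1 - fps_const x * fps_X))"

definition eser :: "complex list \<Rightarrow> complex fps" where
  "eser ys = (\<Prod>y\<leftarrow>ys. 1 + fps_const y * fps_X)"

lemma hser_nth_0 [simp]: "fps_nth (hser xs) 0 = 1"
  by (induction xs) (auto simp: hser_def)

lemma eser_nth_0 [simp]: "fps_nth (eser xs) 0 = 1"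
  by (induction xs) (auto simp: eser_def)

text \<open>Unrolls the recurrence down to position \<open>int b - 1 + r\<close>, where the next row
  of the determinant takes over in \<open>jtp_geometric\<close>. The position is an integer because
  b may be 0.\<close>

lemma fc_geometric_iterate:
  assumes "\<And>r. fc H' r = fc H r + x * fc H' (r - 1)" and "b \<le> a + 1"
  shows "fc H' (int a + r) = (\<Sum>p\<in>{b..<a + 1}. x ^ (a - p) * fc H (int p + r)) + x ^ (a + 1 - b) * fc H' (int b - 1 + r)"
  using assms(2)
proof (induction a)
  case 0
  show ?case
  proof (cases "b = 0")
    case True thus ?thesis using assms(1)[of r] by simp
  next
    case False hence "b = 1" using 0 by simp
    thus ?thesis by simp
  qed
next
  case (Suc a)
  show ?case
  proof (cases "b \<le> a + 1")
    case True
    have "fc H' (int (Suc a) + r) = fc H (int (Suc a) + r) + x * fc H' (int a + r)"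
      using assms(1)[of "int (Suc a) + r"] by (simp add: algebra_simps)
    also have "fc H' (int a + r) = (\<Sum>p\<in>{b..<a + 1}. x ^ (a - p) * fc H (int p + r)) + x ^ (a + 1 - b) * fc H' (int b - 1 + r)"
      by (rule Suc.IH[OF True])
    also have "fc H (int (Suc a) + r) + x * \<dots> =
      (\<Sum>p\<in>{b..<a + 1}. x * x ^ (a - p) * fc H (int p + r)) + fc H (int (Suc a) + r)
        + x * x ^ (a + 1 - b) * fc H' (int b - 1 + r)"
      by (simp add: algebra_simps sum_distrib_left)
    also have "(\<Sum>p\<in>{b..<a + 1}. x * x ^ (a - p) * fc H (int p + r)) =
      (\<Sum>p\<in>{b..<a + 1}. x ^ (Suc a - p) * fc H (int p + r))"
      by (rule sum.cong) (auto simp: Suc_diff_le)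
    also have "x * x ^ (a + 1 - b) = x ^ (Suc a + 1 - b)" using True by (simp add: Suc_diff_le)
    finally show ?thesis using True by (simp add: sum.atLeastLessThan_Suc)
  next
    case False
    hence "b = Suc (Suc a)" using Suc.prems by simp
    thus ?thesis by simp
  qed
qed

text \<open>The determinant obeys the branching rule of \<open>schur_snoc\<close>: subtracting a
  multiple of the next row cuts the geometric sum in row i down to
  \<open>p \<ge> lam (Suc i)\<close>, the interlacing range.\<close>

lemma jtp_geometric:
  assumes "is_partition lam" "lam N = 0" "\<And>r. fc H' r = fc H r + x * fc H' (r - 1)"
  shows "jtp N lam H' = (\<Sum>mu\<in>interlacing lam. x ^ (part_size lam - part_size mu) * jtp N mu H)"
proof -
  have dec: "lam (Suc i) \<le> lam i" for i using part_antimono[OF assms(1), of i "Suc i"] by simp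
  \<comment> \<open>The exponent is the number of unrolling steps from \<open>lam i\<close> to
    \<open>lam (Suc i) - 1\<close>, so that the tail of row i cancels against row
    \<open>Suc i\<close>.\<close>
  define U where "U = (\<lambda>i k. if k = i then 1 else if k = Suc i then - (x ^ (lam i + 1 - lam (Suc i))) else (0 :: complex))"
  define S where "S = (\<lambda>i. {lam (Suc i)..<lam i + 1})"
  have row: "(\<Sum>k<N. U i k * fc H' (int (lam k) - int k + int j)) =
      (\<Sum>p\<in>S i. x ^ (lam i - p) * fc H (int p - int i + int j))" if i: "i < N" and j: "j < N" for i j
  proof -
    let ?f = "\<lambda>k. fc H' (int (lam k) - int k + int j)"
    have "(\<Sum>k<N. U i k * ?f k) = ?f i - x ^ (lam i + 1 - lam (Suc i)) * ?f (Suc i)"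
    proof (cases "Suc i < N")
      case True
      have "(\<Sum>k<N. U i k * ?f k) = (\<Sum>k\<in>{i, Suc i}. U i k * ?f k)"
        by (rule sum.mono_neutral_right) (use i True in \<open>auto simp: U_def\<close>)
      thus ?thesis by (simp add: U_def)
    next
      case False
      hence N: "N = Suc i" using i by simp
      have "(\<Sum>k<N. U i k * ?f k) = (\<Sum>k\<in>{i}. U i k * ?f k)"
        by (rule sum.mono_neutral_right) (use i False in \<open>auto simp: U_def\<close>)
      \<comment> \<open>The last row has no successor to subtract, but as \<open>lam N = 0\<close>
        its tail lies at negative positions.\<close>
      moreover have "?f (Suc i) = 0" using N assms(2) j by simp
      ultimately show ?thesis by (simp add: U_def)
    qed
    also have "?f i = fc H' (int (lam i) + (int j - int i))" by (simp add: algebra_simps)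
    also have "\<dots> = (\<Sum>p\<in>S i. x ^ (lam i - p) * fc H (int p + (int j - int i))) +
        x ^ (lam i + 1 - lam (Suc i)) * fc H' (int (lam (Suc i)) - 1 + (int j - int i))"
      unfolding S_def by (rule fc_geometric_iterate[OF assms(3)]) (use dec[of i] in simp)
    finally show ?thesis by (simp add: algebra_simps)
  qed
  have "detf N U = 1" by (rule detf_upper_unitriangular) (auto simp: U_def)
  hence "jtp N lam H' = detf N U * jtp N lam H'" by simp
  also have "\<dots> = detf N (\<lambda>i j. \<Sum>p\<in>S i. x ^ (lam i - p) * fc H (int p - int i + int j))"
    unfolding jtp_def jt_def detf_mult by (rule detf_cong) (rule row)
  also have "\<dots> = (\<Sum>g\<in>Pi\<^sub>E {..<N} S. (\<Prod>i<N. x ^ (lam i - g i)) *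
      detf N (\<lambda>i j. fc H (int (g i) - int i + int j)))"
    by (rule detf_sum_rows) (auto simp: S_def)
  also have "\<dots> = (\<Sum>mu\<in>interlacing lam. x ^ (part_size lam - part_size mu) * jtp N mu H)"
  proof (rule sum.reindex_bij_witness[where i = "\<lambda>mu. restrict mu {..<N}" and
      j = "\<lambda>g i. if i < N then g i else 0"], goal_cases)
    case (1 g)
    thus ?case by (auto simp: PiE_iff extensional_def restrict_def fun_eq_iff)
  next
    case (2 g)
    have g: "lam (Suc i) \<le> g i" "g i \<le> lam i" if "i < N" for i
      using 2 that by (auto simp: PiE_iff S_def less_Suc_eq_le)
    have z: "lam i = 0" if "N \<le> i" for i using part_antimono[OF assms(1) that] assms(2) by simp
    let ?m = "\<lambda>i. if i < N then g i else 0"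
    have m: "lam (Suc i) \<le> ?m i \<and> ?m i \<le> lam i" for i using g[of i] z[of "Suc i"] by auto
    have "antimono ?m" by (rule decseq_SucI) (use m order_trans in blast)
    moreover have "finite {i. ?m i \<noteq> 0}" by (rule finite_subset[of _ "{..<N}"]) auto
    ultimately show ?case using m by (auto simp: interlacing_def is_partition_def)
  next
    case (3 mu)
    hence "mu i = 0" if "N \<le> i" for i
      using part_antimono[OF assms(1) that] assms(2) unfolding interlacing_def by (auto, metis le_zero_eq)
    thus ?case by (auto simp: fun_eq_iff)
  next
    case (4 mu)
    thus ?case by (auto simp: interlacing_def S_def less_Suc_eq_le)
  next
    case (5 g)
    have g: "lam (Suc i) \<le> g i" "g i \<le> lam i" if "i < N" for i
      using 5 that by (auto simp: PiE_iff S_def less_Suc_eq_le)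
    have z: "lam i = 0" if "N \<le> i" for i using part_antimono[OF assms(1) that] assms(2) by simp
    let ?m = "\<lambda>i. if i < N then g i else 0"
    have m: "lam (Suc i) \<le> ?m i \<and> ?m i \<le> lam i" for i using g[of i] z[of "Suc i"] by auto
    have "antimono ?m" by (rule decseq_SucI) (use m order_trans in blast)
    moreover have "finite {i. ?m i \<noteq> 0}" by (rule finite_subset[of _ "{..<N}"]) auto
    ultimately have p: "is_partition ?m" by (auto simp: is_partition_def)
    have "(\<Prod>i<N. x ^ (lam i - g i)) = x ^ (\<Sum>i<N. lam i - g i)" by (rule power_sum[symmetric])
    also have "(\<Sum>i<N. lam i - g i) = (\<Sum>i<N. lam i) - (\<Sum>i<N. g i)"
      by (rule sum_subtractf_nat) (use g in auto)
    also have "(\<Sum>i<N. lam i) = part_size lam"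
      by (rule part_size_eq[symmetric]) (use assms part_length_le_iff in auto)
    also have "(\<Sum>i<N. g i) = (\<Sum>i<N. ?m i)" by simp
    also have "\<dots> = part_size ?m"
      by (rule part_size_eq[symmetric]) (use p part_length_le_iff in auto)
    finally have e: "(\<Prod>i<N. x ^ (lam i - g i)) = x ^ (part_size lam - part_size ?m)" .
    show ?case unfolding e jtp_def jt_def
      by (intro arg_cong2[where f = "(*)"] refl detf_cong) auto
  qed
  finally show ?thesis .
qed

lemma part_eq_0_iff: "is_partition lam \<Longrightarrow> lam = (\<lambda>_. 0) \<longleftrightarrow> lam 0 = 0"
  using part_antimono[of lam 0] by (auto simp: fun_eq_iff)

lemma jtp_one:
  assumes "is_partition lam" "lam N = 0"
  shows "jtp N lam 1 = (if lam = (\<lambda>_. 0) then 1 else 0)"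
proof (cases "lam 0 = 0")
  case True
  hence l: "lam = (\<lambda>_. 0)" using part_eq_0_iff[OF assms(1)] by simp
  have "jtp N lam 1 = 1" unfolding jtp_def jt_def l
    by (rule detf_upper_unitriangular) (auto simp: fc_def)
  thus ?thesis using l by simp
next
  case False
  hence "0 < N" using assms(2) by (cases N) auto
  hence "jtp N lam 1 = 0" unfolding jtp_def jt_def
    by (intro detf_zero_row[of 0]) (use False in \<open>auto simp: fc_def\<close>)
  thus ?thesis using False by auto
qed

text \<open>Tableau sum and determinant satisfy the same recursion in the last variable and agree
  when there are no variables. The size N can stay fixed since interlacing does not lengthen a
  partition.\<close>

theorem jacobi_trudi:
  assumes "is_partition lam" "lam N = 0"
  shows "schur lam xs = jtp N lam (hser xs)"
  using assms
proof (induction xs arbitrary: lam rule: rev_induct)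
  case Nil
  thus ?case by (simp add: schur_Nil jtp_one hser_def)
next
  case (snoc x xs)
  have "hser (xs @ [x]) = inverse (1 - fps_const x * fps_X) * hser xs" by (simp add: hser_def mult.commute)
  from fc_geometric_mult[OF this]
  have "jtp N lam (hser (xs @ [x])) =
      (\<Sum>mu\<in>interlacing lam. x ^ (part_size lam - part_size mu) * jtp N mu (hser xs))"
    by (intro jtp_geometric snoc.prems)
  also have "\<dots> = (\<Sum>mu\<in>interlacing lam. x ^ (part_size lam - part_size mu) * schur mu xs)"
  proof (intro sum.cong refl arg_cong2[where f = "(*)"])
    fix mu assume "mu \<in> interlacing lam"
    hence "is_partition mu" "mu N \<le> lam N" by (auto simp: interlacing_def)
    thus "jtp N mu (hser xs) = schur mu xs" using snoc.IH[of mu] snoc.prems by simp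
  qed
  finally show ?case using snoc.prems by (simp add: schur_snoc)
qed

section \<open>Vertical strips and the elementary series\<close>

definition vertical_strips :: "(nat \<Rightarrow> nat) \<Rightarrow> (nat \<Rightarrow> nat) set" where
  "vertical_strips nu = {ka. is_partition ka \<and> (\<forall>i. ka i \<le> nu i \<and> nu i \<le> Suc (ka i))}"

text \<open>Each row splits in two, which gives a sum over 0/1 vectors \<open>g\<close> subtracted
  from \<open>nu\<close>. Whenever \<open>nu - g\<close> is not a partition, two neighbouring rows
  coincide or the last row is zero.\<close>

lemma jtp_linear:
  assumes "is_partition nu" "nu N = 0" "\<And>r. fc H' r = fc H r + y * fc H (r - 1)"
  shows "jtp N nu H' = (\<Sum>ka\<in>vertical_strips nu. y ^ (part_size nu - part_size ka) * jtp N ka H)"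
proof -
  have z: "nu i = 0" if "N \<le> i" for i using part_antimono[OF assms(1) that] assms(2) by simp
  have "jtp N nu H' = detf N (\<lambda>i j. \<Sum>e\<in>{0, 1::nat}. y ^ e * fc H (int (nu i) - int e - int i + int j))"
    unfolding jtp_def jt_def by (rule detf_cong) (simp add: assms(3) algebra_simps)
  also have "\<dots> = (\<Sum>g\<in>{..<N} \<rightarrow>\<^sub>E {0, 1}. (\<Prod>i<N. y ^ g i) *
      detf N (\<lambda>i j. fc H (int (nu i) - int (g i) - int i + int j)))"
    by (rule detf_sum_rows) auto
  also have "\<dots> = (\<Sum>g\<in>(\<lambda>ka. restrict (\<lambda>i. nu i - ka i) {..<N}) ` vertical_strips nu. (\<Prod>i<N. y ^ g i) *
      detf N (\<lambda>i j. fc H (int (nu i) - int (g i) - int i + int j)))"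
  proof (rule sum.mono_neutral_right)
    show "finite ({..<N} \<rightarrow>\<^sub>E {0, 1::nat})" by (intro finite_PiE) auto
    show "(\<lambda>ka. restrict (\<lambda>i. nu i - ka i) {..<N}) ` vertical_strips nu \<subseteq> {..<N} \<rightarrow>\<^sub>E {0, 1}"
    proof (intro image_subsetI PiE_I)
      fix ka i assume "ka \<in> vertical_strips nu" "i \<in> {..<N}"
      hence "nu i \<le> Suc (ka i)" by (simp add: vertical_strips_def)
      thus "restrict (\<lambda>i. nu i - ka i) {..<N} i \<in> {0, 1}" using \<open>i \<in> _\<close> by auto
    qed auto
    show "\<forall>g\<in>({..<N} \<rightarrow>\<^sub>E {0, 1}) - (\<lambda>ka. restrict (\<lambda>i. nu i - ka i) {..<N}) ` vertical_strips nu.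
      (\<Prod>i<N. y ^ g i) * detf N (\<lambda>i j. fc H (int (nu i) - int (g i) - int i + int j)) = 0"
    proof
      fix g assume g: "g \<in> ({..<N} \<rightarrow>\<^sub>E {0, 1}) - (\<lambda>ka. restrict (\<lambda>i. nu i - ka i) {..<N}) ` vertical_strips nu"
      hence g01: "g i = 0 \<or> g i = 1" if "i < N" for i using that by (auto simp: PiE_iff)
      let ?ka = "\<lambda>i. if i < N then nu i - g i else 0"
      let ?d = "detf N (\<lambda>i j. fc H (int (nu i) - int (g i) - int i + int j))"
      have "?d = 0"
      proof (cases "\<forall>i<N. g i \<le> nu i")
        case False
        then obtain i where i: "i < N" "nu i < g i" by (auto simp: not_le)
        hence nu_i: "nu i = 0" "g i = 1" using g01[of i] by auto
        have last: "nu (N - 1) = 0" using part_antimono[OF assms(1), of i "N - 1"] i nu_i by simp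
        show ?thesis
        proof (cases "g (N - 1) = 1")
          case True
          \<comment> \<open>A last part lowered to -1 puts the last row at the negative positions
            \<open>j - N\<close>.\<close>
          show ?thesis by (rule detf_zero_row[of "N - 1"]) (use last True i in auto)
        next
          case gN: False
          \<comment> \<open>The last place where a zero part is lowered. The next part is zero and
            not lowered, so both rows have offset \<open>- Suc k\<close>.\<close>
          define k where "k = (GREATEST k. k < N \<and> g k = 1 \<and> nu k = 0)"
          have k: "k < N \<and> g k = 1 \<and> nu k = 0" unfolding k_def
            by (rule GreatestI_nat[of _ i N]) (use i nu_i in auto)
          have k1: "Suc k < N" using k gN by (cases "k = N - 1") auto
          have nuk: "nu (Suc k) = 0" using part_antimono[OF assms(1), of k "Suc k"] k by simp
          have "g (Suc k) \<noteq> 1"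
          proof
            assume "g (Suc k) = 1"
            hence "Suc k \<le> k" unfolding k_def by (intro Greatest_le_nat[of _ _ N]) (use k1 nuk k_def in auto)
            thus False by simp
          qed
          hence "g (Suc k) = 0" using g01[OF k1] by auto
          thus ?thesis by (intro detf_identical_rows[of k N "Suc k"]) (use k k1 nuk in auto)
        qed
      next
        case True
        show ?thesis
        proof (cases "\<forall>i. ?ka (Suc i) \<le> ?ka i")
          case dec: True
          hence "antimono ?ka" by (intro decseq_SucI) auto
          moreover have "finite {i. ?ka i \<noteq> 0}" by (rule finite_subset[of _ "{..<N}"]) auto
          ultimately have "is_partition ?ka" by (auto simp: is_partition_def)
          moreover have "?ka i \<le> nu i \<and> nu i \<le> Suc (?ka i)" for i
            using g01[of i] z[of i] by auto
          ultimately have ka: "?ka \<in> vertical_strips nu" by (simp add: vertical_strips_def)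
          have "g = restrict (\<lambda>i. nu i - ?ka i) {..<N}"
            using g True by (auto simp: fun_eq_iff PiE_iff extensional_def)
          hence "g \<in> (\<lambda>ka. restrict (\<lambda>i. nu i - ka i) {..<N}) ` vertical_strips nu"
            by (rule image_eqI[where f = "\<lambda>ka. restrict (\<lambda>i. nu i - ka i) {..<N}" and x = ?ka]) (rule ka)
          with g show ?thesis by simp
        next
          case False
          then obtain i where i: "?ka i < ?ka (Suc i)" by (auto simp: not_le)
          hence iN: "Suc i < N" by (auto split: if_splits)
          have "g i \<le> nu i" "g (Suc i) \<le> nu (Suc i)" using True iN by simp_all
          moreover have "nu i - g i < nu (Suc i) - g (Suc i)" using i iN by simp
          moreover have "g i = 0 \<or> g i = 1" "g (Suc i) = 0 \<or> g (Suc i) = 1" using g01 iN by simp_all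
          moreover have "nu (Suc i) \<le> nu i" using part_antimono[OF assms(1), of i "Suc i"] by simp
          \<comment> \<open>Only a lowered part followed by an equal one that is not lowered can
            break monotonicity, and then the two offsets coincide.\<close>
          ultimately have "int (nu i) - int (g i) - int i = int (nu (Suc i)) - int (g (Suc i)) - int (Suc i)"
            by linarith
          thus ?thesis by (intro detf_identical_rows[of i N "Suc i"]) (use iN in \<open>auto simp only: Suc_lessD\<close>)
        qed
      qed
      thus "(\<Prod>i<N. y ^ g i) * ?d = 0" by simp
    qed
  qed
  also have "\<dots> = (\<Sum>ka\<in>vertical_strips nu. (\<Prod>i<N. y ^ (nu i - ka i)) * jtp N ka H)"
  proof (subst sum.reindex)
    show "inj_on (\<lambda>ka. restrict (\<lambda>i. nu i - ka i) {..<N}) (vertical_strips nu)"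
    proof (rule inj_onI)
      fix a b assume ab: "a \<in> vertical_strips nu" "b \<in> vertical_strips nu"
        "restrict (\<lambda>i. nu i - a i) {..<N} = restrict (\<lambda>i. nu i - b i) {..<N}"
      show "a = b"
      proof
        fix i
        have "a i \<le> nu i" "b i \<le> nu i" using ab by (auto simp: vertical_strips_def)
        thus "a i = b i" using fun_cong[OF ab(3), of i] z[of i] by (cases "i < N") auto
      qed
    qed
    show "sum ((\<lambda>g. (\<Prod>i<N. y ^ g i) * detf N (\<lambda>i j. fc H (int (nu i) - int (g i) - int i + int j)))
        \<circ> (\<lambda>ka. restrict (\<lambda>i. nu i - ka i) {..<N})) (vertical_strips nu) =
      (\<Sum>ka\<in>vertical_strips nu. (\<Prod>i<N. y ^ (nu i - ka i)) * jtp N ka H)"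
      unfolding o_def jtp_def jt_def
      by (intro sum.cong refl arg_cong2[where f = "(*)"] prod.cong detf_cong)
         (auto simp: vertical_strips_def of_nat_diff)
  qed
  also have "\<dots> = (\<Sum>ka\<in>vertical_strips nu. y ^ (part_size nu - part_size ka) * jtp N ka H)"
  proof (intro sum.cong refl arg_cong2[where f = "(*)"])
    fix ka assume "ka \<in> vertical_strips nu"
    hence ka: "is_partition ka" "\<And>i. ka i \<le> nu i" by (auto simp: vertical_strips_def)
    have "(\<Prod>i<N. y ^ (nu i - ka i)) = y ^ (\<Sum>i<N. nu i - ka i)" by (rule power_sum[symmetric])
    also have "(\<Sum>i<N. nu i - ka i) = (\<Sum>i<N. nu i) - (\<Sum>i<N. ka i)"
      by (rule sum_subtractf_nat) (use ka in auto)
    also have "(\<Sum>i<N. nu i) = part_size nu"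
      by (rule part_size_eq[symmetric]) (use assms part_length_le_iff in auto)
    also have "(\<Sum>i<N. ka i) = part_size ka"
      by (rule part_size_eq[symmetric]) (use ka(2)[of N] ka(1) assms part_length_le_iff in auto)
    finally show "(\<Prod>i<N. y ^ (nu i - ka i)) = y ^ (part_size nu - part_size ka)" .
  qed
  finally show ?thesis .
qed

text \<open>Branching removes horizontal strips from \<open>conjugate nu\<close>, that is vertical
  strips from \<open>nu\<close>, which is the recursion of \<open>jtp_linear\<close>.\<close>

theorem dual_jacobi_trudi:
  assumes "is_partition nu" "nu N = 0"
  shows "schur (conjugate nu) ys = jtp N nu (eser ys)"
  using assms
proof (induction ys arbitrary: nu rule: rev_induct)
  case Nil
  have c: "conjugate nu = (\<lambda>_. 0) \<longleftrightarrow> nu = (\<lambda>_. 0)"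
  proof
    assume "conjugate nu = (\<lambda>_. 0)"
    hence "conjugate (conjugate nu) = (\<lambda>_. 0)" by (simp add: conjugate_def)
    thus "nu = (\<lambda>_. 0)" using Nil by (simp add: conjugate_conjugate)
  qed (simp add: conjugate_def)
  show ?case using Nil by (simp add: schur_Nil conjugate_partition jtp_one c eser_def)
next
  case (snoc y ys)
  note p = snoc.prems(1)
  have "eser (ys @ [y]) = (1 + fps_const y * fps_X) * eser ys" by (simp add: eser_def mult.commute)
  hence "jtp N nu (eser (ys @ [y])) =
      (\<Sum>ka\<in>vertical_strips nu. y ^ (part_size nu - part_size ka) * jtp N ka (eser ys))"
    by (intro jtp_linear snoc.prems) (simp only: fc_linear_mult)
  also have "\<dots> = (\<Sum>ka\<in>vertical_strips nu. y ^ (part_size nu - part_size ka) * schur (conjugate ka) ys)"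
  proof (intro sum.cong refl arg_cong2[where f = "(*)"])
    fix ka assume "ka \<in> vertical_strips nu"
    hence "is_partition ka" "ka N \<le> nu N" by (auto simp: vertical_strips_def)
    thus "jtp N ka (eser ys) = schur (conjugate ka) ys" using snoc.IH[of ka] snoc.prems by simp
  qed
  also have "\<dots> = (\<Sum>mu\<in>interlacing (conjugate nu). y ^ (part_size nu - part_size mu) * schur mu ys)"
  proof (rule sum.reindex_bij_witness[where i = conjugate and j = conjugate], goal_cases)
    case (1 ka) thus ?case by (simp add: vertical_strips_def conjugate_conjugate)
  next
    case (2 ka)
    thus ?case using horizontal_strip_conjugate_iff[OF _ p, of ka]
      by (simp add: vertical_strips_def interlacing_def conjugate_partition)
  next
    case (3 mu) thus ?case by (simp add: interlacing_def conjugate_conjugate)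
  next
    case (4 mu)
    thus ?case using horizontal_strip_conjugate_iff[OF _ p, of "conjugate mu"]
      by (simp add: vertical_strips_def interlacing_def conjugate_partition conjugate_conjugate)
  next
    case (5 ka) thus ?case by (simp add: vertical_strips_def part_size_conjugate)
  qed
  also have "\<dots> = schur (conjugate nu) (ys @ [y])"
    by (simp add: schur_snoc conjugate_partition p part_size_conjugate)
  finally show ?case by simp
qed

subsection \<open>Partial fractions and expansion along the first rows\<close>

text \<open>The variables form a set, so that distinctness is automatic and removing variables is
  set difference. In the application A consists of the negated entries of X.\<close>

definition hs :: "complex set \<Rightarrow> complex list \<Rightarrow> complex fps" where
  "hs A Y = (\<Prod>a\<in>A. inverse (1 - fps_const a * fps_X)) * eser Y"

lemma hs_remove:
  assumes "finite A" "a \<in> A"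
  shows "fc (hs A Y) r = fc (hs (A - {a}) Y) r + a * fc (hs A Y) (r - 1)"
proof (rule fc_geometric_mult)
  show "hs A Y = inverse (1 - fps_const a * fps_X) * hs (A - {a}) Y"
    unfolding hs_def by (subst prod.remove[OF assms]) (simp add: mult_ac)
qed

lemma hs_Cons: "fc (hs A (y # Y)) r = fc (hs A Y) r + y * fc (hs A Y) (r - 1)"
proof -
  have "hs A (y # Y) = (1 + fps_const y * fps_X) * hs A Y" by (simp add: hs_def eser_def mult_ac)
  thus ?thesis by (simp only: fc_linear_mult)
qed

lemma hs_nth_0 [simp]: "fps_nth (hs A Y) 0 = 1"
  by (induction A rule: infinite_finite_induct) (auto simp: hs_def mult.assoc)

lemma hser_eq_hs: "distinct xs \<Longrightarrow> hser xs = hs (set xs) []"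
  by (simp add: hser_def hs_def eser_def prod.distinct_set_conv_list)

lemma fc_geometric: "0 \<le> r \<Longrightarrow> fc (hs {a} []) r = a ^ nat r"
proof -
  have "fc (hs {a} []) (int n) = a ^ n" for n
  proof (induction n)
    case 0
    show ?case by simp
  next
    case (Suc n)
    have "fc (hs {a} []) (int (Suc n)) = fc (hs {} []) (int (Suc n)) + a * fc (hs {a} []) (int n)"
      using hs_remove[of "{a}" a "[]" "int (Suc n)"] by simp
    also have "fc (hs {} []) (int (Suc n)) = 0" by (simp add: hs_def eser_def fc_def)
    finally show ?case using Suc by simp
  qed
  from this[of "nat r"] show "0 \<le> r \<Longrightarrow> ?thesis" by simp
qed

text \<open>Induction through (c - d) h_r(A) = h_(r+1)(A - {d}) - h_(r+1)(A - {c}) for two elements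
  c, d of A. The range includes the negative positions above \<open>- card A\<close>, where both
  sides are 0; the determinants reach these.\<close>

lemma complete_partial_fractions:
  assumes "finite A" "1 - int (card A) \<le> r"
  shows "fc (hs A []) r = (\<Sum>a\<in>A. a ^ nat (r + int (card A) - 1) / (\<Prod>b\<in>A - {a}. a - b))"
  using assms
proof (induction "card A" arbitrary: A r)
  case 0
  hence "A = {}" "r > 0" by auto
  thus ?case by (simp add: hs_def eser_def fc_def)
next
  case (Suc n)
  show ?case
  proof (cases "n = 0")
    case True
    hence "card A = 1" using Suc.hyps by simp
    then obtain a where "A = {a}" by (auto simp: card_1_singleton_iff)
    thus ?thesis using Suc.prems by (simp add: fc_geometric)
  next
    case False
    have "\<exists>c d. c \<in> A \<and> d \<in> A \<and> c \<noteq> d"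
    proof (rule ccontr)
      assume "\<not> ?thesis"
      hence "card A \<le> 1" using Suc.prems(1) by (auto simp: card_le_Suc0_iff_eq)
      thus False using Suc.hyps False by simp
    qed
    then obtain c d where cd: "c \<in> A" "d \<in> A" "c \<noteq> d" by blast
    \<comment> \<open>Passing to \<open>A - {x}\<close> and \<open>r + 1\<close> keeps
      \<open>r + card A - 1\<close> fixed, so the three sums share this exponent and differ only in
      the denominators.\<close>
    define e where "e = nat (r + int (card A) - 1)"
    define t where "t = (\<lambda>B a. if a \<in> B then a ^ e / (\<Prod>b\<in>B - {a}. a - b) else 0 :: complex)"
    have IH: "fc (hs (A - {x}) []) (r + 1) = (\<Sum>a\<in>A. t (A - {x}) a)" if x: "x \<in> A" for x
    proof -
      have card: "card (A - {x}) = n" using Suc.hyps(2) x by (metis card_Diff_singleton diff_Suc_1)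
      have e: "nat (r + 1 + int (card (A - {x})) - 1) = e"
        unfolding e_def card using Suc.hyps(2) by (simp add: algebra_simps)
      have "fc (hs (A - {x}) []) (r + 1) =
        (\<Sum>a\<in>A - {x}. a ^ nat (r + 1 + int (card (A - {x})) - 1) / (\<Prod>b\<in>A - {x} - {a}. a - b))"
        by (rule Suc.hyps(1)) (use card Suc.prems Suc.hyps(2) in auto)
      also have "\<dots> = (\<Sum>a\<in>A - {x}. t (A - {x}) a)"
        unfolding e by (rule sum.cong) (auto simp: t_def)
      also have "\<dots> = (\<Sum>a\<in>A. t (A - {x}) a)"
        by (rule sum.mono_neutral_left) (use Suc.prems in \<open>auto simp: t_def\<close>)
      finally show ?thesis .
    qed
    \<comment> \<open>As t is 0 off its set, the termwise identity also covers \<open>a = c\<close>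
      and \<open>a = d\<close>, where one of the sums lacks the term.\<close>
    have tA: "(c - d) * t A a = t (A - {d}) a - t (A - {c}) a" if a: "a \<in> A" for a
    proof -
      have nz: "(\<Prod>b\<in>B - {a}. a - b) \<noteq> 0" if "B \<subseteq> A" for B
        using Suc.prems(1) that by (auto simp: finite_subset)
      have rem: "(\<Prod>b\<in>A - {a}. a - b) = (a - x) * (\<Prod>b\<in>A - {x} - {a}. a - b)" if "x \<in> A" "x \<noteq> a" for x
        by (subst prod.remove[of _ x]) (use Suc.prems(1) that in \<open>auto simp: Diff_insert2[symmetric] insert_commute\<close>)
      consider "a = c" | "a = d" | "a \<noteq> c" "a \<noteq> d" by blast
      thus ?thesis
      proof cases
        case 1
        have "(c - d) * (x / ((c - d) * Q)) = x / Q" for x Q using cd by simp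
        thus ?thesis using rem[of d] 1 cd by (simp add: t_def)
      next
        case 2
        have "(c - d) * (x / ((d - c) * Q)) = - (x / Q)" for x Q
          using cd by (cases "Q = 0") (auto simp: divide_simps algebra_simps)
        thus ?thesis using rem[of c] 2 cd by (simp add: t_def)
      next
        case 3
        define P where "P = (\<Prod>b\<in>A - {c} - {d} - {a}. a - b)"
        have P: "P \<noteq> 0" unfolding P_def by (rule nz) auto
        have 1: "(\<Prod>b\<in>A - {c} - {a}. a - b) = (a - d) * P" unfolding P_def
          by (subst prod.remove[of _ d]) (use Suc.prems(1) 3 cd in \<open>auto intro!: arg_cong2[where f = "(*)"] prod.cong\<close>)
        have 2: "(\<Prod>b\<in>A - {d} - {a}. a - b) = (a - c) * P" unfolding P_def
          by (subst prod.remove[of _ c]) (use Suc.prems(1) 3 cd in \<open>auto intro!: arg_cong2[where f = "(*)"] prod.cong\<close>)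
        have 4: "(\<Prod>b\<in>A - {a}. a - b) = (a - c) * ((a - d) * P)" using rem[of c] 1 3 cd by simp
        have nz: "a - c \<noteq> 0" "a - d \<noteq> 0" using 3 by auto
        have "t (A - {d}) a - t (A - {c}) a = a ^ e / ((a - c) * P) - a ^ e / ((a - d) * P)"
          using a 3 by (simp add: t_def 1 2)
        also have "\<dots> = a ^ e * ((a - d) - (a - c)) / ((a - c) * ((a - d) * P))"
          using P nz by (simp add: divide_simps) (simp add: algebra_simps)
        also have "\<dots> = (c - d) * t A a" using a by (simp add: t_def 4)
        finally show ?thesis by simp
      qed
    qed
    have "(c - d) * fc (hs A []) r = fc (hs (A - {d}) []) (r + 1) - fc (hs (A - {c}) []) (r + 1)"
      using hs_remove[OF Suc.prems(1) cd(1), of "[]" "r + 1"] hs_remove[OF Suc.prems(1) cd(2), of "[]" "r + 1"]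
      by (simp add: algebra_simps)
    also have "\<dots> = (c - d) * (\<Sum>a\<in>A. t A a)"
      by (simp add: IH cd sum_subtractf[symmetric] sum_distrib_left tA)
    finally have "fc (hs A []) r = (\<Sum>a\<in>A. t A a)" using cd by simp
    thus ?thesis by (simp add: t_def e_def)
  qed
qed

text \<open>Each y contributes the factor \<open>y + a\<close> and involves the positions r and r -
  1, so the lower bound on r grows by one with every y.\<close>

lemma partial_fractions:
  assumes "finite A" "int (length Y) - int (card A) + 1 \<le> r"
  shows "fc (hs A Y) r = (\<Sum>a\<in>A. a ^ nat (r + int (card A) - 1 - int (length Y)) *
    (\<Prod>y\<leftarrow>Y. y + a) / (\<Prod>b\<in>A - {a}. a - b))"
  using assms(2)
proof (induction Y arbitrary: r)
  case Nil
  thus ?case using complete_partial_fractions[OF assms(1), of r] by simp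
next
  case (Cons y Y)
  let ?e = "nat (r + int (card A) - 1 - int (length (y # Y)))"
  have e: "nat (r + int (card A) - 1 - int (length Y)) = Suc ?e"
    "nat (r - 1 + int (card A) - 1 - int (length Y)) = ?e"
    using Cons.prems by auto
  have IH: "fc (hs A Y) r = (\<Sum>a\<in>A. a ^ Suc ?e * (\<Prod>y\<leftarrow>Y. y + a) / (\<Prod>b\<in>A - {a}. a - b))"
    "fc (hs A Y) (r - 1) = (\<Sum>a\<in>A. a ^ ?e * (\<Prod>y\<leftarrow>Y. y + a) / (\<Prod>b\<in>A - {a}. a - b))"
    using Cons.IH[of r] Cons.IH[of "r - 1"] Cons.prems unfolding e by auto
  have "fc (hs A (y # Y)) r = fc (hs A Y) r + y * fc (hs A Y) (r - 1)" by (rule hs_Cons)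
  also have "\<dots> = (\<Sum>a\<in>A. a ^ Suc ?e * (\<Prod>y\<leftarrow>Y. y + a) / (\<Prod>b\<in>A - {a}. a - b) +
      y * (a ^ ?e * (\<Prod>y\<leftarrow>Y. y + a) / (\<Prod>b\<in>A - {a}. a - b)))"
    unfolding IH sum_distrib_left sum.distrib ..
  also have "\<dots> = (\<Sum>a\<in>A. a ^ ?e * (\<Prod>y\<leftarrow>y # Y. y + a) / (\<Prod>b\<in>A - {a}. a - b))"
    by (rule sum.cong) (auto simp: add_divide_distrib[symmetric] algebra_simps)
  finally show ?case .
qed

section \<open>Splitting rows off the determinant\<close>

lemma jt_expand_first_row:
  assumes "finite A" "int (length Y) - int (card A) + 1 \<le> \<alpha> 0"
  shows "jt (Suc N) \<alpha> (hs A Y) = (\<Sum>a\<in>A. a ^ nat (\<alpha> 0 + int (card A) - 1 - int (length Y)) *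
    (\<Prod>y\<leftarrow>Y. y + a) / (\<Prod>b\<in>A - {a}. a - b) * jt N (\<lambda>i. \<alpha> (Suc i) + 1) (hs (A - {a}) Y))"
proof -
  define c where "c = (\<lambda>a. a ^ nat (\<alpha> 0 + int (card A) - 1 - int (length Y)) *
    (\<Prod>y\<leftarrow>Y. y + a) / (\<Prod>b\<in>A - {a}. a - b))"
  \<comment> \<open>The bound makes the exponent at \<open>j = 0\<close> nonnegative, so j can be
    pulled out of \<open>nat\<close> and the row is a combination of geometric progressions.\<close>
  have row: "fc (hs A Y) (\<alpha> 0 + int j) = (\<Sum>a\<in>A. c a * a ^ j)" for j
  proof -
    have "nat (\<alpha> 0 + int j + int (card A) - 1 - int (length Y)) =
        nat (\<alpha> 0 + int (card A) - 1 - int (length Y)) + j"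
      using assms(2) by simp
    thus ?thesis using assms(2)
      by (subst partial_fractions[OF assms(1)]) (auto simp: c_def power_add mult_ac intro!: sum.cong)
  qed
  have "jt (Suc N) \<alpha> (hs A Y) =
    detf (Suc N) (\<lambda>i j. if i = 0 then \<Sum>a\<in>A. c a * a ^ j else fc (hs A Y) (\<alpha> i + int j))"
    unfolding jt_def by (rule detf_cong) (simp add: row)
  also have "\<dots> = (\<Sum>a\<in>A. c a * detf (Suc N) (\<lambda>i j. if i = 0 then a ^ j else fc (hs A Y) (\<alpha> i + int j)))"
    by (rule detf_sum_first_row[OF assms(1)])
  also have "\<dots> = (\<Sum>a\<in>A. c a * jt N (\<lambda>i. \<alpha> (Suc i) + 1) (hs (A - {a}) Y))"
  proof (intro sum.cong refl arg_cong2[where f = "(*)"])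
    fix a assume a: "a \<in> A"
    define M where "M = (\<lambda>i j. if i = 0 then a ^ j else fc (hs A Y) (\<alpha> i + int j))"
    \<comment> \<open>Subtracts from each column a times the previous one. The first row becomes a
      unit vector, and by \<open>hs_remove\<close> the variable a disappears from all other
      rows.\<close>
    define U where "U = (\<lambda>k j. if k = j then 1 else if Suc k = j then - a else (0 :: complex))"
    have MU: "(\<Sum>k<Suc N. M i k * U k j) = M i j - (if j = 0 then 0 else a * M i (j - 1))"
      if "j < Suc N" for i j
    proof (cases j)
      case 0
      have "(\<Sum>k<Suc N. M i k * U k j) = (\<Sum>k\<in>{0}. M i k * U k j)"
        by (rule sum.mono_neutral_right) (use 0 in \<open>auto simp: U_def\<close>)
      thus ?thesis using 0 by (simp add: U_def)
    next
      case (Suc j')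
      have "(\<Sum>k<Suc N. M i k * U k j) = (\<Sum>k\<in>{j', j}. M i k * U k j)"
        by (rule sum.mono_neutral_right) (use Suc that in \<open>auto simp: U_def\<close>)
      thus ?thesis using Suc by (simp add: U_def)
    qed
    have "detf (Suc N) U = 1" by (rule detf_upper_unitriangular) (auto simp: U_def)
    hence "detf (Suc N) M = detf (Suc N) M * detf (Suc N) U" by simp
    also have "\<dots> = detf (Suc N) (\<lambda>i j. M i j - (if j = 0 then 0 else a * M i (j - 1)))"
      unfolding detf_mult by (rule detf_cong) (rule MU)
    also have "\<dots> = detf N (\<lambda>i j. M (Suc i) (Suc j) - a * M (Suc i) j)"
      by (subst detf_first_row_unit) (auto simp: M_def gr0_conv_Suc)
    also have "\<dots> = jt N (\<lambda>i. \<alpha> (Suc i) + 1) (hs (A - {a}) Y)"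
      unfolding jt_def
    proof (rule detf_cong)
      fix i j
      show "M (Suc i) (Suc j) - a * M (Suc i) j = fc (hs (A - {a}) Y) (\<alpha> (Suc i) + 1 + int j)"
        using hs_remove[OF assms(1) a, of Y "\<alpha> (Suc i) + 1 + int j"] by (simp add: M_def algebra_simps)
    qed
    finally show "detf (Suc N) (\<lambda>i j. if i = 0 then a ^ j else fc (hs A Y) (\<alpha> i + int j)) =
      jt N (\<lambda>i. \<alpha> (Suc i) + 1) (hs (A - {a}) Y)" by (simp add: M_def)
  qed
  finally show ?thesis by (simp add: c_def)
qed

text \<open>The bound survives each split: one variable fewer, offsets one higher. The shift by
  \<open>card A - l\<close> compensates for S having only l variables, so the exponents of the split
  rows are unchanged.\<close>

lemma jt_expand_rows:
  assumes "finite A" "\<And>i. i < l \<Longrightarrow> int (length Y) - int (card A) + 1 \<le> \<alpha> i"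
  shows "jt (l + M) \<alpha> (hs A Y) = (\<Sum>S | S \<subseteq> A \<and> card S = l.
    jt l (\<lambda>i. \<alpha> i + int (card A) - int l) (hs S Y) *
    jt M (\<lambda>i. \<alpha> (l + i) + int l) (hs (A - S) Y) / (\<Prod>s\<in>S. \<Prod>t\<in>A - S. s - t))"
  using assms
proof (induction l arbitrary: \<alpha> A)
  case 0
  have "{S. S \<subseteq> A \<and> card S = 0} = {{}}"
    using 0(1) by (auto simp: finite_subset)
  thus ?case by (simp add: jt_def detf_expand)
next
  case (Suc l)
  define n where "n = card A"
  define c where "c = (\<lambda>B a. a ^ nat (\<alpha> 0 + int n - 1 - int (length Y)) *
    (\<Prod>y\<leftarrow>Y. y + a) / (\<Prod>b\<in>B - {a}. a - b))"
  define J where "J = (\<lambda>S. jt l (\<lambda>i. \<alpha> (Suc i) + int n - int l) (hs S Y))"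
  define K where "K = (\<lambda>T. jt M (\<lambda>i. \<alpha> (Suc l + i) + int (Suc l)) (hs T Y))"
  define V where "V = (\<lambda>S T. \<Prod>s\<in>S. \<Prod>t\<in>T. s - t :: complex)"
  have fin: "finite B" if "B \<subseteq> A" for B using that Suc.prems(1) finite_subset by blast
  have "jt (Suc l + M) \<alpha> (hs A Y) =
      (\<Sum>a\<in>A. c A a * jt (l + M) (\<lambda>i. \<alpha> (Suc i) + 1) (hs (A - {a}) Y))"
    using jt_expand_first_row[OF Suc.prems(1), of Y \<alpha> "l + M"] Suc.prems(2)[of 0]
    by (simp add: c_def n_def)
  also have "\<dots> = (\<Sum>a\<in>A. \<Sum>S | S \<subseteq> A - {a} \<and> card S = l. c A a * (J S * K (A - {a} - S) / V S (A - {a} - S)))"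
  proof (rule sum.cong[OF refl])
    fix a assume a: "a \<in> A"
    have card: "int (card (A - {a})) = int n - 1"
      using card_Suc_Diff1[OF Suc.prems(1) a] by (simp add: n_def)
    have "jt (l + M) (\<lambda>i. \<alpha> (Suc i) + 1) (hs (A - {a}) Y) =
      (\<Sum>S | S \<subseteq> A - {a} \<and> card S = l. jt l (\<lambda>i. \<alpha> (Suc i) + 1 + int (card (A - {a})) - int l) (hs S Y) *
        jt M (\<lambda>i. \<alpha> (Suc (l + i)) + 1 + int l) (hs (A - {a} - S) Y) / (\<Prod>s\<in>S. \<Prod>t\<in>A - {a} - S. s - t))"
    proof (rule Suc.IH)
      fix i assume "i < l"
      thus "int (length Y) - int (card (A - {a})) + 1 \<le> \<alpha> (Suc i) + 1"
        using Suc.prems(2)[of "Suc i"] card by (simp add: n_def)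
    qed (use Suc.prems in auto)
    also have "\<dots> = (\<Sum>S | S \<subseteq> A - {a} \<and> card S = l. J S * K (A - {a} - S) / V S (A - {a} - S))"
      unfolding J_def K_def V_def card by (simp add: algebra_simps)
    finally show "c A a * jt (l + M) (\<lambda>i. \<alpha> (Suc i) + 1) (hs (A - {a}) Y) =
      (\<Sum>S | S \<subseteq> A - {a} \<and> card S = l. c A a * (J S * K (A - {a} - S) / V S (A - {a} - S)))"
      by (simp add: sum_distrib_left)
  qed
  also have "\<dots> = (\<Sum>(a, S)\<in>Sigma A (\<lambda>a. {S. S \<subseteq> A - {a} \<and> card S = l}).
      c A a * (J S * K (A - {a} - S) / V S (A - {a} - S)))"
    by (rule sum.Sigma) (use Suc.prems(1) in auto)
  \<comment> \<open>Regroup by the set that includes the first chosen variable a. The denominator of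
    a over \<open>A - {a}\<close> splits into a part inside S, kept in \<open>c S a\<close>, and a
    part over \<open>A - S\<close>, which completes the double product.\<close>
  also have "\<dots> = (\<Sum>(S, a)\<in>Sigma {S. S \<subseteq> A \<and> card S = Suc l} (\<lambda>S. S).
      c S a * J (S - {a}) * K (A - S) / V S (A - S))"
  proof (rule sum.reindex_bij_witness[where i = "\<lambda>(S, a). (a, S - {a})" and j = "\<lambda>(a, S). (insert a S, a)"], goal_cases)
    case (2 z) thus ?case by (auto simp: card_insert_if fin subset_Diff_insert intro: finite_subset)
  next
    case (5 z)
    then obtain a S where z: "z = (a, S)" "a \<in> A" "S \<subseteq> A" "a \<notin> S" "card S = l" by auto
    define T where "T = A - insert a S"
    have T: "A - {a} - S = T" by (auto simp: T_def)
    have f: "finite S" "finite T" using z fin[of S] Suc.prems(1) by (auto simp: T_def)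
    have "(\<Prod>b\<in>A - {a}. a - b) = (\<Prod>b\<in>S \<union> T. a - b)" by (rule prod.cong) (use z in \<open>auto simp: T_def\<close>)
    also have "\<dots> = (\<Prod>b\<in>S. a - b) * (\<Prod>b\<in>T. a - b)"
      by (rule prod.union_disjoint) (use f in \<open>auto simp: T_def\<close>)
    finally have 1: "(\<Prod>b\<in>A - {a}. a - b) = (\<Prod>b\<in>S. a - b) * (\<Prod>b\<in>T. a - b)" .
    have 2: "insert a S - {a} = S" using z by auto
    have 3: "V (insert a S) T = (\<Prod>b\<in>T. a - b) * V S T" using z f by (simp add: V_def)
    show ?case unfolding z(1) by (simp add: T 2 3 c_def 1 T_def[symmetric] mult.assoc)
  qed (use Suc.prems(1) in \<open>auto simp: card_Diff_singleton insert_absorb\<close>)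
  also have "\<dots> = (\<Sum>S | S \<subseteq> A \<and> card S = Suc l. \<Sum>a\<in>S. c S a * J (S - {a}) * K (A - S) / V S (A - S))"
    by (rule sum.Sigma[symmetric]) (use Suc.prems(1) fin in auto)
  also have "\<dots> = (\<Sum>S | S \<subseteq> A \<and> card S = Suc l.
      jt (Suc l) (\<lambda>i. \<alpha> i + int n - int (Suc l)) (hs S Y) * K (A - S) / V S (A - S))"
  proof (rule sum.cong[OF refl])
    fix S assume "S \<in> {S. S \<subseteq> A \<and> card S = Suc l}"
    hence S: "finite S" "card S = Suc l" using fin by auto
    \<comment> \<open>The first-row expansion read from right to left, now in the variables
      S.\<close>
    have "jt (Suc l) (\<lambda>i. \<alpha> i + int n - int (Suc l)) (hs S Y) = (\<Sum>a\<in>S. c S a * J (S - {a}))"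
      using jt_expand_first_row[OF S(1), of Y "\<lambda>i. \<alpha> i + int n - int (Suc l)" l] Suc.prems(2)[of 0] S(2)
      by (simp add: c_def J_def n_def algebra_simps)
    thus "(\<Sum>a\<in>S. c S a * J (S - {a}) * K (A - S) / V S (A - S)) =
      jt (Suc l) (\<lambda>i. \<alpha> i + int n - int (Suc l)) (hs S Y) * K (A - S) / V S (A - S)"
      by (simp add: sum_distrib_right sum_divide_distrib)
  qed
  finally show ?case by (simp add: n_def K_def V_def)
qed

subsection \<open>The bialternant formula\<close>

definition plus_rho :: "nat \<Rightarrow> (nat \<Rightarrow> nat) \<Rightarrow> nat \<Rightarrow> nat" where
  "plus_rho N lam i = lam i + (N - 1 - i)"

text \<open>For \<gamma> = \<open>plus_rho N (\<lambda>_. 0)\<close> this is the Vandermonde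
  determinant.\<close>

definition alternant :: "(nat \<Rightarrow> nat) \<Rightarrow> complex list \<Rightarrow> complex" where
  "alternant \<gamma> z = detf (length z) (\<lambda>i j. z ! j ^ \<gamma> i)"

text \<open>By partial fractions the Jacobi-Trudi matrix is the alternant matrix times a matrix
  independent of \<open>lam\<close>. The zero partition then identifies C as the inverse of the
  Vandermonde determinant, which also shows the latter to be nonzero.\<close>

lemma jtp_factor:
  assumes "distinct z"
  obtains C where "\<And>lam. jtp (length z) lam (hser z) = alternant (plus_rho (length z) lam) z * C"
proof -
  define N where "N = length z"
  define w where "w = (\<lambda>k. 1 / (\<Prod>b\<in>set z - {z ! k}. z ! k - b))"
  have card: "card (set z) = N" using assms by (simp add: N_def distinct_card)
  have e: "fc (hser z) (int (lam i) - int i + int j) =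
      (\<Sum>k<N. z ! k ^ plus_rho N lam i * (w k * z ! k ^ j))" if "i < N" for lam i j
  proof -
    have "fc (hser z) (int (lam i) - int i + int j) = (\<Sum>a\<in>set z.
        a ^ nat (int (lam i) - int i + int j + int N - 1) / (\<Prod>b\<in>set z - {a}. a - b))"
      unfolding hser_eq_hs[OF assms] by (subst complete_partial_fractions) (use that card in auto)
    also have "nat (int (lam i) - int i + int j + int N - 1) = plus_rho N lam i + j"
      using that by (simp add: plus_rho_def)
    also have "(\<Sum>a\<in>set z. a ^ (plus_rho N lam i + j) / (\<Prod>b\<in>set z - {a}. a - b)) =
      (\<Sum>k<N. z ! k ^ (plus_rho N lam i + j) / (\<Prod>b\<in>set z - {z ! k}. z ! k - b))"
      by (rule sum.reindex_bij_betw[OF bij_betw_nth[OF assms], symmetric]) (auto simp: N_def)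
    finally show ?thesis by (simp add: w_def power_add)
  qed
  have "jtp N lam (hser z) = alternant (plus_rho N lam) z * detf N (\<lambda>k j. w k * z ! k ^ j)" for lam
    unfolding alternant_def N_def[symmetric] detf_mult jtp_def jt_def by (rule detf_cong) (rule e)
  thus ?thesis using that unfolding N_def by blast
qed

lemma jtp_0: "jtp N (\<lambda>_. 0) H = 1" if "fps_nth H 0 = 1"
  unfolding jtp_def jt_def by (rule detf_upper_unitriangular) (use that in \<open>auto simp: fc_def\<close>)

lemma alternant_rho_nonzero: "distinct z \<Longrightarrow> alternant (plus_rho (length z) (\<lambda>_. 0)) z \<noteq> 0"
  using jtp_factor[of z] jtp_0[of "hser z" "length z"] by (metis hser_nth_0 mult_zero_left zero_neq_one)

theorem bialternant:
  assumes "distinct z" "is_partition lam" "lam (length z) = 0"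
  shows "schur lam z * alternant (plus_rho (length z) (\<lambda>_. 0)) z = alternant (plus_rho (length z) lam) z"
proof -
  obtain C where C: "\<And>lam. jtp (length z) lam (hser z) = alternant (plus_rho (length z) lam) z * C"
    using jtp_factor[OF assms(1)] by blast
  have "alternant (plus_rho (length z) (\<lambda>_. 0)) z * C = 1" using C[of "\<lambda>_. 0"] by (simp add: jtp_0)
  thus ?thesis using C[of lam] by (simp add: jacobi_trudi[OF assms(2,3)] mult_ac)
qed

subsection \<open>Linear independence of monomials and alternants\<close>

lemma digit_sum_inj:
  fixes \<gamma> \<delta> :: "nat \<Rightarrow> nat"
  assumes "\<And>j. j < N \<Longrightarrow> \<gamma> j < B" "\<And>j. j < N \<Longrightarrow> \<delta> j < B"
    "(\<Sum>j<N. \<gamma> j * B ^ j) = (\<Sum>j<N. \<delta> j * B ^ j)" "j < N"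
  shows "\<gamma> j = \<delta> j"
  using assms
proof (induction N arbitrary: \<gamma> \<delta> j)
  case (Suc N)
  have shift: "(\<Sum>j<Suc N. f j * B ^ j) = f 0 + B * (\<Sum>j<N. f (Suc j) * B ^ j)" for f :: "nat \<Rightarrow> nat"
    by (simp only: sum.lessThan_Suc_shift) (simp add: sum_distrib_left mult_ac)
  have eq: "\<gamma> 0 + B * (\<Sum>j<N. \<gamma> (Suc j) * B ^ j) = \<delta> 0 + B * (\<Sum>j<N. \<delta> (Suc j) * B ^ j)"
    using Suc.prems(3) unfolding shift .
  have lt: "\<gamma> 0 < B" "\<delta> 0 < B" using Suc.prems(1,2)[of 0] by auto
  have 0: "\<gamma> 0 = \<delta> 0" using arg_cong[OF eq, of "\<lambda>x. x mod B"] lt by simp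
  moreover have "(\<Sum>j<N. \<gamma> (Suc j) * B ^ j) = (\<Sum>j<N. \<delta> (Suc j) * B ^ j)"
    using eq 0 lt by simp
  hence "\<gamma> (Suc i) = \<delta> (Suc i)" if "i < N" for i
    using Suc.IH[of "\<lambda>j. \<gamma> (Suc j)" "\<lambda>j. \<delta> (Suc j)" i] Suc.prems(1,2) that by auto
  ultimately show ?case using Suc.prems(4) by (cases j) auto
qed auto

text \<open>Kronecker substitution \<open>z\<^sub>j = t ^ (B ^ j)\<close>.\<close>

lemma monomials_independent:
  fixes f :: "(nat \<Rightarrow> nat) \<Rightarrow> complex"
  assumes "finite \<Gamma>" "\<Gamma> \<subseteq> {..<N} \<rightarrow>\<^sub>E UNIV"
    and "\<And>z. distinct z \<Longrightarrow> length z = N \<Longrightarrow> (\<Sum>\<gamma>\<in>\<Gamma>. f \<gamma> * (\<Prod>j<N. z ! j ^ \<gamma> j)) = 0"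
    and "\<gamma> \<in> \<Gamma>"
  shows "f \<gamma> = 0"
proof -
  obtain B where B: "\<And>\<gamma> j. \<gamma> \<in> \<Gamma> \<Longrightarrow> j < N \<Longrightarrow> \<gamma> j < B" "2 \<le> B"
  proof
    let ?S = "(\<lambda>(\<gamma>, j). \<gamma> j) ` (\<Gamma> \<times> {..<N})"
    fix \<gamma> j assume "\<gamma> \<in> \<Gamma>" "j < N"
    hence "\<gamma> j \<in> ?S" by force
    hence "\<gamma> j \<le> Max (insert 0 ?S)" using assms(1) by (intro Max_ge) auto
    thus "\<gamma> j < Max (insert 0 ?S) + 2" by simp
  qed auto
  define e where "e = (\<lambda>\<gamma>. \<Sum>j<N. \<gamma> j * B ^ j)"
  have inj: "inj_on e \<Gamma>"
  proof (rule inj_onI)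
    fix a b assume ab: "a \<in> \<Gamma>" "b \<in> \<Gamma>" "e a = e b"
    have "a j = b j" if "j < N" for j
      using digit_sum_inj[of N a B b j] B(1) ab that by (auto simp: e_def)
    thus "a = b" using ab assms(2) by (intro PiE_ext[of a "{..<N}" "\<lambda>_. UNIV" b]) auto
  qed
  define p where "p = (\<Sum>\<gamma>\<in>\<Gamma>. Polynomial.monom (f \<gamma>) (e \<gamma>))"
  \<comment> \<open>The hypothesis covers distinct coordinates only; t and B being at least 2 keeps
    the values \<open>t ^ (B ^ j)\<close> apart.\<close>
  have "poly p (of_nat t) = 0" if t: "2 \<le> t" for t
  proof -
    let ?z = "map (\<lambda>j. (of_nat t :: complex) ^ (B ^ j)) [0..<N]"
    have "inj (\<lambda>j. t ^ (B ^ j))"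
      using t B(2) by (auto intro!: injI)
    hence "inj (\<lambda>j. (of_nat (t ^ (B ^ j)) :: complex))"
      unfolding inj_def of_nat_eq_iff .
    hence "inj_on (\<lambda>j. (of_nat t :: complex) ^ (B ^ j)) {0..<N}"
      unfolding of_nat_power by (rule inj_on_subset) simp
    hence "distinct ?z" by (simp add: distinct_map)
    hence "(\<Sum>\<gamma>\<in>\<Gamma>. f \<gamma> * (\<Prod>j<N. ?z ! j ^ \<gamma> j)) = 0" by (intro assms(3)) auto
    also have "(\<Sum>\<gamma>\<in>\<Gamma>. f \<gamma> * (\<Prod>j<N. ?z ! j ^ \<gamma> j)) = (\<Sum>\<gamma>\<in>\<Gamma>. f \<gamma> * of_nat t ^ e \<gamma>)"
    proof (rule sum.cong[OF refl])
      fix \<gamma>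
      have "(\<Prod>j<N. ?z ! j ^ \<gamma> j) = (\<Prod>j<N. of_nat t ^ (\<gamma> j * B ^ j))"
        by (rule prod.cong) (simp_all add: power_mult[symmetric] mult.commute)
      also have "\<dots> = of_nat t ^ e \<gamma>" unfolding e_def by (rule power_sum[symmetric])
      finally show "f \<gamma> * (\<Prod>j<N. ?z ! j ^ \<gamma> j) = f \<gamma> * of_nat t ^ e \<gamma>" by simp
    qed
    finally show ?thesis by (simp add: p_def poly_sum poly_monom)
  qed
  hence "of_nat ` {2..} \<subseteq> {x. poly p x = 0}" by auto
  moreover have "infinite (of_nat ` {2..} :: complex set)"
    by (subst finite_image_iff) (auto simp: inj_on_def infinite_Ici)
  ultimately have "p = 0" using poly_roots_finite finite_subset by blast
  have "coeff p (e \<gamma>) = (\<Sum>\<delta>\<in>\<Gamma>. if \<delta> = \<gamma> then f \<gamma> else 0)"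
    unfolding p_def coeff_sum by (intro sum.cong) (use inj assms(4) in \<open>auto dest: inj_onD\<close>)
  also have "\<dots> = f \<gamma>" using assms(1,4) by simp
  finally show ?thesis using \<open>p = 0\<close> by simp
qed

text \<open>Such a sequence is the sorted list of its values. This recovers a partition from the set
  of its shifted parts.\<close>

lemma strictly_decreasing_image_eq:
  fixes f g :: "nat \<Rightarrow> nat"
  assumes "\<And>i j. i < j \<Longrightarrow> j < N \<Longrightarrow> f j < f i" "\<And>i j. i < j \<Longrightarrow> j < N \<Longrightarrow> g j < g i"
    "f ` {..<N} = g ` {..<N}" "i < N"
  shows "f i = g i"
proof -
  have s: "sorted_wrt (<) (rev (map h [0..<N]))" if "\<And>i j. i < j \<Longrightarrow> j < N \<Longrightarrow> h j < h i" for h :: "nat \<Rightarrow> nat"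
    using that by (auto simp: sorted_wrt_iff_nth_less rev_nth)
  have "rev (map f [0..<N]) = rev (map g [0..<N])"
    by (rule strict_sorted_equal) (use s assms in \<open>auto simp: atLeast0LessThan\<close>)
  thus ?thesis using assms(4) by (auto simp: map_eq_conv)
qed

lemma plus_rho_less:
  assumes "is_partition lam" "i < j" "j < N"
  shows "plus_rho N lam j < plus_rho N lam i"
  using part_antimono[OF assms(1), of i j] assms(2,3) by (simp add: plus_rho_def)

lemma plus_rho_inj: "is_partition lam \<Longrightarrow> inj_on (plus_rho N lam) {..<N}"
  by (rule inj_onI) (metis lessThan_iff linorder_neqE_nat order_less_irrefl plus_rho_less)

text \<open>The set of values recovers the partition, and injectivity of \<open>plus_rho\<close>
  then recovers the permutation. So the monomials of all these alternants are pairwise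
  different.\<close>

lemma plus_rho_permuted_inj:
  assumes "is_partition lam" "lam N = 0" "is_partition mu" "mu N = 0"
    "p permutes {..<N}" "q permutes {..<N}"
    "\<And>i. i < N \<Longrightarrow> plus_rho N lam (p i) = plus_rho N mu (q i)"
  shows "lam = mu \<and> p = q"
proof -
  have "plus_rho N lam ` {..<N} = (\<lambda>i. plus_rho N lam (p i)) ` {..<N}"
    using permutes_image[OF assms(5)] by (metis image_image)
  also have "\<dots> = (\<lambda>i. plus_rho N mu (q i)) ` {..<N}" by (rule image_cong) (use assms(7) in auto)
  also have "\<dots> = plus_rho N mu ` {..<N}" using permutes_image[OF assms(6)] by (metis image_image)
  finally have im: "plus_rho N lam ` {..<N} = plus_rho N mu ` {..<N}" .
  have eq: "plus_rho N lam i = plus_rho N mu i" if "i < N" for i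
    by (rule strictly_decreasing_image_eq[OF _ _ im that]) (use plus_rho_less assms in auto)
  have "lam i = mu i" if "i < N" for i using eq[OF that] that by (simp add: plus_rho_def)
  hence lm: "lam = mu" by (intro part_ext[OF assms(1,3,2,4)])
  moreover have "p = q"
  proof
    fix i show "p i = q i"
    proof (cases "i < N")
      case True
      thus ?thesis using inj_onD[OF plus_rho_inj[OF assms(1), of N] assms(7)[OF True, folded lm]]
          permutes_lessThan[OF assms(5)] permutes_lessThan[OF assms(6)] by simp
    next
      case False
      thus ?thesis using assms(5,6) by (simp add: permutes_def)
    qed
  qed
  ultimately show ?thesis ..
qed

lemma alternant_monomials:
  assumes "length z = N"
  shows "alternant \<gamma> z = (\<Sum>p | p permutes {..<N}. of_int (sign p) * (\<Prod>j<N. z ! j ^ restrict (\<lambda>i. \<gamma> (p i)) {..<N} j))"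
proof -
  have "alternant \<gamma> z = detf N (\<lambda>i j. z ! i ^ \<gamma> j)"
    unfolding alternant_def assms by (rule detf_transpose[symmetric])
  thus ?thesis by (simp add: detf_expand)
qed

lemma alternants_independent:
  fixes d :: "(nat \<Rightarrow> nat) \<Rightarrow> complex"
  assumes "finite K" "\<And>lam. lam \<in> K \<Longrightarrow> is_partition lam \<and> lam N = 0"
    and "\<And>z. distinct z \<Longrightarrow> length z = N \<Longrightarrow> (\<Sum>lam\<in>K. d lam * alternant (plus_rho N lam) z) = 0"
    and "lam \<in> K"
  shows "d lam = 0"
proof -
  let ?P = "{p. p permutes {..<N}}"
  define \<phi> where "\<phi> = (\<lambda>(lam, p). restrict (\<lambda>i. plus_rho N lam (p i)) {..<N})"
  define h where "h = (\<lambda>(lam, p :: nat \<Rightarrow> nat). d lam * of_int (sign p))"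
  have finP: "finite ?P" by (rule finite_permutations) simp
  have inj: "inj_on \<phi> (K \<times> ?P)"
  proof (rule inj_onI)
    fix x y assume xy: "x \<in> K \<times> ?P" "y \<in> K \<times> ?P" "\<phi> x = \<phi> y"
    obtain a p b q where e: "x = (a, p)" "y = (b, q)" by (metis prod.exhaust)
    have "plus_rho N a (p i) = plus_rho N b (q i)" if "i < N" for i
      using fun_cong[OF xy(3), of i] that by (simp add: \<phi>_def e)
    hence "a = b \<and> p = q" using xy e assms(2) by (intro plus_rho_permuted_inj[of _ N]) auto
    thus "x = y" using e by simp
  qed
  \<comment> \<open>The coefficient must be a function of the exponent vector, hence the inverse of
    \<phi>. At \<open>(lam, id)\<close> the sign is 1 and the coefficient is
    \<open>d lam\<close>.\<close>
  have "h (inv_into (K \<times> ?P) \<phi> (\<phi> (lam, id))) = 0"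
  proof (rule monomials_independent[where \<Gamma> = "\<phi> ` (K \<times> ?P)" and N = N and f = "\<lambda>\<gamma>. h (inv_into (K \<times> ?P) \<phi> \<gamma>)"])
    show "finite (\<phi> ` (K \<times> ?P))" using assms(1) finP by blast
    show "\<phi> ` (K \<times> ?P) \<subseteq> {..<N} \<rightarrow>\<^sub>E UNIV" by (auto simp: \<phi>_def split: if_splits)
    show "\<phi> (lam, id) \<in> \<phi> ` (K \<times> ?P)" using assms(4) by (auto simp: permutes_id)
    fix z :: "complex list" assume z: "distinct z" "length z = N"
    have "(\<Sum>\<gamma>\<in>\<phi> ` (K \<times> ?P). h (inv_into (K \<times> ?P) \<phi> \<gamma>) * (\<Prod>j<N. z ! j ^ \<gamma> j)) =
      (\<Sum>x\<in>K \<times> ?P. h x * (\<Prod>j<N. z ! j ^ \<phi> x j))"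
      by (subst sum.reindex[OF inj]) (simp add: inv_into_f_f[OF inj])
    also have "\<dots> = (\<Sum>lam\<in>K. d lam * alternant (plus_rho N lam) z)"
      unfolding alternant_monomials[OF z(2)] sum_distrib_left sum.cartesian_product
      by (rule sum.cong) (auto simp: h_def \<phi>_def mult_ac)
    finally show "(\<Sum>\<gamma>\<in>\<phi> ` (K \<times> ?P). h (inv_into (K \<times> ?P) \<phi> \<gamma>) * (\<Prod>j<N. z ! j ^ \<gamma> j)) = 0"
      using assms(3)[OF z] by simp
  qed
  also have "inv_into (K \<times> ?P) \<phi> (\<phi> (lam, id)) = (lam, id)"
    by (rule inv_into_f_f[OF inj]) (use assms(4) in \<open>auto simp: permutes_id\<close>)
  finally show ?thesis by (simp add: h_def)
qed

lemma schur_independent: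
  fixes d :: "(nat \<Rightarrow> nat) \<Rightarrow> complex"
  assumes "finite K" "\<And>lam. lam \<in> K \<Longrightarrow> is_partition lam \<and> lam N = 0"
    and "\<And>z. distinct z \<Longrightarrow> length z = N \<Longrightarrow> (\<Sum>lam\<in>K. d lam * schur lam z) = 0"
    and "lam \<in> K"
  shows "d lam = 0"
proof (rule alternants_independent[OF assms(1,2) _ assms(4)])
  fix z :: "complex list" assume z: "distinct z" "length z = N"
  have "(\<Sum>lam\<in>K. d lam * alternant (plus_rho N lam) z) =
    (\<Sum>lam\<in>K. d lam * schur lam z) * alternant (plus_rho N (\<lambda>_. 0)) z"
    unfolding sum_distrib_right
    by (rule sum.cong) (use bialternant[OF z(1)] z(2) assms(2) in \<open>auto simp: mult.assoc\<close>)
  thus "(\<Sum>lam\<in>K. d lam * alternant (plus_rho N lam) z) = 0" using assms(3)[OF z] by simp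
qed auto

subsection \<open>Straightening of alternants\<close>

text \<open>Sort the exponents decreasingly and subtract \<rho>. Distinct naturals in decreasing
  order satisfy \<open>N - 1 - i \<le> xs ! i\<close>, so the differences are natural
  numbers.\<close>

lemma straighten:
  fixes g :: "nat \<Rightarrow> nat"
  assumes "inj_on g {..<N}"
  obtains lam p where "is_partition lam" "lam N = 0" "p permutes {..<N}"
    "\<And>i. i < N \<Longrightarrow> g i = plus_rho N lam (p i)"
proof -
  define xs where "xs = rev (sorted_list_of_set (g ` {..<N}))"
  have len: "length xs = N" using assms by (simp add: xs_def card_image)
  have set: "set xs = g ` {..<N}" by (simp add: xs_def)
  have dist: "distinct xs" by (simp add: xs_def)
  have dec: "xs ! j < xs ! i" if "i < j" "j < N" for i j
  proof -
    have "sorted_wrt (<) (rev xs)" by (simp add: xs_def)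
    hence "sorted_wrt (\<lambda>a b. b < a) xs" by (simp add: sorted_wrt_rev)
    thus ?thesis using that len by (auto simp: sorted_wrt_iff_nth_less)
  qed
  have low: "N - 1 - i \<le> xs ! i" if "i < N" for i
    using that
  proof (induction "N - 1 - i" arbitrary: i)
    case (Suc k)
    hence "N - 1 - Suc i \<le> xs ! Suc i" by (intro Suc.hyps(1)) auto
    moreover have "xs ! Suc i < xs ! i" using Suc by (intro dec) auto
    ultimately show ?case by simp
  qed auto
  define lam where "lam = (\<lambda>i. if i < N then xs ! i - (N - 1 - i) else 0)"
  have "antimono lam"
  proof (rule decseq_SucI)
    fix i show "lam (Suc i) \<le> lam i"
    proof (cases "Suc i < N")
      case True
      thus ?thesis using dec[of i "Suc i"] low[of i] by (simp add: lam_def)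
    qed (simp add: lam_def)
  qed
  moreover have "finite {i. lam i \<noteq> 0}" by (rule finite_subset[of _ "{..<N}"]) (auto simp: lam_def)
  ultimately have part: "is_partition lam" by (simp add: is_partition_def)
  have pr: "plus_rho N lam i = xs ! i" if "i < N" for i using low[OF that] that by (simp add: lam_def plus_rho_def)
  have bx: "bij_betw (nth xs) {..<N} (g ` {..<N})" by (rule bij_betw_nth[OF dist]) (auto simp: len set)
  define p where "p = (\<lambda>i. if i < N then inv_into {..<N} (nth xs) (g i) else i)"
  have "bij_betw (inv_into {..<N} (nth xs) \<circ> g) {..<N} {..<N}"
    using assms bx by (intro bij_betw_trans[of g _ "g ` {..<N}"] bij_betw_inv_into) (auto simp: bij_betw_def)
  hence "bij_betw p {..<N} {..<N}" by (rule bij_betw_cong[THEN iffD1, rotated]) (auto simp: p_def)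
  hence perm: "p permutes {..<N}" by (rule bij_imp_permutes) (auto simp: p_def)
  have "g i = plus_rho N lam (p i)" if "i < N" for i
  proof -
    have "plus_rho N lam (p i) = xs ! p i" by (rule pr) (rule permutes_lessThan[OF perm that])
    also have "\<dots> = g i" using that bx by (simp add: p_def bij_betw_inv_into_right)
    finally show ?thesis by simp
  qed
  with that[of lam p] part perm show ?thesis by (simp add: lam_def)
qed

lemma alternant_not_inj: "\<not> inj_on \<gamma> {..<length z} \<Longrightarrow> alternant \<gamma> z = 0"
  unfolding alternant_def inj_on_def by (auto intro: detf_identical_rows)

lemma alternant_permuted:
  assumes "p permutes {..<length z}" "\<And>i. i < length z \<Longrightarrow> \<gamma> i = \<delta> (p i)"
  shows "alternant \<gamma> z = of_int (sign p) * alternant \<delta> z"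
proof -
  have "alternant \<gamma> z = detf (length z) (\<lambda>i j. z ! j ^ \<delta> (p i))"
    unfolding alternant_def by (rule detf_cong) (use assms(2) in auto)
  also have "\<dots> = of_int (sign p) * alternant \<delta> z"
    unfolding alternant_def by (rule detf_permute_rows[OF assms(1)])
  finally show ?thesis .
qed

section \<open>Schur polynomials times alternants\<close>

definition tab_weight :: "(nat \<Rightarrow> nat) \<Rightarrow> (nat \<times> nat \<Rightarrow> nat) \<Rightarrow> nat \<Rightarrow> nat" where
  "tab_weight mu T i = card {c \<in> cells mu. T c = i}"

lemma prod_tab_weight:
  assumes "is_partition mu" "T \<in> ssyt mu N"
  shows "(\<Prod>c\<in>cells mu. h (T c)) = (\<Prod>i<N. h i ^ tab_weight mu T i :: complex)"
proof -
  have "(\<Prod>c\<in>cells mu. h (T c)) = (\<Prod>i<N. \<Prod>c | c \<in> cells mu \<and> T c = i. h (T c))"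
    by (rule prod.group[symmetric]) (use assms ssyt_less in \<open>auto simp: finite_cells\<close>)
  also have "\<dots> = (\<Prod>i<N. h i ^ tab_weight mu T i)"
    by (rule prod.cong) (auto simp: tab_weight_def)
  finally show ?thesis .
qed

lemma sum_tab_weight:
  assumes "is_partition mu" "T \<in> ssyt mu N"
  shows "(\<Sum>i<N. tab_weight mu T i) = part_size mu"
proof -
  have "card (cells mu) = (\<Sum>i<N. \<Sum>c | c \<in> cells mu \<and> T c = i. 1)"
    unfolding card_eq_sum
    by (rule sum.group[symmetric]) (use assms ssyt_less in \<open>auto simp: finite_cells\<close>)
  thus ?thesis by (simp add: card_cells assms tab_weight_def)
qed

text \<open>Symmetry is read off from Jacobi-Trudi: distinct variables enter only through their
  set.\<close>

lemma schur_permute: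
  assumes "is_partition mu" "distinct z" "p permutes {..<length z}"
  shows "schur mu (permute_list p z) = schur mu z"
proof -
  have "hser (permute_list p z) = hser z"
    using assms by (simp add: hser_eq_hs)
  moreover have "mu (part_length mu) = 0" using part_zero[OF assms(1)] by simp
  ultimately show ?thesis using assms(1) by (simp add: jacobi_trudi)
qed

text \<open>Since the Schur polynomial is symmetric, it can be expanded in the permuted variables
  separately in each term of the alternant.\<close>

lemma schur_times_alternant:
  assumes "is_partition mu" "distinct z" "length z = N"
  shows "schur mu z * alternant \<gamma> z = (\<Sum>T\<in>ssyt mu N. alternant (\<lambda>i. \<gamma> i + tab_weight mu T i) z)"
proof -
  have "schur mu z * alternant \<gamma> z = (\<Sum>p | p permutes {..<N}. of_int (sign p) * (\<Prod>i<N. z ! p i ^ \<gamma> i) * schur mu z)"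
    by (simp add: alternant_def detf_expand assms(3) sum_distrib_left mult_ac)
  also have "\<dots> = (\<Sum>p | p permutes {..<N}. \<Sum>T\<in>ssyt mu N. of_int (sign p) * (\<Prod>i<N. z ! p i ^ (\<gamma> i + tab_weight mu T i)))"
  proof (rule sum.cong[OF refl])
    fix p assume "p \<in> {p. p permutes {..<N}}"
    hence p: "p permutes {..<length z}" by (simp add: assms(3))
    have "schur mu z = (\<Sum>T\<in>ssyt mu N. \<Prod>c\<in>cells mu. permute_list p z ! T c)"
      using schur_permute[OF assms(1,2) p] by (simp add: schur_def assms(3))
    also have "\<dots> = (\<Sum>T\<in>ssyt mu N. \<Prod>i<N. z ! p i ^ tab_weight mu T i)"
    proof (rule sum.cong[OF refl])
      fix T assume T: "T \<in> ssyt mu N"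
      have "(\<Prod>c\<in>cells mu. permute_list p z ! T c) = (\<Prod>c\<in>cells mu. z ! p (T c))"
        by (rule prod.cong) (use p T assms(3) ssyt_less in \<open>auto simp: permute_list_nth\<close>)
      also have "\<dots> = (\<Prod>i<N. z ! p i ^ tab_weight mu T i)" by (rule prod_tab_weight[OF assms(1) T])
      finally show "(\<Prod>c\<in>cells mu. permute_list p z ! T c) = \<dots>" .
    qed
    finally show "of_int (sign p) * (\<Prod>i<N. z ! p i ^ \<gamma> i) * schur mu z =
      (\<Sum>T\<in>ssyt mu N. of_int (sign p) * (\<Prod>i<N. z ! p i ^ (\<gamma> i + tab_weight mu T i)))"
      by (simp add: sum_distrib_left power_add prod.distrib mult.assoc)
  qed
  also have "\<dots> = (\<Sum>T\<in>ssyt mu N. alternant (\<lambda>i. \<gamma> i + tab_weight mu T i) z)"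
    by (subst sum.swap) (simp add: alternant_def detf_expand assms(3))
  finally show ?thesis .
qed

subsection \<open>Littlewood--Richardson coefficients\<close>

text \<open>Strict columns force the first entry of row i to be at least i, which leaves no value
  for row \<open>length xs\<close>.\<close>

lemma schur_too_long:
  assumes "is_partition lam" "lam (length xs) \<noteq> 0"
  shows "schur lam xs = 0"
proof -
  have "i \<le> T (i, 0)" if T: "T \<in> ssyt lam N" and "i \<le> length xs" for T N i
    using that(2)
  proof (induction i)
    case (Suc i)
    have "lam (Suc i) \<noteq> 0" using part_antimono[OF assms(1) Suc.prems] assms(2) by simp
    hence "T (i, 0) < T (Suc i, 0)" by (intro ssyt_col[OF T]) (simp add: cells_def)
    thus ?case using Suc by simp
  qed auto
  moreover have "T (length xs, 0) < length xs" if "T \<in> ssyt lam (length xs)" for T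
    by (rule ssyt_less[OF that]) (use assms(2) in \<open>simp add: cells_def\<close>)
  ultimately have "ssyt lam (length xs) = {}" by fastforce
  thus ?thesis by (simp add: schur_def)
qed

lemma schur_mult_alternant_rho:
  assumes "distinct z" "is_partition lam"
  shows "schur lam z * alternant (plus_rho (length z) (\<lambda>_. 0)) z =
    (if lam (length z) = 0 then alternant (plus_rho (length z) lam) z else 0)"
  using assms by (simp add: bialternant schur_too_long)

text \<open>A zero variable contributes the factor 1 to \<open>hser\<close>. This carries identities
  from more variables to fewer.\<close>

lemma schur_append_0: "is_partition lam \<Longrightarrow> schur lam (xs @ replicate k 0) = schur lam xs"
proof -
  assume p: "is_partition lam"
  have "hser (xs @ replicate k 0) = hser xs" by (simp add: hser_def)
  thus ?thesis using p part_zero[OF p order_refl] by (simp add: jacobi_trudi[of lam "part_length lam"])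
qed

text \<open>An identity between polynomial functions extends from the points with distinct
  coordinates by continuity along \<open>z\<^sub>j + t j\<close>.\<close>

lemma schur_identity_extend:
  fixes c :: "(nat \<Rightarrow> nat) \<Rightarrow> complex"
  assumes "\<And>z. distinct z \<Longrightarrow> length z = N \<Longrightarrow> schur mu z * schur nu z = (\<Sum>lam\<in>K. c lam * schur lam z)"
    and "length z = N"
  shows "schur mu z * schur nu z = (\<Sum>lam\<in>K. c lam * schur lam z)"
proof -
  define w where "w = (\<lambda>t. map (\<lambda>j. z ! j + t * of_nat j) [0..<N])"
  have len: "length (w t) = N" for t by (simp add: w_def)
  have cont: "isCont (\<lambda>t. schur lam (w t)) 0" if "\<And>T c. T \<in> ssyt lam N \<Longrightarrow> c \<in> cells lam \<Longrightarrow> T c < N" for lam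
  proof -
    have "schur lam (w t) = (\<Sum>T\<in>ssyt lam N. \<Prod>c\<in>cells lam. z ! T c + t * of_nat (T c))" for t
      unfolding schur_def len by (intro sum.cong prod.cong refl) (simp add: w_def that)
    thus ?thesis by (simp add: continuous_intros)
  qed
  have ssyt: "T c < N" if "T \<in> ssyt lam N" "c \<in> cells lam" for lam T c
    using ssyt_less[OF that] .
  let ?F = "\<lambda>t. schur mu (w t) * schur nu (w t) - (\<Sum>lam\<in>K. c lam * schur lam (w t))"
  have "isCont ?F 0" by (intro continuous_intros cont ssyt)
  hence lim: "(?F \<longlongrightarrow> ?F 0) (at 0)" by (simp add: isCont_def)
  have ev: "eventually (\<lambda>t. ?F t = 0) (at 0)"
  proof -
    \<comment> \<open>The nonzero parameters at which two coordinates of \<open>w t\<close> collide.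
      They are finitely many, so 0 is approached through points with distinct coordinates.\<close>
    define B where "B = {(z ! i - z ! j) / (of_nat j - of_nat i) | i j. i < N \<and> j < N} - {0}"
    have "finite B"
    proof -
      have "B \<subseteq> (\<lambda>(i, j). (z ! i - z ! j) / (of_nat j - of_nat i)) ` ({..<N} \<times> {..<N})"
        by (auto simp: B_def)
      thus ?thesis by (rule finite_subset) simp
    qed
    hence "open (- B)" by (simp add: finite_imp_closed open_Compl)
    moreover have "0 \<in> - B" by (simp add: B_def)
    ultimately have "eventually (\<lambda>t. t \<in> - B) (at 0)" by (rule eventually_at_in_open')
    moreover have "eventually (\<lambda>t :: complex. t \<noteq> 0) (at 0)" by (simp add: eventually_at_filter)
    ultimately show ?thesis
    proof eventually_elim
      case (elim t)
      have "inj_on (\<lambda>j. z ! j + t * of_nat j) {0..<N}"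
      proof (rule inj_onI)
        fix i j assume ij: "i \<in> {0..<N}" "j \<in> {0..<N}" "z ! i + t * of_nat i = z ! j + t * of_nat j"
        show "i = j"
        proof (rule ccontr)
          assume "i \<noteq> j"
          hence "t = (z ! i - z ! j) / (of_nat j - of_nat i)" using ij(3) by (simp add: field_simps)
          thus False using elim ij by (auto simp: B_def)
        qed
      qed
      hence "distinct (w t)" by (simp add: w_def distinct_map)
      thus ?case using assms(1)[OF _ len] by simp
    qed
  qed
  have "(?F \<longlongrightarrow> 0) (at 0)" by (rule tendsto_eventually[OF ev])
  hence "?F 0 = 0" by (rule tendsto_unique[OF at_neq_bot lim])
  moreover have "w 0 = z" by (rule nth_equalityI) (auto simp: w_def assms(2))
  ultimately show ?thesis by simp
qed

text \<open>The number of variables is fixed and the degree condition built in, a stage before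
  \<open>lr_coeffs\<close>, which asks for all numbers of variables at once.\<close>

definition lr_expansion :: "(nat \<Rightarrow> nat) \<Rightarrow> (nat \<Rightarrow> nat) \<Rightarrow> nat \<Rightarrow> ((nat \<Rightarrow> nat) \<Rightarrow> int) \<Rightarrow> bool" where
  "lr_expansion mu nu N c \<longleftrightarrow> finite {lam. c lam \<noteq> 0} \<and>
     (\<forall>lam. c lam \<noteq> 0 \<longrightarrow> is_partition lam \<and> part_size lam = part_size mu + part_size nu) \<and>
     (\<forall>z. length z = N \<longrightarrow> schur mu z * schur nu z = (\<Sum>lam | c lam \<noteq> 0. of_int (c lam) * schur lam z))"

text \<open>Multiply by the Vandermonde determinant, expand the product of the Schur polynomial of
  \<open>mu\<close> with the alternant of \<open>nu\<close> over tableaux, and straighten every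
  term. The coefficients are sums of signs, hence integers.\<close>

lemma lr_expansion_exists:
  assumes "is_partition mu" "is_partition nu" "nu N = 0"
  shows "\<exists>c. lr_expansion mu nu N c"
proof -
  define \<gamma> where "\<gamma> = (\<lambda>T i. plus_rho N nu i + tab_weight mu T i)"
  define G where "G = {T \<in> ssyt mu N. inj_on (\<gamma> T) {..<N}}"
  have finG: "finite G" by (simp add: G_def finite_ssyt assms(1))
  have "\<forall>T\<in>G. \<exists>lam p. is_partition lam \<and> lam N = 0 \<and> p permutes {..<N} \<and> (\<forall>i<N. \<gamma> T i = plus_rho N lam (p i))"
  proof
    fix T assume "T \<in> G"
    hence "inj_on (\<gamma> T) {..<N}" by (simp add: G_def)
    then obtain lam p where "is_partition lam" "lam N = 0" "p permutes {..<N}"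
      "\<And>i. i < N \<Longrightarrow> \<gamma> T i = plus_rho N lam (p i)" by (rule straighten) blast
    thus "\<exists>lam p. is_partition lam \<and> lam N = 0 \<and> p permutes {..<N} \<and> (\<forall>i<N. \<gamma> T i = plus_rho N lam (p i))"
      by blast
  qed
  then obtain L p where Lp: "\<And>T. T \<in> G \<Longrightarrow> is_partition (L T)" "\<And>T. T \<in> G \<Longrightarrow> L T N = 0"
    "\<And>T. T \<in> G \<Longrightarrow> p T permutes {..<N}"
    "\<And>T i. T \<in> G \<Longrightarrow> i < N \<Longrightarrow> \<gamma> T i = plus_rho N (L T) (p T i)"
    by metis
  define c where "c = (\<lambda>lam. \<Sum>T | T \<in> G \<and> L T = lam. sign (p T))"
  have c: "\<exists>T\<in>G. L T = lam" if "c lam \<noteq> 0" for lam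
  proof (rule ccontr)
    assume "\<not> ?thesis"
    hence "{T. T \<in> G \<and> L T = lam} = {}" by auto
    hence "c lam = 0" unfolding c_def by (simp only: sum.empty)
    thus False using that by simp
  qed
  have sub: "{lam. c lam \<noteq> 0} \<subseteq> L ` G" using c by blast
  \<comment> \<open>Straightening permutes the exponents and so keeps their sum; removing \<rho>
    leaves the degree.\<close>
  have size: "part_size (L T) = part_size mu + part_size nu" if T: "T \<in> G" for T
  proof -
    have pl: "part_length (L T) \<le> N" "part_length nu \<le> N"
      using Lp(1,2)[OF T] assms part_length_le_iff by auto
    have "(\<Sum>i<N. \<gamma> T i) = (\<Sum>i<N. plus_rho N (L T) (p T i))"
      by (rule sum.cong) (use Lp(4)[OF T] in auto)
    also have "\<dots> = (\<Sum>i<N. plus_rho N (L T) i)"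
      using sum.permute[OF Lp(3)[OF T], of "plus_rho N (L T)"] by (simp add: o_def)
    finally have "(\<Sum>i<N. nu i) + (\<Sum>i<N. tab_weight mu T i) = (\<Sum>i<N. L T i)"
      unfolding \<gamma>_def plus_rho_def sum.distrib by simp
    moreover have "(\<Sum>i<N. tab_weight mu T i) = part_size mu"
      using T by (intro sum_tab_weight assms) (simp add: G_def)
    ultimately show ?thesis
      using part_size_eq[OF assms(2) pl(2)] part_size_eq[OF Lp(1)[OF T] pl(1)] by simp
  qed
  \<comment> \<open>Distinct variables first, where the Vandermonde determinant can be cancelled;
    continuity does the rest.\<close>
  have key: "schur mu z * schur nu z = (\<Sum>lam | c lam \<noteq> 0. of_int (c lam) * schur lam z)"
    if z: "distinct z" "length z = N" for z
  proof -
    let ?R = "alternant (plus_rho N (\<lambda>_. 0)) z"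
    have "schur mu z * schur nu z * ?R = schur mu z * alternant (plus_rho N nu) z"
      using bialternant[OF z(1) assms(2)] z(2) assms(3) by (simp add: mult.assoc)
    also have "\<dots> = (\<Sum>T\<in>ssyt mu N. alternant (\<gamma> T) z)"
      unfolding schur_times_alternant[OF assms(1) z] \<gamma>_def ..
    also have "\<dots> = (\<Sum>T\<in>G. alternant (\<gamma> T) z)"
      by (rule sum.mono_neutral_right) (auto simp: G_def finite_ssyt assms alternant_not_inj z)
    also have "\<dots> = (\<Sum>T\<in>G. of_int (sign (p T)) * alternant (plus_rho N (L T)) z)"
      by (rule sum.cong[OF refl], rule alternant_permuted) (use Lp z in auto)
    also have "\<dots> = (\<Sum>lam\<in>L ` G. \<Sum>T | T \<in> G \<and> L T = lam. of_int (sign (p T)) * alternant (plus_rho N (L T)) z)"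
      by (rule sum.group[symmetric]) (use finG in auto)
    also have "\<dots> = (\<Sum>lam\<in>L ` G. of_int (c lam) * alternant (plus_rho N lam) z)"
      by (rule sum.cong) (auto simp: c_def sum_distrib_right)
    also have "\<dots> = (\<Sum>lam | c lam \<noteq> 0. of_int (c lam) * alternant (plus_rho N lam) z)"
      by (rule sum.mono_neutral_right) (use finG sub in auto)
    also have "\<dots> = (\<Sum>lam | c lam \<noteq> 0. of_int (c lam) * (schur lam z * ?R))"
    proof (rule sum.cong[OF refl])
      fix lam assume "lam \<in> {lam. c lam \<noteq> 0}"
      then obtain T where "T \<in> G" "L T = lam" using c by blast
      hence "is_partition lam" "lam N = 0" using Lp by auto
      thus "of_int (c lam) * alternant (plus_rho N lam) z = of_int (c lam) * (schur lam z * ?R)"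
        using bialternant[OF z(1), of lam] z(2) by simp
    qed
    also have "\<dots> = (\<Sum>lam | c lam \<noteq> 0. of_int (c lam) * schur lam z) * ?R"
      by (simp add: sum_distrib_right mult.assoc)
    finally show ?thesis using alternant_rho_nonzero[OF z(1)] z(2) by simp
  qed
  have "lr_expansion mu nu N c" unfolding lr_expansion_def
  proof (intro conjI allI impI)
    show "finite {lam. c lam \<noteq> 0}" using sub finG finite_subset by blast
    fix lam assume "c lam \<noteq> 0"
    then obtain T where "T \<in> G" "L T = lam" using c by blast
    thus "is_partition lam" "part_size lam = part_size mu + part_size nu" using Lp(1) size by auto
  next
    fix z :: "complex list" assume "length z = N"
    thus "schur mu z * schur nu z = (\<Sum>lam | c lam \<noteq> 0. of_int (c lam) * schur lam z)"
      using schur_identity_extend[of N mu nu "\<lambda>lam. of_int (c lam)"] key by blast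
  qed
  thus ?thesis by blast
qed

lemma int_schur_independent:
  assumes "finite {lam. c lam \<noteq> 0}" "finite {lam. c' lam \<noteq> (0::int)}"
    and "\<And>lam. c lam \<noteq> 0 \<Longrightarrow> is_partition lam \<and> lam N = 0"
    and "\<And>lam. c' lam \<noteq> 0 \<Longrightarrow> is_partition lam \<and> lam N = 0"
    and "\<And>z. length z = N \<Longrightarrow> (\<Sum>lam | c lam \<noteq> 0. of_int (c lam) * schur lam z) =
      (\<Sum>lam | c' lam \<noteq> 0. of_int (c' lam) * schur lam z)"
  shows "c = c'"
proof
  fix lam
  let ?K = "{lam. c lam \<noteq> 0} \<union> {lam. c' lam \<noteq> 0}"
  show "c lam = c' lam"
  proof (cases "lam \<in> ?K")
    case True
    have "of_int (c lam) - of_int (c' lam) = (0 :: complex)"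
    proof (rule schur_independent[where K = ?K and N = N and d = "\<lambda>lam. of_int (c lam) - of_int (c' lam)"])
      fix z :: "complex list" assume z: "length z = N"
      have "(\<Sum>lam\<in>?K. of_int (c lam) * schur lam z) = (\<Sum>lam | c lam \<noteq> 0. of_int (c lam) * schur lam z)"
        "(\<Sum>lam\<in>?K. of_int (c' lam) * schur lam z) = (\<Sum>lam | c' lam \<noteq> 0. of_int (c' lam) * schur lam z)"
        by (rule sum.mono_neutral_right; use assms(1,2) in auto)+
      thus "(\<Sum>lam\<in>?K. (of_int (c lam) - of_int (c' lam)) * schur lam z) = 0"
        using assms(5)[OF z] by (simp add: left_diff_distrib sum_subtractf)
    qed (use assms True in auto)
    thus ?thesis by simp
  qed auto
qed

text \<open>Fewer variables arise by setting some to zero. With more variables an expansion exists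
  as well, and setting the surplus to zero compares it with \<open>c\<close> in a number of
  variables where every partition of this size fits, so independence applies.\<close>

lemma lr_expansion_all_variables:
  assumes "is_partition mu" "is_partition nu" "lr_expansion mu nu (part_size mu + part_size nu) c"
  shows "schur mu xs * schur nu xs = (\<Sum>lam | c lam \<noteq> 0. of_int (c lam) * schur lam xs)"
proof -
  define N where "N = part_size mu + part_size nu"
  have c: "finite {lam. c lam \<noteq> 0}" "\<And>lam. c lam \<noteq> 0 \<Longrightarrow> is_partition lam \<and> part_size lam = N"
    "\<And>z. length z = N \<Longrightarrow> schur mu z * schur nu z = (\<Sum>lam | c lam \<noteq> 0. of_int (c lam) * schur lam z)"
    using assms(3) by (auto simp: lr_expansion_def N_def)
  have len: "lam M = 0" if "is_partition lam" "part_size lam \<le> M" for lam M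
    using part_length_le_size[OF that(1)] part_zero[OF that(1), of M] that(2) by simp
  show ?thesis
  proof (cases "length xs \<le> N")
    case True
    let ?z = "xs @ replicate (N - length xs) 0"
    have "schur mu ?z * schur nu ?z = (\<Sum>lam | c lam \<noteq> 0. of_int (c lam) * schur lam ?z)"
      by (rule c(3)) (use True in simp)
    moreover have "(\<Sum>lam | c lam \<noteq> 0. of_int (c lam) * schur lam ?z) = (\<Sum>lam | c lam \<noteq> 0. of_int (c lam) * schur lam xs)"
      by (rule sum.cong) (use c(2) in \<open>auto simp: schur_append_0\<close>)
    ultimately show ?thesis by (simp add: schur_append_0 assms)
  next
    case False
    have "nu (length xs) = 0" by (rule len[OF assms(2)]) (use False in \<open>simp add: N_def\<close>)
    then obtain c' where "lr_expansion mu nu (length xs) c'" using lr_expansion_exists[OF assms(1,2)] by blast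
    hence c': "finite {lam. c' lam \<noteq> 0}" "\<And>lam. c' lam \<noteq> 0 \<Longrightarrow> is_partition lam \<and> part_size lam = N"
      "\<And>z. length z = length xs \<Longrightarrow> schur mu z * schur nu z = (\<Sum>lam | c' lam \<noteq> 0. of_int (c' lam) * schur lam z)"
      by (auto simp: lr_expansion_def N_def)
    have "c = c'"
    proof (rule int_schur_independent[OF c(1) c'(1)])
      fix z :: "complex list" assume z: "length z = N"
      let ?z = "z @ replicate (length xs - N) 0"
      have "(\<Sum>lam | c' lam \<noteq> 0. of_int (c' lam) * schur lam z) = (\<Sum>lam | c' lam \<noteq> 0. of_int (c' lam) * schur lam ?z)"
        by (rule sum.cong) (use c'(2) in \<open>auto simp: schur_append_0\<close>)
      also have "\<dots> = schur mu ?z * schur nu ?z" by (rule c'(3)[symmetric]) (use z False in simp)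
      also have "\<dots> = schur mu z * schur nu z" by (simp add: schur_append_0 assms)
      also have "\<dots> = (\<Sum>lam | c lam \<noteq> 0. of_int (c lam) * schur lam z)" by (rule c(3)[OF z])
      finally show "(\<Sum>lam | c lam \<noteq> 0. of_int (c lam) * schur lam z) = (\<Sum>lam | c' lam \<noteq> 0. of_int (c' lam) * schur lam z)"
        by simp
    qed (use c(2) c'(2) len in auto)
    thus ?thesis using c'(3)[of xs] by simp
  qed
qed

text \<open>Shows that the definite description in \<open>lr_coeffs\<close> denotes: existence from
  an expansion in enough variables, uniqueness from independence.\<close>

lemma lr_coeffs_expansion:
  assumes "is_partition mu" "is_partition nu"
  shows "finite {lam. lr_coeffs mu nu lam \<noteq> 0}"
    and "lr_coeffs mu nu lam \<noteq> 0 \<Longrightarrow> is_partition lam"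
    and "lr_coeffs mu nu lam \<noteq> 0 \<Longrightarrow> part_size lam = part_size mu + part_size nu"
    and "schur mu xs * schur nu xs = (\<Sum>lam | lr_coeffs mu nu lam \<noteq> 0. of_int (lr_coeffs mu nu lam) * schur lam xs)"
proof -
  define N where "N = part_size mu + part_size nu"
  have "nu N = 0" using part_length_le_size[OF assms(2)] by (intro part_zero[OF assms(2)]) (simp add: N_def)
  then obtain c where c: "lr_expansion mu nu N c" using lr_expansion_exists[OF assms] by blast
  have all: "schur mu xs * schur nu xs = (\<Sum>lam | c lam \<noteq> 0. of_int (c lam) * schur lam xs)" for xs
    using lr_expansion_all_variables[OF assms] c unfolding N_def by blast
  have c1: "finite {lam. c lam \<noteq> 0}" "\<And>lam. c lam \<noteq> 0 \<Longrightarrow> is_partition lam \<and> part_size lam = N"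
    using c by (auto simp: lr_expansion_def N_def)
  have "lr_coeffs mu nu = c" unfolding lr_coeffs_def
  proof (rule the_equality)
    show "finite {lam. c lam \<noteq> 0} \<and> (\<forall>lam. c lam \<noteq> 0 \<longrightarrow> is_partition lam) \<and>
      (\<forall>xs. schur mu xs * schur nu xs = (\<Sum>lam | c lam \<noteq> 0. of_int (c lam) * schur lam xs))"
      using c1 all by blast
    fix d :: "(nat \<Rightarrow> nat) \<Rightarrow> int" assume d: "finite {lam. d lam \<noteq> 0} \<and> (\<forall>lam. d lam \<noteq> 0 \<longrightarrow> is_partition lam) \<and>
      (\<forall>xs. schur mu xs * schur nu xs = (\<Sum>lam | d lam \<noteq> 0. of_int (d lam) * schur lam xs))"
    let ?K = "{lam. d lam \<noteq> 0} \<union> {lam. c lam \<noteq> 0}"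
    \<comment> \<open>The competitor \<open>d\<close> carries no degree condition, so the number of
      variables is taken from the lengths in both supports.\<close>
    define M where "M = Max (insert 0 (part_length ` ?K))"
    have M: "lam M = 0" if "lam \<in> ?K" for lam
    proof (rule part_zero[of lam])
      show "is_partition lam" using that d c1 by blast
      have "finite (part_length ` ?K)" using d c1 by blast
      thus "part_length lam \<le> M" unfolding M_def using that by (intro Max_ge) auto
    qed
    have dc: "(\<Sum>lam | d lam \<noteq> 0. of_int (d lam) * schur lam z) = (\<Sum>lam | c lam \<noteq> 0. of_int (c lam) * schur lam z)" for z
      using d all by metis
    show "d = c"
    proof (rule int_schur_independent[OF _ c1(1) _ _ dc])
      show "finite {lam. d lam \<noteq> 0}" using d by blast
      fix lam
      show "is_partition lam \<and> lam M = 0" if "d lam \<noteq> 0" using that d M by blast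
      show "is_partition lam \<and> lam M = 0" if "c lam \<noteq> 0" using that c1 M by blast
    qed
  qed
  thus "finite {lam. lr_coeffs mu nu lam \<noteq> 0}" "lr_coeffs mu nu lam \<noteq> 0 \<Longrightarrow> is_partition lam"
    "lr_coeffs mu nu lam \<noteq> 0 \<Longrightarrow> part_size lam = part_size mu + part_size nu"
    "schur mu xs * schur nu xs = (\<Sum>lam | lr_coeffs mu nu lam \<noteq> 0. of_int (lr_coeffs mu nu lam) * schur lam xs)"
    using c1 all by (auto simp: N_def)
qed

subsection \<open>The Cauchy identity and determinantal Littlewood--Schur functions\<close>

lemma plus_rho_lt: "is_partition lam \<Longrightarrow> lam 0 \<le> M \<Longrightarrow> i < N \<Longrightarrow> plus_rho N lam i < M + N"
  using part_antimono[of lam 0 i] by (simp add: plus_rho_def)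

lemma parts_in_iff:
  assumes "is_partition lam" "lam N = 0"
  shows "lam \<in> parts_in N M \<longleftrightarrow> (\<forall>i<N. plus_rho N lam i < M + N)"
proof
  assume "lam \<in> parts_in N M"
  thus "\<forall>i<N. plus_rho N lam i < M + N" by (auto simp: parts_in_def intro: plus_rho_lt)
next
  assume *: "\<forall>i<N. plus_rho N lam i < M + N"
  show "lam \<in> parts_in N M"
  proof (cases N)
    case 0 thus ?thesis using assms by (simp add: parts_in_def)
  next
    case (Suc n)
    thus ?thesis using assms *[rule_format, of 0] by (simp add: parts_in_def plus_rho_def)
  qed
qed

text \<open>Absorb the factors into the columns, expand the entries in powers and sort the
  exponents. Injective exponent vectors correspond to pairs of a partition in the box and a
  permutation; summing over the permutations gives \<open>jtp\<close>. A polynomial kernel keeps the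
  sum finite.\<close>

theorem cauchy_identity:
  fixes p :: "complex poly"
  assumes "length z = N" "degree p \<le> M"
  shows "(\<Prod>j<N. poly p (z ! j)) * alternant (plus_rho N (\<lambda>_. 0)) z =
    (\<Sum>lam\<in>parts_in N M. jtp N lam (fps_of_poly p) * alternant (plus_rho N lam) z)"
proof -
  let ?P = "fps_of_poly p" and ?Q = "{p. p permutes {..<N}}"
  define c where "c = (\<lambda>i g. fc ?P (int g - int (N - 1 - i)))"
  define F where "F = (\<lambda>g. (\<Prod>i<N. c i (g i)) * alternant g z)"
  define \<phi> where "\<phi> = (\<lambda>(lam, s). restrict (\<lambda>i. plus_rho N lam (s i)) {..<N})"
  have finQ: "finite ?Q" by (rule finite_permutations) simp
  have entry: "poly p x * x ^ (N - 1 - i) = (\<Sum>g<M + N. c i g * x ^ g)" if "i < N" for x i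
  proof -
    define r where "r = N - 1 - i"
    have "poly p x = (\<Sum>n\<le>M. coeff p n * x ^ n)"
      unfolding poly_altdef by (rule sum.mono_neutral_left) (use assms(2) in \<open>auto simp: coeff_eq_0\<close>)
    hence "poly p x * x ^ r = (\<Sum>n\<le>M. coeff p n * x ^ (n + r))"
      by (simp add: sum_distrib_right power_add mult.assoc)
    also have "\<dots> = (\<Sum>n\<le>M. c i (n + r) * x ^ (n + r))"
      unfolding c_def r_def[symmetric] by (simp add: fps_of_poly_nth)
    also have "\<dots> = (\<Sum>g\<in>(\<lambda>n. n + r) ` {..M}. c i g * x ^ g)" by (subst sum.reindex) auto
    also have "\<dots> = (\<Sum>g<M + N. c i g * x ^ g)"
    proof (rule sum.mono_neutral_left)
      show "(\<lambda>n. n + r) ` {..M} \<subseteq> {..<M + N}" using that by (auto simp: r_def)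
      show "\<forall>g\<in>{..<M + N} - (\<lambda>n. n + r) ` {..M}. c i g * x ^ g = 0"
      proof
        fix g assume g: "g \<in> {..<M + N} - (\<lambda>n. n + r) ` {..M}"
        have "g < r \<or> M < g - r"
        proof (rule ccontr)
          assume "\<not> ?thesis"
          hence "g = (g - r) + r" "g - r \<in> {..M}" by auto
          with g show False by blast
        qed
        hence "c i g = 0"
        proof
          assume "g < r" thus ?thesis unfolding c_def r_def[symmetric] by simp
        next
          assume *: "M < g - r"
          hence e: "int g - int r = int (g - r)" by simp
          have "coeff p (g - r) = 0" using * assms(2) by (intro coeff_eq_0) simp
          thus ?thesis unfolding c_def r_def[symmetric] e fc_int fps_of_poly_nth .
        qed
        thus "c i g * x ^ g = 0" by simp
      qed
    qed auto
    finally show ?thesis by (simp add: r_def)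
  qed
  have inj: "inj_on \<phi> (parts_in N M \<times> ?Q)"
  proof (rule inj_onI)
    fix x y assume xy: "x \<in> parts_in N M \<times> ?Q" "y \<in> parts_in N M \<times> ?Q" "\<phi> x = \<phi> y"
    obtain a p b q where e: "x = (a, p)" "y = (b, q)" by (metis prod.exhaust)
    have "plus_rho N a (p i) = plus_rho N b (q i)" if "i < N" for i
      using fun_cong[OF xy(3), of i] that by (simp add: \<phi>_def e)
    hence "a = b \<and> p = q" using xy e by (intro plus_rho_permuted_inj[of _ N]) (auto simp: parts_in_def)
    thus "x = y" using e by simp
  qed
  have "(\<Prod>j<N. poly p (z ! j)) * alternant (plus_rho N (\<lambda>_. 0)) z =
      detf N (\<lambda>i j. z ! j ^ (N - 1 - i)) * (\<Prod>j<N. poly p (z ! j))"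
    by (simp add: alternant_def assms(1) plus_rho_def mult.commute)
  also have "\<dots> = detf N (\<lambda>i j. poly p (z ! j) * z ! j ^ (N - 1 - i))"
  proof -
    have "(\<Prod>j<N. poly p (z ! j)) = (\<Prod>i<N. poly p (z ! s i))" if "s permutes {..<N}" for s
      using prod.permute[OF that, of "\<lambda>j. poly p (z ! j)"] by (simp add: o_def)
    thus ?thesis unfolding detf_expand sum_distrib_right
      by (intro sum.cong refl) (simp add: prod.distrib mult_ac)
  qed
  also have "\<dots> = detf N (\<lambda>i j. \<Sum>g\<in>{..<M + N}. c i g * z ! j ^ g)"
    by (rule detf_cong) (rule entry)
  also have "\<dots> = (\<Sum>g\<in>{..<N} \<rightarrow>\<^sub>E {..<M + N}. F g)"
    by (subst detf_sum_rows) (simp_all add: F_def alternant_def assms(1))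
  also have "\<dots> = (\<Sum>g\<in>\<phi> ` (parts_in N M \<times> ?Q). F g)"
  proof (rule sum.mono_neutral_right)
    show "finite ({..<N} \<rightarrow>\<^sub>E {..<M + N})" by (intro finite_PiE) auto
    show "\<phi> ` (parts_in N M \<times> ?Q) \<subseteq> {..<N} \<rightarrow>\<^sub>E {..<M + N}"
    proof (safe intro!: PiE_I)
      fix lam s i assume *: "lam \<in> parts_in N M" "s permutes {..<N}" "i < N"
      thus "\<phi> (lam, s) i < M + N"
        using plus_rho_lt[of lam M "s i" N] permutes_lessThan[of s N i] by (simp add: \<phi>_def parts_in_def)
    qed (auto simp: \<phi>_def split: if_splits)
    show "\<forall>g\<in>({..<N} \<rightarrow>\<^sub>E {..<M + N}) - \<phi> ` (parts_in N M \<times> ?Q). F g = 0"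
    proof
      fix g assume g: "g \<in> ({..<N} \<rightarrow>\<^sub>E {..<M + N}) - \<phi> ` (parts_in N M \<times> ?Q)"
      have "\<not> inj_on g {..<N}"
      proof
        assume "inj_on g {..<N}"
        then obtain lam s where ls: "is_partition lam" "lam N = 0" "s permutes {..<N}"
          "\<And>i. i < N \<Longrightarrow> g i = plus_rho N lam (s i)" by (rule straighten) blast
        have "plus_rho N lam i < M + N" if "i < N" for i
        proof -
          have "i \<in> s ` {..<N}" using permutes_image[OF ls(3)] that by simp
          then obtain j where "j < N" "i = s j" by auto
          moreover have "g j < M + N" using g \<open>j < N\<close> by (auto simp: PiE_iff)
          ultimately show ?thesis using ls(4)[of j] by simp
        qed
        hence "lam \<in> parts_in N M" using parts_in_iff[OF ls(1,2)] by simp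
        moreover have "g = \<phi> (lam, s)"
        proof
          fix i show "g i = \<phi> (lam, s) i"
            using g ls(4)[of i] by (cases "i < N") (auto simp: \<phi>_def PiE_iff extensional_def)
        qed
        ultimately have "g \<in> \<phi> ` (parts_in N M \<times> ?Q)" using ls(3) by (intro image_eqI[of _ _ "(lam, s)"]) auto
        with g show False by simp
      qed
      thus "F g = 0" by (simp add: F_def alternant_not_inj assms(1))
    qed
  qed
  also have "\<dots> = (\<Sum>x\<in>parts_in N M \<times> ?Q. F (\<phi> x))" by (subst sum.reindex[OF inj]) simp
  also have "\<dots> = (\<Sum>lam\<in>parts_in N M. \<Sum>s\<in>?Q. F (\<phi> (lam, s)))"
    by (subst sum.cartesian_product) simp
  also have "\<dots> = (\<Sum>lam\<in>parts_in N M. jtp N lam ?P * alternant (plus_rho N lam) z)"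
  proof (rule sum.cong[OF refl])
    fix lam
    have "(\<Sum>s\<in>?Q. F (\<phi> (lam, s))) =
      (\<Sum>s\<in>?Q. of_int (sign s) * (\<Prod>i<N. c i (plus_rho N lam (s i)))) * alternant (plus_rho N lam) z"
      unfolding sum_distrib_right
    proof (rule sum.cong[OF refl])
      fix s assume "s \<in> ?Q"
      hence "alternant (\<phi> (lam, s)) z = of_int (sign s) * alternant (plus_rho N lam) z"
        by (intro alternant_permuted) (auto simp: assms(1) \<phi>_def)
      thus "F (\<phi> (lam, s)) = of_int (sign s) * (\<Prod>i<N. c i (plus_rho N lam (s i))) * alternant (plus_rho N lam) z"
        by (simp add: F_def) (simp add: \<phi>_def mult_ac)
    qed
    also have "(\<Sum>s\<in>?Q. of_int (sign s) * (\<Prod>i<N. c i (plus_rho N lam (s i)))) =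
        detf N (\<lambda>i j. c i (plus_rho N lam j))" by (simp add: detf_expand)
    also have "\<dots> = detf N (\<lambda>i j. c j (plus_rho N lam i))" by (rule detf_transpose[symmetric])
    also have "\<dots> = jtp N lam ?P"
      unfolding jtp_def jt_def by (rule detf_cong) (simp add: c_def plus_rho_def of_nat_diff algebra_simps)
    finally show "(\<Sum>s\<in>?Q. F (\<phi> (lam, s))) = jtp N lam ?P * alternant (plus_rho N lam) z" .
  qed
  finally show ?thesis .
qed

section \<open>The determinant of a product of two series\<close>

definition part_pairs :: "nat \<Rightarrow> ((nat \<Rightarrow> nat) \<times> (nat \<Rightarrow> nat)) set" where
  "part_pairs s = {(\<mu>, \<nu>). is_partition \<mu> \<and> is_partition \<nu> \<and> part_size \<mu> + part_size \<nu> = s}"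

text \<open>Both sides are the coefficient of the alternant of \<open>lam\<close> in the product of two Cauchy kernels.\<close>

lemma jtp_mult_poly:
  fixes p q :: "complex poly"
  assumes "is_partition lam" "part_size lam \<le> N"
  shows "jtp N lam (fps_of_poly (p * q)) = (\<Sum>(\<mu>, \<nu>)\<in>part_pairs (part_size lam).
    of_int (lr_coeffs \<mu> \<nu> lam) * jtp N \<mu> (fps_of_poly p) * jtp N \<nu> (fps_of_poly q))"
proof -
  \<comment> \<open>Bounds the degrees of p, q and their product, and makes the box contain all
    components of \<open>part_pairs (part_size lam)\<close>.\<close>
  define M where "M = degree p + degree q + part_size lam"
  let ?PP = "parts_in N M \<times> parts_in N M"
  define D :: "(nat \<Rightarrow> nat) \<times> (nat \<Rightarrow> nat) \<Rightarrow> complex"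
    where "D = (\<lambda>(\<mu>, \<nu>). jtp N \<mu> (fps_of_poly p) * jtp N \<nu> (fps_of_poly q))"
  define C where "C = (\<lambda>(\<mu>, \<nu>). lr_coeffs \<mu> \<nu>)"
  \<comment> \<open>One finite index set for both sides; products of Schur polynomials may involve
    partitions outside the box.\<close>
  define K where "K = parts_in N M \<union> (\<Union>x\<in>?PP. {ka. C x ka \<noteq> 0 \<and> ka N = 0})"
  have part: "is_partition \<mu>" if "\<mu> \<in> parts_in N M" for \<mu> using that by (simp add: parts_in_def)
  have finC: "finite {ka. C x ka \<noteq> 0}" if "x \<in> ?PP" for x
    using lr_coeffs_expansion(1) part that by (auto simp: C_def)
  have partC: "is_partition ka" if "x \<in> ?PP" "C x ka \<noteq> 0" for x ka
    using lr_coeffs_expansion(2) part that by (auto simp: C_def)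
  have finK: "finite K" unfolding K_def
  proof (intro finite_UnI finite_parts_in finite_UN_I finite_cartesian_product)
    fix x assume "x \<in> ?PP"
    from finC[OF this] show "finite {ka. C x ka \<noteq> 0 \<and> ka N = 0}" by (rule rev_finite_subset) auto
  qed
  have K: "is_partition ka \<and> ka N = 0" if "ka \<in> K" for ka
  proof (cases "ka \<in> parts_in N M")
    case False
    hence "ka \<in> (\<Union>x\<in>?PP. {ka. C x ka \<noteq> 0 \<and> ka N = 0})" using that by (simp only: K_def Un_iff simp_thms)
    then obtain x where "x \<in> ?PP" "ka \<in> {ka. C x ka \<noteq> 0 \<and> ka N = 0}" by (rule UN_E)
    thus ?thesis using partC[of x ka] by simp
  qed (simp add: parts_in_def)
  define J where "J = (\<lambda>ka. if ka \<in> parts_in N M then jtp N ka (fps_of_poly (p * q)) else 0)"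
  define d where "d = (\<lambda>ka. (\<Sum>x\<in>?PP. D x * of_int (C x ka)) - J ka)"
  have lam: "lam \<in> parts_in N M"
    by (rule parts_of_size_in) (use assms in \<open>auto simp: M_def\<close>)
  have "d lam = 0"
  proof (rule alternants_independent[where K = K and N = N and d = d])
    fix z :: "complex list" assume z: "distinct z" "length z = N"
    define a where "a = (\<lambda>ka. alternant (plus_rho N ka) z)"
    let ?R = "a (\<lambda>_. 0)"
    have cauchy: "(\<Prod>j<N. poly r (z ! j)) * ?R = (\<Sum>ka\<in>parts_in N M. jtp N ka (fps_of_poly r) * a ka)"
      if "degree r \<le> M" for r
      unfolding a_def by (rule cauchy_identity) (use z that in auto)
    \<comment> \<open>Partitions with more than N parts vanish in N variables, which is why K keeps
      only \<open>ka N = 0\<close>.\<close>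
    have bialt: "schur ka z * ?R = (if ka N = 0 then a ka else 0)" if "is_partition ka" for ka
      using schur_mult_alternant_rho[OF z(1) that] z(2) by (simp add: a_def)
    have deg: "degree (p * q) \<le> M" using degree_mult_le[of p q] by (simp add: M_def)
    have "(\<Sum>ka\<in>K. J ka * a ka) = (\<Sum>ka\<in>parts_in N M. jtp N ka (fps_of_poly (p * q)) * a ka)"
      by (rule sum.mono_neutral_cong_right) (use finK in \<open>auto simp: K_def J_def\<close>)
    also have "\<dots> = (\<Prod>j<N. poly q (z ! j)) * ((\<Prod>j<N. poly p (z ! j)) * ?R)"
      by (subst cauchy[OF deg, symmetric]) (simp add: prod.distrib mult_ac)
    also have "(\<Prod>j<N. poly p (z ! j)) * ?R = (\<Sum>\<mu>\<in>parts_in N M. jtp N \<mu> (fps_of_poly p) * a \<mu>)"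
      by (rule cauchy) (simp add: M_def)
    also have "\<dots> = (\<Sum>\<mu>\<in>parts_in N M. jtp N \<mu> (fps_of_poly p) * schur \<mu> z) * ?R"
      unfolding sum_distrib_right mult.assoc
      by (intro sum.cong refl) (auto simp: parts_in_def bialt)
    also have "(\<Prod>j<N. poly q (z ! j)) * \<dots> = (\<Sum>\<mu>\<in>parts_in N M. jtp N \<mu> (fps_of_poly p) * schur \<mu> z) *
        ((\<Prod>j<N. poly q (z ! j)) * ?R)" by (simp only: mult_ac)
    also have "(\<Prod>j<N. poly q (z ! j)) * ?R = (\<Sum>\<nu>\<in>parts_in N M. jtp N \<nu> (fps_of_poly q) * a \<nu>)"
      by (rule cauchy) (simp add: M_def)
    also have "\<dots> = (\<Sum>\<nu>\<in>parts_in N M. jtp N \<nu> (fps_of_poly q) * schur \<nu> z) * ?R"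
      unfolding sum_distrib_right mult.assoc
      by (intro sum.cong refl) (auto simp: parts_in_def bialt)
    also have "(\<Sum>\<mu>\<in>parts_in N M. jtp N \<mu> (fps_of_poly p) * schur \<mu> z) *
        ((\<Sum>\<nu>\<in>parts_in N M. jtp N \<nu> (fps_of_poly q) * schur \<nu> z) * ?R) =
      (\<Sum>(\<mu>, \<nu>)\<in>?PP. D (\<mu>, \<nu>) * (schur \<mu> z * schur \<nu> z * ?R))"
    proof -
      have "sum f A * (sum g A * r) = (\<Sum>(\<mu>, \<nu>)\<in>A \<times> A. f \<mu> * g \<nu> * r)"
        for f g :: "(nat \<Rightarrow> nat) \<Rightarrow> complex" and A r
        by (simp only: mult.assoc[symmetric] sum_product sum.cartesian_product)
           (simp add: sum_distrib_right case_prod_beta)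
      thus ?thesis by (simp add: D_def mult_ac)
    qed
    also have "\<dots> = (\<Sum>x\<in>?PP. D x * (\<Sum>ka\<in>K. of_int (C x ka) * a ka))"
    proof (rule sum.cong[OF refl], clarify)
      fix \<mu> \<nu> assume mn: "\<mu> \<in> parts_in N M" "\<nu> \<in> parts_in N M"
      let ?x = "(\<mu>, \<nu>)"
      have "schur \<mu> z * schur \<nu> z * ?R = (\<Sum>ka | C ?x ka \<noteq> 0. of_int (C ?x ka) * schur ka z) * ?R"
        using lr_coeffs_expansion(4)[OF part part, OF mn] by (simp add: C_def)
      also have "\<dots> = (\<Sum>ka | C ?x ka \<noteq> 0. of_int (C ?x ka) * (if ka N = 0 then a ka else 0))"
        unfolding sum_distrib_right mult.assoc
        by (intro sum.cong refl) (use partC[of ?x] mn bialt in auto)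
      also have "\<dots> = (\<Sum>ka | C ?x ka \<noteq> 0 \<and> ka N = 0. of_int (C ?x ka) * a ka)"
        by (rule sum.mono_neutral_cong_right) (use finC[of ?x] mn in auto)
      also have "\<dots> = (\<Sum>ka\<in>K. of_int (C ?x ka) * a ka)"
      proof (rule sum.mono_neutral_left[OF finK])
        show "{ka. C ?x ka \<noteq> 0 \<and> ka N = 0} \<subseteq> K" unfolding K_def using mn by blast
        show "\<forall>ka\<in>K - {ka. C ?x ka \<noteq> 0 \<and> ka N = 0}. of_int (C ?x ka) * a ka = 0"
        proof
          fix ka assume ka: "ka \<in> K - {ka. C ?x ka \<noteq> 0 \<and> ka N = 0}"
          hence "ka N = 0" using K[of ka] by simp
          with ka have "C ?x ka = 0" by simp
          thus "of_int (C ?x ka) * a ka = 0" by simp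
        qed
      qed
      finally show "D ?x * (schur \<mu> z * schur \<nu> z * ?R) = D ?x * (\<Sum>ka\<in>K. of_int (C ?x ka) * a ka)" by simp
    qed
    also have "\<dots> = (\<Sum>ka\<in>K. (\<Sum>x\<in>?PP. D x * of_int (C x ka)) * a ka)"
      unfolding sum_distrib_left sum_distrib_right by (subst sum.swap) (simp add: mult_ac)
    finally show "(\<Sum>ka\<in>K. d ka * alternant (plus_rho N ka) z) = 0"
      by (simp add: d_def left_diff_distrib sum_subtractf a_def)
  next
    show "finite K" by (rule finK)
    show "lam \<in> K" using lam by (simp add: K_def)
    show "is_partition ka \<and> ka N = 0" if "ka \<in> K" for ka by (rule K[OF that])
  qed
  hence "jtp N lam (fps_of_poly (p * q)) = (\<Sum>x\<in>?PP. D x * of_int (C x lam))"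
    using lam by (simp add: d_def J_def)
  also have "\<dots> = (\<Sum>x\<in>part_pairs (part_size lam). D x * of_int (C x lam))"
  proof (rule sum.mono_neutral_right)
    show "finite ?PP" by (simp add: finite_parts_in)
    show "part_pairs (part_size lam) \<subseteq> ?PP"
      using assms(2) by (auto simp: part_pairs_def M_def intro!: parts_of_size_in)
    show "\<forall>x\<in>?PP - part_pairs (part_size lam). D x * of_int (C x lam) = 0"
    proof (clarify)
      fix \<mu> \<nu> assume "\<mu> \<in> parts_in N M" "\<nu> \<in> parts_in N M" "(\<mu>, \<nu>) \<notin> part_pairs (part_size lam)"
      hence "lr_coeffs \<mu> \<nu> lam = 0"
        using lr_coeffs_expansion(3)[of \<mu> \<nu> lam] part by (auto simp: part_pairs_def)
      thus "D (\<mu>, \<nu>) * of_int (C (\<mu>, \<nu>) lam) = 0" by (simp add: C_def)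
    qed
  qed
  finally show ?thesis by (simp add: D_def C_def case_prod_beta mult_ac)
qed

lemma jtp_cong:
  assumes "is_partition lam" "\<And>n. n \<le> lam 0 + N \<Longrightarrow> fps_nth H n = fps_nth H' n"
  shows "jtp N lam H = jtp N lam H'"
  unfolding jtp_def jt_def
proof (rule detf_cong)
  fix i j assume "i < N" "j < N"
  moreover have "lam i \<le> lam 0" by (rule part_antimono[OF assms(1)]) simp
  ultimately show "fc H (int (lam i) - int i + int j) = fc H' (int (lam i) - int i + int j)"
    unfolding fc_def using assms(2)[of "nat (int (lam i) - int i + int j)"] by auto
qed

text \<open>The determinants see only finitely many coefficients, at positions up to
  \<open>part_size lam + N\<close>, so both series can be truncated to polynomials.\<close>

lemma jtp_mult:
  assumes "is_partition lam" "part_size lam \<le> N"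
  shows "jtp N lam (H * H') = (\<Sum>(\<mu>, \<nu>)\<in>part_pairs (part_size lam).
    of_int (lr_coeffs \<mu> \<nu> lam) * jtp N \<mu> H * jtp N \<nu> H')"
proof -
  define R where "R = part_size lam + N"
  define tr where "tr = (\<lambda>H :: complex fps. \<Sum>n\<le>R. Polynomial.monom (fps_nth H n) n)"
  have tr: "coeff (tr H) n = fps_nth H n" if "n \<le> R" for H n
    using that by (simp add: tr_def coeff_sum)
  have small: "jtp N \<mu> (fps_of_poly (tr H)) = jtp N \<mu> H" if "is_partition \<mu>" "part_size \<mu> \<le> part_size lam" for \<mu> H
  proof (rule jtp_cong[OF that(1)])
    fix n assume "n \<le> \<mu> 0 + N"
    hence "n \<le> R" using part_le_size[OF that(1), of 0] that(2) by (simp add: R_def)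
    thus "fps_nth (fps_of_poly (tr H)) n = fps_nth H n" by (simp add: tr fps_of_poly_nth)
  qed
  have "jtp N lam (H * H') = jtp N lam (fps_of_poly (tr H * tr H'))"
  proof (rule jtp_cong[OF assms(1)])
    fix n assume "n \<le> lam 0 + N"
    hence "n \<le> R" using part_le_size[OF assms(1), of 0] by (simp add: R_def)
    thus "fps_nth (H * H') n = fps_nth (fps_of_poly (tr H * tr H')) n"
      by (simp add: fps_mult_nth coeff_mult tr atLeast0AtMost fps_of_poly_nth)
  qed
  also have "\<dots> = (\<Sum>(\<mu>, \<nu>)\<in>part_pairs (part_size lam).
    of_int (lr_coeffs \<mu> \<nu> lam) * jtp N \<mu> H * jtp N \<nu> H')"
    unfolding jtp_mult_poly[OF assms]
    by (rule sum.cong) (auto simp: part_pairs_def small)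
  finally show ?thesis .
qed

text \<open>By Jacobi-Trudi and its dual, both Schur factors in LS are determinants governed by
  \<mu> and \<nu> themselves, so the sum is the one in \<open>jtp_mult\<close>. Size
  \<open>part_size lam\<close> fits all \<mu> and \<nu> at once; stability then changes it to
  N.\<close>

theorem LS_jacobi_trudi:
  assumes "is_partition lam" "lam N = 0"
  shows "LS lam X Y = jtp N lam (hser X * eser Y)"
proof -
  define M where "M = part_size lam"
  have "LS lam X Y = (\<Sum>(\<mu>, \<nu>)\<in>part_pairs M. of_int (lr_coeffs \<mu> \<nu> lam) * jtp M \<mu> (hser X) * jtp M \<nu> (eser Y))"
    unfolding LS_def part_pairs_def[symmetric] M_def[symmetric]
  proof (rule sum.cong[OF refl], clarify)
    fix \<mu> \<nu> assume "(\<mu>, \<nu>) \<in> part_pairs M"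
    hence mn: "is_partition \<mu>" "is_partition \<nu>" "part_size \<mu> \<le> M" "part_size \<nu> \<le> M"
      by (auto simp: part_pairs_def)
    have "\<mu> M = 0" "\<nu> M = 0"
      using mn part_length_le_size[OF mn(1)] part_length_le_size[OF mn(2)]
        part_zero[OF mn(1), of M] part_zero[OF mn(2), of M] by auto
    thus "of_int (lr_coeffs \<mu> \<nu> lam) * schur \<mu> X * schur (conjugate \<nu>) Y =
      of_int (lr_coeffs \<mu> \<nu> lam) * jtp M \<mu> (hser X) * jtp M \<nu> (eser Y)"
      using mn by (simp add: jacobi_trudi[of \<mu> M] dual_jacobi_trudi[of \<nu> M])
  qed
  also have "\<dots> = jtp M lam (hser X * eser Y)"
    unfolding M_def by (rule jtp_mult[symmetric]) (use assms in auto)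
  also have "\<dots> = jtp (part_length lam) lam (hser X * eser Y)"
    by (rule jtp_stable) (auto simp: M_def part_zero[OF assms(1)] part_length_le_size[OF assms(1)])
  also have "\<dots> = jtp N lam (hser X * eser Y)"
    by (rule jtp_stable[symmetric]) (use assms part_length_le_iff in \<open>auto simp: part_zero[OF assms(1)]\<close>)
  finally show ?thesis .
qed

subsection \<open>Overlaps and the index\<close>

lemma add_rho_nth: "i < a \<Longrightarrow> add_rho a \<mu> ! i = plus_rho a \<mu> i"
  by (simp add: add_rho_def plus_rho_def)

lemma length_add_rho [simp]: "length (add_rho a \<mu>) = a"
  by (simp add: add_rho_def)

lemma set_add_rho: "set (add_rho a \<mu>) = plus_rho a \<mu> ` {..<a}"
  by (auto simp: add_rho_def plus_rho_def)

lemma distinct_add_rho: "is_partition \<mu> \<Longrightarrow> distinct (add_rho a \<mu>)"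
  using plus_rho_inj[of \<mu> a] by (auto simp: distinct_conv_nth add_rho_nth inj_on_def)

lemma is_overlap_unique:
  assumes "is_overlap a b \<mu> \<nu> \<kappa>" "is_overlap a b \<mu> \<nu> \<kappa>'"
  shows "\<kappa> = \<kappa>'"
proof -
  have p: "is_partition \<kappa>" "is_partition \<kappa>'" "\<kappa> (a + b) = 0" "\<kappa>' (a + b) = 0"
    using assms part_length_le_iff by (auto simp: is_overlap_def)
  have "mset (add_rho (a + b) \<kappa>) = mset (add_rho (a + b) \<kappa>')"
    using assms by (simp add: is_overlap_def)
  hence "set (add_rho (a + b) \<kappa>) = set (add_rho (a + b) \<kappa>')" by (rule mset_eq_setD)
  hence im: "plus_rho (a + b) \<kappa> ` {..<a + b} = plus_rho (a + b) \<kappa>' ` {..<a + b}"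
    by (simp add: set_add_rho)
  have eq: "plus_rho (a + b) \<kappa> i = plus_rho (a + b) \<kappa>' i" if "i < a + b" for i
    by (rule strictly_decreasing_image_eq[OF _ _ im that]) (use plus_rho_less p in auto)
  show ?thesis
  proof (rule part_ext[OF p])
    fix i assume "i < a + b"
    thus "\<kappa> i = \<kappa>' i" using eq[of i] by (simp add: plus_rho_def)
  qed
qed

lemma overlapD:
  assumes "overlap a b \<mu> \<nu> = Some \<kappa>"
  shows "is_overlap a b \<mu> \<nu> \<kappa>"
proof -
  have ex: "\<exists>\<kappa>. is_overlap a b \<mu> \<nu> \<kappa>" and the: "(THE \<kappa>. is_overlap a b \<mu> \<nu> \<kappa>) = \<kappa>"
    using assms by (auto simp: overlap_def split: if_splits)
  show ?thesis using ex theI'[of "is_overlap a b \<mu> \<nu>"] is_overlap_unique unfolding the[symmetric] by blast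
qed

text \<open>The entries of \<kappa> + \<rho> are distinct, so the sorting permutation is unique and
  the definite description in \<open>overlap_sign\<close> denotes it.\<close>

lemma overlap_permutation:
  assumes "overlap a b \<mu> \<nu> = Some \<kappa>"
  obtains p where "p permutes {..<a + b}" "overlap_sign a b \<mu> \<nu> = sign p"
    "\<And>i. i < a + b \<Longrightarrow> plus_rho (a + b) \<kappa> i = (add_rho a \<mu> @ add_rho b \<nu>) ! p i"
proof -
  let ?xs = "add_rho a \<mu> @ add_rho b \<nu>" and ?ys = "add_rho (a + b) \<kappa>"
  have ov: "is_partition \<kappa>" "mset ?ys = mset ?xs"
    using overlapD[OF assms] by (auto simp: is_overlap_def)
  have "distinct ?ys" by (rule distinct_add_rho[OF ov(1)])
  hence dist: "distinct ?xs" using ov(2) by (metis mset_eq_imp_distinct_iff)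
  obtain p where p: "p permutes {..<length ?xs}" "permute_list p ?xs = ?ys"
    using mset_eq_permutation[OF ov(2)] by blast
  have nth: "?ys ! i = ?xs ! q i" if "q permutes {..<a + b}" "permute_list q ?xs = ?ys" "i < a + b" for q i
    unfolding that(2)[symmetric] using that(1,3) by (subst permute_list_nth) auto
  have "(THE \<pi>. \<pi> permutes {..<a + b} \<and> permute_list \<pi> ?xs = ?ys) = p"
  proof (rule the_equality)
    show "p permutes {..<a + b} \<and> permute_list p ?xs = ?ys" using p by simp
    fix q assume q: "q permutes {..<a + b} \<and> permute_list q ?xs = ?ys"
    show "q = p"
    proof
      fix i show "q i = p i"
      proof (cases "i < a + b")
        case True
        have "?xs ! q i = ?xs ! p i" using nth[of q i] nth[of p i] q p True by simp
        moreover have "q i < a + b" "p i < a + b" using q p True permutes_lessThan by auto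
        ultimately show ?thesis using nth_eq_iff_index_eq[OF dist] by simp
      next
        case False
        thus ?thesis using p q by (simp add: permutes_def)
      qed
    qed
  qed
  hence "overlap_sign a b \<mu> \<nu> = sign p" using assms by (simp add: overlap_sign_def)
  moreover have "plus_rho (a + b) \<kappa> i = ?xs ! p i" if "i < a + b" for i
    using nth[of p i] p that by (simp add: add_rho_nth)
  ultimately show ?thesis using that p(1) by simp
qed

section \<open>The index and the parts next to it\<close>

lemma mn_index_props:
  assumes "is_partition lam"
  shows "mn_index m n lam \<le> min (int m) (int n)"
    and "(int m + 1 - mn_index m n lam, int n + 1 - mn_index m n lam) \<notin> diagram lam"
    and "mn_index m n lam < min (int m) (int n) \<Longrightarrow>
      (int m - mn_index m n lam, int n - mn_index m n lam) \<in> diagram lam"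
proof -
  define P where "P = (\<lambda>k. k \<le> min (int m) (int n) \<and> (int m + 1 - k, int n + 1 - k) \<notin> diagram lam)"
  \<comment> \<open>So small that row n + 1 - k0 lies beyond the last part; both coordinates are
    positive, so the added half-axes do not interfere.\<close>
  define k0 where "k0 = min (int m) (int n) - int (part_length lam) - 1"
  have "P k0"
  proof -
    have "lam (nat (int n - k0)) = 0"
      by (rule part_zero[OF assms]) (simp add: k0_def)
    moreover have "k0 < int m" "k0 < int n" by (simp_all add: k0_def)
    ultimately show ?thesis by (auto simp: P_def diagram_def)
  qed
  have fin: "finite {k. k0 \<le> k \<and> P k}"
    by (rule finite_subset[of _ "{k0..min (int m) (int n)}"]) (auto simp: P_def)
  define k where "k = Max {k. k0 \<le> k \<and> P k}"
  have k: "k0 \<le> k" "P k" using Max_in[OF fin] \<open>P k0\<close> by (auto simp: k_def)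
  have max: "j \<le> k" if "P j" for j
  proof (cases "k0 \<le> j")
    case True thus ?thesis unfolding k_def using that by (intro Max_ge fin) auto
  qed (use k in auto)
  have "mn_index m n lam = k"
    unfolding mn_index_def P_def[symmetric] by (rule Greatest_equality) (use k max in auto)
  thus "mn_index m n lam \<le> min (int m) (int n)"
    "(int m + 1 - mn_index m n lam, int n + 1 - mn_index m n lam) \<notin> diagram lam"
    "mn_index m n lam < min (int m) (int n) \<Longrightarrow>
      (int m - mn_index m n lam, int n - mn_index m n lam) \<in> diagram lam"
    using k(2) max[of "k + 1"] by (auto simp: P_def)
qed

text \<open>Maximality of the index puts the point (m - k, n - k) into the diagram, and earlier rows
  are at least as long. If k attains the minimum of m and n, either the bound is 0 or there are no
  such rows.\<close>

lemma mn_index_rows: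
  assumes "is_partition lam" "k = mn_index m n lam" "int i < int n - k"
  shows "int m - k \<le> int (lam i)"
proof -
  have le: "k \<le> min (int m) (int n)" using mn_index_props(1)[OF assms(1)] assms(2) by simp
  show ?thesis
  proof (cases "k = min (int m) (int n)")
    case True thus ?thesis using assms(3) by auto
  next
    case False
    hence "k < min (int m) (int n)" using le by linarith
    hence "(int m - k, int n - k) \<in> diagram lam"
      using mn_index_props(3)[OF assms(1), of m n] assms(2) by simp
    hence "int m - k \<le> int (lam (nat (int n - k - 1)))"
      using False le by (auto simp: diagram_def)
    also have "lam (nat (int n - k - 1)) \<le> lam i"
      by (rule part_antimono[OF assms(1)]) (use assms(3) in auto)
    finally show ?thesis by simp
  qed
qed

lemma mn_index_rest:
  assumes "is_partition lam" "k = mn_index m n lam"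
  shows "int (lam (nat (int n - k))) \<le> int m - k"
  using mn_index_props(1,2)[OF assms(1), of m n] unfolding assms(2)[symmetric]
  by (auto simp: diagram_def)

subsection \<open>Proof of the theorem\<close>

lemma set_nths_index: "I \<subseteq> {..<length xs} \<Longrightarrow> set (nths xs I) = (\<lambda>i. xs ! i) ` I"
  by (auto simp: set_nths)

text \<open>Negation reverses each difference, so the denominator of the expansion in the negated
  variables is \<Delta>(T; S) without a sign.\<close>

lemma Delta_distinct:
  assumes "distinct S" "distinct T"
  shows "Delta T S = (\<Prod>s\<in>uminus ` set S. \<Prod>t\<in>uminus ` set T. s - t)"
proof -
  have "Delta T S = (\<Prod>t\<in>set T. \<Prod>s\<in>set S. t - s)"
    using assms by (simp add: Delta_def prod.distinct_set_conv_list)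
  also have "\<dots> = (\<Prod>s\<in>set S. \<Prod>t\<in>set T. t - s)" by (rule prod.swap)
  finally show ?thesis by (simp add: prod.reindex)
qed

text \<open>The theorem sums over sets of positions, the determinant expansion over sets of values;
  distinct entries identify the two.\<close>

lemma sum_subsets_index:
  assumes "distinct xs"
  shows "(\<Sum>I | I \<subseteq> {..<length xs} \<and> card I = l. F ((\<lambda>i. xs ! i) ` I)) = (\<Sum>S | S \<subseteq> set xs \<and> card S = l. F S)"
proof (rule sum.reindex_bij_betw[where h = "image ((!) xs)" and g = F])
  have b: "bij_betw ((!) xs) {..<length xs} (set xs)" by (rule bij_betw_nth) (use assms in auto)
  have inj: "inj_on ((!) xs) I" if "I \<subseteq> {..<length xs}" for I
    using b that by (auto simp: bij_betw_def intro: inj_on_subset)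
  have "bij_betw (image ((!) xs)) (Pow {..<length xs}) (Pow (set xs))" by (rule bij_betw_Pow[OF b])
  hence "bij_betw (image ((!) xs)) {I \<in> Pow {..<length xs}. card I = l} {S \<in> Pow (set xs). card S = l}"
    by (rule bij_betw_Collect) (use inj in \<open>auto simp: card_image\<close>)
  thus "bij_betw (image ((!) xs)) {I. I \<subseteq> {..<length xs} \<and> card I = l} {S. S \<subseteq> set xs \<and> card S = l}"
    by simp
qed

theorem mainTheorem1:
  fixes m n l :: nat and k :: int
    and X Y :: "complex list"
    and lam \<mu> \<nu> :: "nat \<Rightarrow> nat"
  assumes "length X = n" and "distinct X" and "length Y = m"
    and "is_partition lam" and "k = mn_index m n lam"
    and "int l \<le> min (int n - k) (int n)"
    and "is_partition \<mu>" and "part_length \<mu> \<le> l"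
    and "is_partition \<nu>" and "int (part_length \<nu>) \<le> int n - k - int l"
    and "Some (seq_take (nat (int n - k)) lam) = overlap l (nat (int n - k - int l)) \<mu> \<nu>"
  shows "LS lam (map uminus X) Y =
    (\<Sum>I | I \<subseteq> {..<n} \<and> card I = l.
      let S = nths X I; T = nths X ({..<n} - I) in
      of_int (overlap_sign l (nat (int n - k - int l)) \<mu> \<nu>)
        * LS (add_rect \<mu> k l) (map uminus S) Y
        * LS (seq_append (nat (int n - k - int l)) \<nu> (seq_drop (nat (int n - k)) lam)) (map uminus T) Y
        / Delta T S)"
proof -
  define b where "b = nat (int n - k - int l)"
  define \<kappa> where "\<kappa> = seq_take (l + b) lam"
  define A where "A = uminus ` set X"
  have nk: "int n - k = int l + int b" "nat (int n - k) = l + b" using assms(6) by (auto simp: b_def)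
  have ov: "overlap l b \<mu> \<nu> = Some \<kappa>" using assms(11) by (simp add: \<kappa>_def nk(2) b_def)
  obtain p where p: "p permutes {..<l + b}" "overlap_sign l b \<mu> \<nu> = sign p"
    "\<And>i. i < l + b \<Longrightarrow> plus_rho (l + b) \<kappa> i = (add_rho l \<mu> @ add_rho b \<nu>) ! p i"
    by (rule overlap_permutation[OF ov]) blast
  have kap: "\<kappa> i = lam i" if "i < l + b" for i using that by (simp add: \<kappa>_def seq_take_def)
  \<comment> \<open>The index bounds the parts of \<lambda> from below, and \<rho> only enlarges
    them. The permutation carries the bound to the shifted parts of \<mu> and \<nu>.\<close>
  have big: "int m - k \<le> int (plus_rho (l + b) \<kappa> i)" if "i < l + b" for i
    using mn_index_rows[OF assms(4,5), of i] that nk by (simp add: plus_rho_def kap)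
  have big': "int m - k \<le> int ((add_rho l \<mu> @ add_rho b \<nu>) ! i)" if "i < l + b" for i
  proof -
    have "i \<in> p ` {..<l + b}" using permutes_image[OF p(1)] that by simp
    then obtain j where "j < l + b" "i = p j" by auto
    thus ?thesis using big[of j] p(3)[of j] by simp
  qed
  have mu_rho: "int m - k \<le> int (plus_rho l \<mu> i)" if "i < l" for i
    using big'[of i] that by (simp add: nth_append add_rho_nth)
  have nu_rho: "int m - k \<le> int (plus_rho b \<nu> i)" if "i < b" for i
    using big'[of "l + i"] that by (simp add: nth_append add_rho_nth)
  \<comment> \<open>At the last part \<rho> contributes 0, so there the bound holds for \<mu>
    itself, and earlier parts are no smaller.\<close>
  have mu_ge: "int m - k \<le> int (\<mu> i)" if "i < l" for i
  proof -
    have "\<mu> (l - 1) \<le> \<mu> i" by (rule part_antimono[OF assms(7)]) (use that in simp)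
    moreover have "int m - k \<le> int (\<mu> (l - 1))" using mu_rho[of "l - 1"] that by (simp add: plus_rho_def)
    ultimately show ?thesis by simp
  qed
  have nu_ge: "int m - k \<le> int (\<nu> i)" if "i < b" for i
  proof -
    have "\<nu> (b - 1) \<le> \<nu> i" by (rule part_antimono[OF assms(9)]) (use that in simp)
    moreover have "int m - k \<le> int (\<nu> (b - 1))" using nu_rho[of "b - 1"] that by (simp add: plus_rho_def)
    ultimately show ?thesis by simp
  qed
  have mu_l: "\<mu> i = 0" if "l \<le> i" for i
    using part_zero[OF assms(7)] assms(8) that by simp

  define \<sigma> where "\<sigma> = add_rect \<mu> k l"
  define \<tau> where "\<tau> = seq_append b \<nu> (seq_drop (l + b) lam)"
  \<comment> \<open>Each of these parts plus k is at least m, so \<open>nat\<close> in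
    \<open>add_rect\<close> does not truncate.\<close>
  have sig: "int (\<sigma> i) = int (\<mu> i) + k" if "i < l" for i
    using mu_ge[OF that] that by (simp add: \<sigma>_def add_rect_def)
  have sig0: "\<sigma> i = 0" if "l \<le> i" for i using mu_l[OF that] that by (simp add: \<sigma>_def add_rect_def)
  have sig_part: "is_partition \<sigma>" unfolding is_partition_def
  proof
    show "antimono \<sigma>"
    proof (rule decseq_SucI)
      fix i show "\<sigma> (Suc i) \<le> \<sigma> i"
        using sig[of i] sig[of "Suc i"] sig0[of "Suc i"] part_antimono[OF assms(7), of i "Suc i"]
        by (cases "Suc i < l") auto
    qed
    show "finite {i. \<sigma> i \<noteq> 0}"
    proof (rule finite_subset)
      show "{i. \<sigma> i \<noteq> 0} \<subseteq> {..<l}"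
      proof
        fix i assume "i \<in> {i. \<sigma> i \<noteq> 0}"
        thus "i \<in> {..<l}" using sig0[of i] by (cases "l \<le> i") auto
      qed
    qed simp
  qed
  have tau1: "\<tau> i = \<nu> i" if "i < b" for i using that by (simp add: \<tau>_def seq_append_def)
  have tau2: "\<tau> (b + i) = lam (l + b + i)" for i
    by (simp add: \<tau>_def seq_append_def seq_drop_def add_ac)
  have tau_part: "is_partition \<tau>" unfolding is_partition_def
  proof
    show "antimono \<tau>"
    proof (rule decseq_SucI)
      fix i
      consider "Suc i < b" | "Suc i = b" | "b \<le> i" by linarith
      thus "\<tau> (Suc i) \<le> \<tau> i"
      proof cases
        case 1 thus ?thesis using part_antimono[OF assms(9), of i "Suc i"] by (simp add: tau1)
      next
        case 2
        \<comment> \<open>The seam: parts of \<nu> are at least m - k, the next part of \<lambda> is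
          at most m - k.\<close>
        have "int (lam (l + b)) \<le> int m - k" using mn_index_rest[OF assms(4,5)] nk(2) by simp
        thus ?thesis using nu_ge[of i] tau1[of i] tau2[of 0] 2 by simp
      next
        case 3
        then obtain j where "i = b + j" using le_Suc_ex by blast
        thus ?thesis using tau2[of j] tau2[of "Suc j"] part_antimono[OF assms(4), of "l + b + j" "l + b + Suc j"] by simp
      qed
    qed
    show "finite {i. \<tau> i \<noteq> 0}"
    proof (rule finite_subset)
      show "{i. \<tau> i \<noteq> 0} \<subseteq> {..<b + part_length lam}"
      proof (rule subsetI, rule ccontr)
        fix i assume i: "i \<in> {i. \<tau> i \<noteq> 0}" "i \<notin> {..<b + part_length lam}"
        then obtain j where "i = b + j" "part_length lam \<le> j" using le_Suc_ex[of b i] by auto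
        thus False using i part_zero[OF assms(4), of "l + b + j"] by (simp add: tau2)
      qed
    qed simp
  qed

  define N where "N = l + (b + part_length lam)"
  \<comment> \<open>The row offsets of \<lambda>, with the first l + b rows in the order of \<mu>
    and \<nu>. Removing l + b - 1 - i from a shifted part and then subtracting i amounts to the
    constant - (l + b) + 1.\<close>
  define \<alpha> where "\<alpha> = (\<lambda>i. if i < l + b then int ((add_rho l \<mu> @ add_rho b \<nu>) ! i) - int (l + b) + 1
    else int (lam i) - int i)"
  have card: "card A = n" unfolding A_def using assms(1,2) by (simp add: card_image distinct_card)
  have finA: "finite A" by (simp add: A_def)
  have lamN: "lam N = 0" by (rule part_zero[OF assms(4)]) (simp add: N_def)
  have tauN: "\<tau> (b + part_length lam) = 0" unfolding tau2 by (rule part_zero[OF assms(4)]) simp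
  have hs: "hser (map uminus xs) * eser Y = hs (uminus ` set xs) Y" if "distinct xs" for xs
  proof -
    have "distinct (map uminus xs)" using that by (simp add: distinct_map)
    from hser_eq_hs[OF this] show ?thesis by (simp add: hs_def eser_def)
  qed
  have pN: "p permutes {..<N}" by (rule permutes_subset[OF p(1)]) (auto simp: N_def)
  have rows: "int (lam i) - int i = \<alpha> (p i)" for i
  proof (cases "i < l + b")
    case True
    have "p i < l + b" by (rule permutes_lessThan[OF p(1) True])
    hence "\<alpha> (p i) = int (plus_rho (l + b) \<kappa> i) - int (l + b) + 1" using p(3)[OF True] by (simp add: \<alpha>_def)
    thus ?thesis using True by (simp add: plus_rho_def kap of_nat_diff)
  next
    case False
    hence "p i = i" using p(1) by (simp add: permutes_def)
    thus ?thesis using False by (simp add: \<alpha>_def)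
  qed
  \<comment> \<open>The offset is \<mu>_i - i - b, and n - l = k + b turns it into \<mu>_i + k - i.
    This is the origin of the rectangle.\<close>
  have al: "\<alpha> i + int n - int l = int (\<sigma> i) - int i" if "i < l" for i
    using that nk(1) sig[OF that] by (simp add: \<alpha>_def nth_append add_rho_nth plus_rho_def of_nat_diff)
  \<comment> \<open>The shift by l makes up for the l rows in front, both for \<nu> and for the
    lower rows of \<lambda>.\<close>
  have al': "\<alpha> (l + i) + int l = int (\<tau> i) - int i" for i
  proof (cases "i < b")
    case True
    thus ?thesis by (simp add: \<alpha>_def nth_append add_rho_nth plus_rho_def of_nat_diff tau1)
  next
    case False
    then obtain j where "i = b + j" using le_Suc_ex[of b i] by auto
    thus ?thesis by (simp add: \<alpha>_def tau2 add_ac)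
  qed
  have "LS lam (map uminus X) Y = jtp N lam (hs A Y)"
    by (simp add: LS_jacobi_trudi[OF assms(4) lamN] hs assms(2) A_def)
  also have "\<dots> = of_int (sign p) * jt N \<alpha> (hs A Y)"
    unfolding jtp_def jt_def rows by (rule detf_permute_rows[OF pN])
  also have "jt N \<alpha> (hs A Y) = (\<Sum>S | S \<subseteq> A \<and> card S = l.
    jt l (\<lambda>i. \<alpha> i + int (card A) - int l) (hs S Y) *
    jt (b + part_length lam) (\<lambda>i. \<alpha> (l + i) + int l) (hs (A - S) Y) / (\<Prod>s\<in>S. \<Prod>t\<in>A - S. s - t))"
    unfolding N_def
  proof (rule jt_expand_rows[OF finA])
    fix i assume i: "i < l"
    \<comment> \<open>Here (m - k) - (n - k) + 1 = m - n + 1, so the index gives exactly the bound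
      of partial fractions.\<close>
    show "int (length Y) - int (card A) + 1 \<le> \<alpha> i"
      using mu_rho[OF i] i nk(1) by (simp add: \<alpha>_def nth_append add_rho_nth card assms(3))
  qed
  also have "\<dots> = (\<Sum>S | S \<subseteq> A \<and> card S = l.
    jtp l \<sigma> (hs S Y) * jtp (b + part_length lam) \<tau> (hs (A - S) Y) / (\<Prod>s\<in>S. \<Prod>t\<in>A - S. s - t))"
    unfolding al' jtp_def jt_def card
    by (intro sum.cong refl arg_cong2[where f = "(/)"] arg_cong2[where f = "(*)"] detf_cong) (simp add: al)
  also have "\<dots> = (\<Sum>I | I \<subseteq> {..<length (map uminus X)} \<and> card I = l.
    jtp l \<sigma> (hs ((!) (map uminus X) ` I) Y) * jtp (b + part_length lam) \<tau> (hs (A - (!) (map uminus X) ` I) Y) /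
      (\<Prod>s\<in>(!) (map uminus X) ` I. \<Prod>t\<in>A - (!) (map uminus X) ` I. s - t))"
    by (subst sum_subsets_index) (use assms(2) in \<open>auto simp: distinct_map A_def\<close>)
  also have "of_int (sign p) * \<dots> = (\<Sum>I | I \<subseteq> {..<n} \<and> card I = l.
      let S = nths X I; T = nths X ({..<n} - I) in
      of_int (overlap_sign l b \<mu> \<nu>) * LS \<sigma> (map uminus S) Y * LS \<tau> (map uminus T) Y / Delta T S)"
    unfolding sum_distrib_left length_map assms(1)
  proof (rule sum.cong[OF refl])
    fix I assume "I \<in> {I. I \<subseteq> {..<n} \<and> card I = l}"
    hence I: "I \<subseteq> {..<n}" by simp
    define S T where "S = nths X I" and "T = nths X ({..<n} - I)"
    have dist: "distinct S" "distinct T" using assms(2) by (simp_all add: S_def T_def)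
    have S: "uminus ` set S = (!) (map uminus X) ` I"
      using I unfolding S_def by (subst set_nths_index) (auto simp: assms(1) image_image intro!: image_cong)
    have inj: "inj_on ((!) X) {..<n}" using assms(1,2) by (simp add: inj_on_nth)
    have "set T = (!) X ` ({..<n} - I)" unfolding T_def by (rule set_nths_index) (auto simp: assms(1))
    also have "\<dots> = (!) X ` {..<n} - (!) X ` I" using inj I by (simp add: inj_on_image_set_diff)
    also have "(!) X ` {..<n} = set X" using assms(1) by (auto simp: in_set_conv_nth)
    also have "(!) X ` I = set S" unfolding S_def by (rule set_nths_index[symmetric]) (use I assms(1) in simp)
    finally have "uminus ` set T = A - uminus ` set S"
      unfolding A_def by (simp only: image_set_diff[OF injI[OF neg_equal_iff_equal[THEN iffD1]]])
    hence T: "uminus ` set T = A - (!) (map uminus X) ` I" by (simp only: S)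
    have LS1: "LS \<sigma> (map uminus S) Y = jtp l \<sigma> (hs (uminus ` set S) Y)"
      by (simp only: LS_jacobi_trudi[OF sig_part sig0[OF order_refl]] hs[OF dist(1)])
    have LS2: "LS \<tau> (map uminus T) Y = jtp (b + part_length lam) \<tau> (hs (uminus ` set T) Y)"
      by (simp only: LS_jacobi_trudi[OF tau_part tauN] hs[OF dist(2)])
    show "of_int (sign p) * (jtp l \<sigma> (hs ((!) (map uminus X) ` I) Y) *
        jtp (b + part_length lam) \<tau> (hs (A - (!) (map uminus X) ` I) Y) /
        (\<Prod>s\<in>(!) (map uminus X) ` I. \<Prod>t\<in>A - (!) (map uminus X) ` I. s - t)) =
      (let S = nths X I; T = nths X ({..<n} - I) in
        of_int (overlap_sign l b \<mu> \<nu>) * LS \<sigma> (map uminus S) Y * LS \<tau> (map uminus T) Y / Delta T S)"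
      unfolding S_def[symmetric] T_def[symmetric] Let_def LS1 LS2 Delta_distinct[OF dist] S T p(2)
      by simp
  qed
  finally show ?thesis unfolding \<sigma>_def \<tau>_def b_def[symmetric] nk(2) .
qed

end
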